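(* Let $\ell\in\mathbb{N}$, let $(X,\mathcal{B},\mu,T_1,\ldots,T_\ell)$ be a system and let $f\in L^2(\mu)$. Let $g_1,\ldots,g_\ell\in\mathcal{T}$ satisfy $g_\ell\prec\cdots\prec g_1$ and be such that $\sum_{i=1}^{\ell}\lambda_i g_i\in\mathcal{T}$ for all $(\lambda_1,\ldots,\lambda_\ell)\in\mathbb{R}^\ell\setminus\{\vec 0\}$. Then $$\lim_{N\to\infty}\left\|\frac{1}{N}\sum_{n=1}^N T_1^{[g_1(n)]}\cdots T_\ell^{[g_\ell(n)]}f-Pf\right\|_{L^2(\mu)}=0,$$ where $P$ denotes the (orthogonal) projection onto the closed subspace $\{f\in L^2(\mu): T_if=f\text{ for all }1\le i\le\ell\}$.
   Context: $\omega=\{0,1,2,\ldots\}$, $\mathbb{N}=\{1,2,\ldots\}$. A system $(X,\mathcal{B},\mu,T_1,\ldots,T_\ell)$ is a probability space $(X,\mathcal{B},\mu)$ with invertible measure preserving transformations $T_i:X\to X$ that commute: $T_iT_j=T_jT_i$ for all $i,j$. $Tf:=f\circ T$. $[x]$ is the largest integer $\le x$. $\mathbb{R}^+$ denotes some half-line $[x_0,\infty)$, $x_0\ge0$ (allowed to depend on the function); all statements about functions concern sufficiently large $x$ (values of $g(n)$ for finitely many $n$ are irrelevant). $g_2\prec g_1$ means $|g_1(x)|/|g_2(x)|\to\infty$ as $x\to\infty$. $\mathcal{R}:=\{g\in C^\infty(\mathbb{R}^+):\ \lim_{x\to\infty}\frac{xg^{(j+1)}(x)}{g^{(j)}(x)}\in\mathbb{R}\text{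 for all }j\in\omega\}$ (real-valued functions; the limits are required to exist and be finite). For $i\in\omega$, $\mathcal{T}_i:=\{g\in\mathcal{R}:\ \text{there is }\alpha\text{ with } i<\alpha\le i+1,\ \lim_{x\to\infty}\frac{xg'(x)}{g(x)}=\alpha,\ \text{and}\ \lim_{x\to\infty}g^{(i+1)}(x)=0\}$, and $\mathcal{T}:=\bigcup_{i=0}^\infty\mathcal{T}_i$. *)

theory Defs
  imports "HOL-Probability.Probability"
begin

section \<open>Measure preserving systems\<close>

definition invertible_mpt :: "'a measure \<Rightarrow> ('a \<Rightarrow> 'a) \<Rightarrow> bool" where
  "invertible_mpt M S \<longleftrightarrow>
     bij_betw S (space M) (space M) \<and>
     S \<in> measurable M M \<and>
     inv_into (space M) S \<in> measurable M M \<and>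
     distr M M S = M"

definition mp_system :: "'a measure \<Rightarrow> nat \<Rightarrow> (nat \<Rightarrow> 'a \<Rightarrow> 'a) \<Rightarrow> bool" where
  "mp_system M l T \<longleftrightarrow>
     prob_space M \<and>
     (\<forall>i\<in>{1..l}. invertible_mpt M (T i)) \<and>
     (\<forall>i\<in>{1..l}. \<forall>j\<in>{1..l}. \<forall>x\<in>space M. T i (T j x) = T j (T i x))"

definition int_iter :: "'a measure \<Rightarrow> ('a \<Rightarrow> 'a) \<Rightarrow> int \<Rightarrow> 'a \<Rightarrow> 'a" where
  "int_iter M S k =
     (if k \<ge> 0 then S ^^ nat k else inv_into (space M) S ^^ nat (- k))"

text \<open>The function \<open>T\<^sub>1\<^bsup>k 1\<^esup> \<dots> T\<^sub>l\<^bsup>k l\<^esup> f\<close>, each transformation acting by \<open>S h = h \<circ> S\<close>.\<close>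

definition koopman_prod ::
  "'a measure \<Rightarrow> nat \<Rightarrow> (nat \<Rightarrow> 'a \<Rightarrow> 'a) \<Rightarrow> (nat \<Rightarrow> int) \<Rightarrow> ('a \<Rightarrow> complex) \<Rightarrow> 'a \<Rightarrow> complex" where
  "koopman_prod M l T k f = foldr (\<lambda>i h. h \<circ> int_iter M (T i) (k i)) [1..<Suc l] f"


section \<open>Square integrable functions\<close>

text \<open>Elements of \<open>L\<^sup>2\<close> are represented by functions; equality in \<open>L\<^sup>2\<close> is equality
  almost everywhere.\<close>

definition L2_space :: "'a measure \<Rightarrow> ('a \<Rightarrow> complex) set" where
  "L2_space M = {f \<in> borel_measurable M. integrable M (\<lambda>x. (norm (f x))\<^sup>2)}"

definition L2_norm :: "'a measure \<Rightarrow> ('a \<Rightarrow> complex) \<Rightarrow> real" where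
  "L2_norm M f = sqrt (\<integral>x. (norm (f x))\<^sup>2 \<partial>M)"

definition L2_inner :: "'a measure \<Rightarrow> ('a \<Rightarrow> complex) \<Rightarrow> ('a \<Rightarrow> complex) \<Rightarrow> complex" where
  "L2_inner M f h = (\<integral>x. f x * cnj (h x) \<partial>M)"

definition invariant_L2 ::
  "'a measure \<Rightarrow> nat \<Rightarrow> (nat \<Rightarrow> 'a \<Rightarrow> 'a) \<Rightarrow> ('a \<Rightarrow> complex) set" where
  "invariant_L2 M l T = {f \<in> L2_space M. \<forall>i\<in>{1..l}. AE x in M. f (T i x) = f x}"

text \<open>A representative of the orthogonal projection of \<open>f\<close> onto the closed subspace \<open>V\<close>;
  it is determined up to equality almost everywhere.\<close>

definition L2_proj ::
  "'a measure \<Rightarrow> ('a \<Rightarrow> complex) set \<Rightarrow> ('a \<Rightarrow> complex) \<Rightarrow> 'a \<Rightarrow> complex" where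
  "L2_proj M V f = (SOME p. p \<in> V \<and> (\<forall>h\<in>V. L2_inner M (\<lambda>x. f x - p x) h = 0))"


section \<open>Tempered functions\<close>

text \<open>A function on a half-line is a total function whose values below the half-line are
  arbitrary. The open half-line \<open>x > x0\<close> avoids one-sided derivatives at the end point; as
  \<open>x0\<close> may be enlarged, this does not affect membership in the classes below.\<close>

definition smooth_on_half_line :: "(real \<Rightarrow> real) \<Rightarrow> bool" where
  "smooth_on_half_line g \<longleftrightarrow>
     (\<exists>x0\<ge>0. \<forall>j. \<forall>x>x0. (deriv ^^ j) g differentiable at x)"

text \<open>Since \<open>x / 0 = 0\<close> in HOL, that the quotients are defined for large \<open>x\<close> is required
  explicitly.\<close>

definition class_R :: "(real \<Rightarrow> real) set" where
  "class_R = {g. smooth_on_half_line g \<and>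
     (\<forall>j. (\<forall>\<^sub>F x in at_top. (deriv ^^ j) g x \<noteq> 0) \<and>
          (\<exists>c::real. ((\<lambda>x. x * (deriv ^^ Suc j) g x / (deriv ^^ j) g x) \<longlongrightarrow> c) at_top))}"

definition class_T_at :: "nat \<Rightarrow> (real \<Rightarrow> real) set" where
  "class_T_at i = {g \<in> class_R.
     (\<exists>\<alpha>::real. real i < \<alpha> \<and> \<alpha> \<le> real i + 1 \<and>
        ((\<lambda>x. x * deriv g x / g x) \<longlongrightarrow> \<alpha>) at_top) \<and>
     ((deriv ^^ Suc i) g \<longlongrightarrow> 0) at_top}"

definition class_T :: "(real \<Rightarrow> real) set" where
  "class_T = (\<Union>i. class_T_at i)"

text \<open>\<open>grows_slower g2 g1\<close> is \<open>g2 \<prec> g1\<close>; as \<open>x / 0 = 0\<close>, it entails that \<open>g2\<close> is eventually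
  nonzero.\<close>

definition grows_slower :: "(real \<Rightarrow> real) \<Rightarrow> (real \<Rightarrow> real) \<Rightarrow> bool" where
  "grows_slower g2 g1 \<longleftrightarrow> filterlim (\<lambda>x. \<bar>g1 x\<bar> / \<bar>g2 x\<bar>) at_top at_top"

end

theory Submission
  imports Defs
begin

text \<open>Replacing \<open>f\<close> by \<open>f - Pf\<close>, one has to show that the averages of an \<open>f\<close> orthogonal to the invariant functions
  tend to zero. Spectrally this reduces to the exponential sums with phase \<open>\<Sum>i. \<theta> i * \<lfloor>g i n\<rfloor>\<close>, which have mean zero
  unless all \<open>\<theta> i\<close> are integers: a function in \<open>class_T_at m\<close> has \<open>(m + 1)\<close>-st differences decreasing to zero more
  slowly than \<open>1 / n\<close>, so van der Corput's difference trick and Fejer's theorem apply to linear combinations of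
  the \<open>g i\<close>, and the integer parts are removed by trigonometric approximation.

  In place of a spectral measure we use the positive functional \<open>\<Lambda>\<close> on trigonometric polynomials with
  \<open>\<Lambda> (\<bar>p\<bar>\<^sup>2) = \<parallel>p(T) f\<parallel>\<^sup>2\<close>. The exponential means need not tend to zero locally uniformly away from the integers,
  so bounded convergence for \<open>\<Lambda>\<close> is required; Eberlein's argument gives it without countable additivity. The atom at
  the integers is removed by a convex combination \<open>q\<close> of characters, equal to 1 there, for which \<open>q(T) f\<close> is small;
  it exists by the mean ergodic theorem.\<close>

section \<open>Means and van der Corput's lemma\<close>

text \<open>The construction is arranged so that one pointwise statement on the frequency torus
  suffices. With \<open>A\<close> the exponential mean, the product of \<open>A\<close> and
  \<open>1 - q\<close> tends to zero at every frequency: off the integer points because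
  \<open>A\<close> does, at the integer points because the factor \<open>1 - q\<close> vanishes
  there for every \<open>N\<close>. The remaining part of the average comes from
  \<open>q(T) f\<close>, and averaging along the action cannot enlarge its norm. The split into
  integer and other frequencies comes from the integer parts: trading
  \<open>\<lfloor>y\<rfloor>\<close> with frequency \<open>\<theta>\<close> for \<open>y\<close>
  itself costs integer shifts, so the coefficients met are \<open>\<theta> + m\<close>. They are all
  nonzero exactly when \<open>\<theta>\<close> is not an integer, and then the linear combination
  left over lies in \<open>class_T\<close>. Differences are taken of functions of a real variable,
  where the mean value theorem turns a monotone derivative into a monotone difference.\<close>

definition has_mean :: "(nat \<Rightarrow> complex) \<Rightarrow> complex \<Rightarrow> bool" where
  "has_mean u L \<longleftrightarrow> (\<lambda>N. (\<Sum>n=1..N. u n) / of_nat N) \<longlonglongrightarrow> L"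

lemma has_mean_add: "has_mean u a \<Longrightarrow> has_mean v b \<Longrightarrow> has_mean (\<lambda>n. u n + v n) (a + b)"
  unfolding has_mean_def by (drule (1) tendsto_add) (simp add: sum.distrib add_divide_distrib)

lemma has_mean_cmult: "has_mean u a \<Longrightarrow> has_mean (\<lambda>n. c * u n) (c * a)"
  unfolding has_mean_def
  by (drule tendsto_mult_left[where c = c]) (simp add: sum_distrib_left[symmetric])

lemma has_mean_const: "has_mean (\<lambda>n. c) c"
  unfolding has_mean_def
  by (rule tendsto_eventually) (use eventually_gt_at_top[of 0] in eventually_elim, simp)

lemma has_mean_sum:
  assumes "\<And>i. i \<in> I \<Longrightarrow> has_mean (u i) (a i)"
  shows "has_mean (\<lambda>n. \<Sum>i\<in>I. u i n) (\<Sum>i\<in>I. a i)"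
  using assms
proof (induction I rule: infinite_finite_induct)
  case (insert x F)
  then show ?case by (auto intro: has_mean_add)
qed (use has_mean_const[of 0] in auto)

lemma has_mean_cnj: "has_mean u a \<Longrightarrow> has_mean (\<lambda>n. cnj (u n)) (cnj a)"
  unfolding has_mean_def by (drule tendsto_cnj) simp

lemma has_mean_zeroI:
  assumes "\<And>e. e > 0 \<Longrightarrow> eventually (\<lambda>N. norm ((\<Sum>n=1..N. u n) / of_nat N) \<le> e) sequentially"
  shows "has_mean u 0"
  unfolding has_mean_def tendsto_iff
proof safe
  fix e :: real assume "e > 0"
  then show "eventually (\<lambda>N. dist ((\<Sum>n=1..N. u n) / of_nat N) 0 < e) sequentially"
    using assms[of "e/2"] by (auto elim!: eventually_mono)
qed

lemma sum_shift_diff: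
  fixes u :: "nat \<Rightarrow> complex"
  assumes "\<And>n. norm (u n) \<le> 1"
  shows "norm ((\<Sum>n=1..N. u (n + h)) - (\<Sum>n=1..N. u n)) \<le> 2 * real h"
proof (induction h)
  case (Suc h)
  have "(\<Sum>n=1..N. u (n + Suc h)) = (\<Sum>n=1..N. u (n + h)) + u (Suc (N + h)) - u (Suc h)"
    by (induction N) (auto simp: algebra_simps)
  then have "(\<Sum>n=1..N. u (n + Suc h)) - (\<Sum>n=1..N. u n)
      = ((\<Sum>n=1..N. u (n + h)) - (\<Sum>n=1..N. u n)) + (u (Suc (N + h)) - u (Suc h))" by simp
  also have "norm \<dots> \<le> 2 * real h + (1 + 1)"
    by (intro norm_triangle_mono Suc.IH norm_triangle_le_diff add_mono assms)
  finally show ?case by simp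
qed simp

lemma has_mean_shift:
  assumes "has_mean u a" "\<And>n. norm (u n) \<le> 1"
  shows "has_mean (\<lambda>n. u (n + h)) a"
proof -
  have "(\<lambda>N. ((\<Sum>n=1..N. u (n + h)) - (\<Sum>n=1..N. u n)) / of_nat N) \<longlonglongrightarrow> 0"
  proof (rule Lim_null_comparison)
    show "eventually (\<lambda>N. norm (((\<Sum>n=1..N. u (n + h)) - (\<Sum>n=1..N. u n)) / of_nat N) \<le> 2 * real h / real N) sequentially"
      using sum_shift_diff[of u, OF assms(2)]
      by (intro always_eventually allI) (auto simp: norm_divide divide_right_mono)
  qed (rule lim_const_over_n)
  from tendsto_add[OF this assms(1)[unfolded has_mean_def]] show ?thesis
    by (simp add: has_mean_def diff_divide_distrib)
qed

lemma norm_sum_square_le: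
  fixes u :: "'b \<Rightarrow> complex"
  shows "(norm (\<Sum>n\<in>A. u n))\<^sup>2 \<le> card A * (\<Sum>n\<in>A. (norm (u n))\<^sup>2)"
proof -
  have "(norm (\<Sum>n\<in>A. u n))\<^sup>2 \<le> (\<Sum>n\<in>A. norm (u n))\<^sup>2"
    by (intro power_mono norm_sum) auto
  also have "\<dots> \<le> (\<Sum>n\<in>A. (norm (u n))\<^sup>2) * (\<Sum>n\<in>A. 1\<^sup>2)"
    using Cauchy_Schwarz_ineq_sum[of "\<lambda>n. norm (u n)" "\<lambda>_. 1" A] by simp
  finally show ?thesis by (simp add: mult.commute)
qed

text \<open>Averaging \<open>u\<close> over windows of length \<open>H\<close> hardly changes its
  mean. In the second moment of a window sum the diagonal contributes at most \<open>H\<close>,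
  against the trivial bound \<open>H^2\<close>, and the off-diagonal terms are correlations of mean
  zero. Cauchy-Schwarz over \<open>n\<close> thus bounds the mean of \<open>u\<close> by a multiple
  of \<open>1 / sqrt H\<close>.\<close>

lemma van_der_Corput:
  fixes u :: "nat \<Rightarrow> complex"
  assumes bnd: "\<And>n. norm (u n) \<le> 1"
    and corr: "\<And>d. d \<ge> 1 \<Longrightarrow> has_mean (\<lambda>n. u (n + d) * cnj (u n)) 0"
  shows "has_mean u 0"
proof (rule has_mean_zeroI)
  fix e :: real assume e: "e > 0"
  \<comment> \<open>The constant 8 makes \<open>2 * H\<close>, the bound for the normalised second
    moment, at most \<open>(e * H / 2)^2\<close>. The window sums then use one half of
    \<open>e * H\<close>, the shifts of the windows the other half.\<close>
  obtain H :: nat where "max 1 (8 / e\<^sup>2) < real H"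
    using reals_Archimedean2 by blast
  then have H: "H > 0" "8 / e\<^sup>2 < H" by auto
  define w where "w n = (\<Sum>h<H. u (n + h))" for n
  have corr': "has_mean (\<lambda>n. u (n + h) * cnj (u (n + h'))) 0" if "h \<noteq> h'" for h h'
  proof -
    have gt: "has_mean (\<lambda>n. u (n + h) * cnj (u (n + h'))) 0" if "h > h'" for h h'
    proof -
      have "has_mean (\<lambda>n. u ((n + h') + (h - h')) * cnj (u (n + h'))) 0"
        using that bnd
        by (intro has_mean_shift[where u = "\<lambda>n. u (n + (h - h')) * cnj (u n)"] corr)
          (auto simp: norm_mult intro: mult_le_one)
      then show ?thesis using that by (simp add: add.assoc)
    qed
    show ?thesis
    proof (cases "h > h'")
      case True then show ?thesis by (rule gt)
    next
      case False
      with that have "h' > h" by auto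
      from has_mean_cnj[OF gt[OF this]] show ?thesis by (simp add: mult.commute)
    qed
  qed
  define off where "off n = (\<Sum>h<H. \<Sum>h'<H. if h = h' then 0 else u (n + h) * cnj (u (n + h')))" for n
  have "has_mean off (\<Sum>h<H. \<Sum>h'<H. 0)" unfolding off_def
  proof (intro has_mean_sum)
    fix h h' show "has_mean (\<lambda>n. if h = h' then 0 else u (n + h) * cnj (u (n + h'))) 0"
      using corr'[of h h'] has_mean_const[of 0] by (cases "h = h'") auto
  qed
  then have off: "has_mean off 0" by simp
  have w2: "(norm (w n))\<^sup>2 \<le> H + Re (off n)" for n
  proof -
    have "complex_of_real ((norm (w n))\<^sup>2) = w n * cnj (w n)"
      by (rule complex_norm_square)
    also have "\<dots> = (\<Sum>h<H. \<Sum>h'<H. u (n + h) * cnj (u (n + h')))"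
      unfolding w_def by (simp add: sum_product)
    also have "\<dots> = (\<Sum>h<H. \<Sum>h'<H. (if h = h' then 0 else u (n + h) * cnj (u (n + h')))
        + (if h = h' then u (n + h) * cnj (u (n + h')) else 0))"
      by (intro sum.cong refl) auto
    also have "\<dots> = off n + (\<Sum>h<H. u (n + h) * cnj (u (n + h)))"
      unfolding off_def by (simp add: sum.distrib)
    also have "\<dots> = off n + of_real (\<Sum>h<H. (norm (u (n + h)))\<^sup>2)"
      by (simp only: complex_norm_square[symmetric] of_real_sum)
    finally have "(norm (w n))\<^sup>2 = Re (off n) + (\<Sum>h<H. (norm (u (n + h)))\<^sup>2)"
      by (metis Re_complex_of_real plus_complex.sel(1))
    also have "(\<Sum>h<H. (norm (u (n + h)))\<^sup>2) \<le> (\<Sum>h<H. 1)"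
      by (intro sum_mono) (use bnd in \<open>auto intro: power_le_one\<close>)
    finally show ?thesis by simp
  qed
  \<comment> \<open>A mean below 1 is below \<open>H\<close>: the off-diagonal part adds no more
    than the diagonal does.\<close>
  have "eventually (\<lambda>N. norm ((\<Sum>n=1..N. off n) / of_nat N) < 1) sequentially"
    using off unfolding has_mean_def tendsto_iff dist_norm by (auto dest: spec[of _ 1])
  \<comment> \<open>Each of the \<open>H\<close> shifts moves the sum by at most
    \<open>2 * H\<close>; for such \<open>N\<close> the total \<open>2 * H * H\<close> is at most
    \<open>N * e * H / 2\<close>.\<close>
  moreover have "eventually (\<lambda>N. real N > 4 * real H / e) sequentially"
    using filterlim_real_sequentially by (auto simp: filterlim_at_top_dense)
  ultimately show "eventually (\<lambda>N. norm ((\<Sum>n=1..N. u n) / of_nat N) \<le> e) sequentially"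
    using eventually_gt_at_top[of 0]
  proof eventually_elim
    case (elim N)
    define a where "a = (\<Sum>n=1..N. u n)"
    define b where "b = (\<Sum>n=1..N. w n)"
    have "b = (\<Sum>h<H. \<Sum>n=1..N. u (n + h))" unfolding b_def w_def by (rule sum.swap)
    then have "b - of_nat H * a = (\<Sum>h<H. (\<Sum>n=1..N. u (n + h)) - a)"
      by (simp add: sum_subtractf)
    also have "norm \<dots> \<le> (\<Sum>h<H. 2 * real H)"
      unfolding a_def
      by (intro sum_norm_le order_trans[OF sum_shift_diff[of u, OF bnd]]) auto
    finally have ba: "norm (b - of_nat H * a) \<le> 2 * real H * real H" by simp
    have offle: "Re (\<Sum>n=1..N. off n) \<le> real N * real H"
    proof -
      have "Re (\<Sum>n=1..N. off n) \<le> norm (\<Sum>n=1..N. off n)" by (rule complex_Re_le_cmod)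
      also have "\<dots> \<le> real N * 1" using elim by (simp add: norm_divide field_simps)
      also have "\<dots> \<le> real N * real H" using H by (intro mult_left_mono) auto
      finally show ?thesis by simp
    qed
    have "(norm b)\<^sup>2 \<le> N * (\<Sum>n=1..N. (norm (w n))\<^sup>2)"
      unfolding b_def using norm_sum_square_le[of w "{1..N}"] by simp
    also have "\<dots> \<le> N * (\<Sum>n=1..N. H + Re (off n))"
      by (intro mult_left_mono sum_mono w2) auto
    also have "(\<Sum>n=1..N. H + Re (off n)) = N * H + Re (\<Sum>n=1..N. off n)"
      by (simp add: sum.distrib)
    also have "real N * (real (N * H) + Re (\<Sum>n=1..N. off n)) \<le> real N * (real (N * H) + real N * real H)"
      using offle by (intro mult_left_mono add_left_mono) auto
    finally have "(norm b)\<^sup>2 \<le> (real N)\<^sup>2 * (2 * H)" by (simp add: power2_eq_square mult_ac)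
    also have "\<dots> \<le> (N * e * H / 2)\<^sup>2"
    proof -
      have "8 \<le> e\<^sup>2 * H" using H e by (simp add: field_simps)
      then have "8 * real H \<le> e\<^sup>2 * H * H" using H by (intro mult_right_mono) auto
      then have "(real N)\<^sup>2 * (8 * real H) \<le> (real N)\<^sup>2 * (e\<^sup>2 * H * H)" by (intro mult_left_mono) auto
      then show ?thesis by (simp add: power_mult_distrib power_divide power2_eq_square mult_ac)
    qed
    finally have "norm b \<le> N * e * H / 2" using e by (intro power2_le_imp_le[of "norm b"]) auto
    moreover have "2 * real H * real H \<le> N * e * H / 2"
      using elim e H by (simp add: field_simps)
    moreover have "norm (of_nat H * a) \<le> norm b + norm (b - of_nat H * a)"
      by (metis norm_minus_commute norm_triangle_sub)
    ultimately have "real H * norm a \<le> N * e * H / 2 + N * e * H / 2"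
      using ba unfolding norm_mult norm_of_nat by linarith
    then have "real H * norm a \<le> real H * (N * e)" by (simp add: mult_ac)
    then have "norm a \<le> N * e" using H by simp
    then show ?case using elim by (simp add: a_def norm_divide field_simps)
  qed
qed

section \<open>Fejer's theorem for slowly varying differences\<close>

definition e1 :: "real \<Rightarrow> complex" where "e1 x = cis (2 * pi * x)"

lemma norm_e1 [simp]: "norm (e1 x) = 1" by (simp add: e1_def)

lemma e1_add: "e1 (x + y) = e1 x * e1 y" by (simp add: e1_def cis_mult distrib_left)

lemma e1_minus: "e1 (- x) = cnj (e1 x)" by (simp add: e1_def cis_cnj)

lemma e1_diff: "e1 (x - y) = e1 x * cnj (e1 y)" using e1_add[of x "- y"] by (simp add: e1_minus)

lemma e1_0 [simp]: "e1 0 = 1" by (simp add: e1_def)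

lemma e1_of_int: "e1 (of_int k) = 1"
  using cis_multiple_2pi[of "of_int k"] by (simp add: e1_def)

lemma e1_neq_1: "e1 d \<noteq> 1" if "0 < d" "d < 1"
proof
  assume "e1 d = 1"
  then have "cos (2 * pi * d) = 1" by (simp add: e1_def complex_eq_iff)
  then obtain n :: int where "2 * pi * d = of_int n * 2 * pi" by (auto simp: cos_one_2pi_int)
  then have "d = of_int n" by simp
  with that show False by auto
qed

text \<open>Double-angle formulas, the sine being positive. What matters is the shape of the result:
  the real part is constant and the imaginary part is monotone in \<open>d\<close>, so that along
  monotone differences the total variation telescopes.\<close>

lemma inverse_e1_minus_1:
  assumes "0 < d" "d < 1"
  shows "inverse (e1 d - 1) = - 1/2 - (\<i> / 2) * of_real (cot (pi * d))"
proof -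
  have s: "sin (pi * d) > 0" using assms by (intro sin_gt_zero) auto
  have "e1 d - 1 = Complex (- 2 * (sin (pi*d))\<^sup>2) (2 * sin (pi*d) * cos (pi*d))"
    using cos_double_sin[of "pi*d"] sin_double[of "pi*d"]
    by (simp add: e1_def complex_eq_iff mult_ac)
  moreover have "- 1/2 - (\<i> / 2) * of_real (cot (pi * d)) = Complex (- 1/2) (- cot (pi*d) / 2)"
    by (simp add: complex_eq_iff)
  moreover have "Complex (- 2 * t\<^sup>2) (2 * t * c) * Complex (- 1/2) (- (c / t) / 2) = 1"
    if "t > 0" "t\<^sup>2 + c\<^sup>2 = 1" for t c :: real
    using that by (simp add: complex_eq_iff power2_eq_square)
  ultimately have "(e1 d - 1) * (- 1/2 - (\<i> / 2) * of_real (cot (pi * d))) = 1"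
    using s by (simp add: cot_def)
  then show ?thesis by (metis inverse_unique)
qed

lemma cot_bounds:
  assumes "0 < d" "d \<le> 1/2"
  shows "0 \<le> cot (pi * d)" "cot (pi * d) \<le> 1 / d"
proof -
  have s: "sin (pi * d) > 0" using assms by (intro sin_gt_zero) auto
  have c: "cos (pi * d) \<ge> 0" using assms by (intro cos_ge_zero order_trans[of "- (pi / 2)" 0 "pi * d"]) auto
  show "0 \<le> cot (pi * d)" using s c by (simp add: cot_def)
  show "cot (pi * d) \<le> 1 / d"
  proof -
    define t where "t = pi * d"
    have t: "0 \<le> t" "t \<le> pi" using assms by (auto simp: t_def)
    \<comment> \<open>The function \<open>sin t - t * cos t\<close> has derivative
      \<open>t * sin t\<close>. This gives \<open>cot t \<le> 1 / t\<close>; the factor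
      \<open>pi\<close> gained for \<open>t = pi * d\<close> is then given away.\<close>
    have "sin 0 - 0 * cos 0 \<le> sin t - t * cos t"
    proof (rule DERIV_nonneg_imp_nondecreasing[OF t(1), of "\<lambda>t. sin t - t * cos t"])
      fix y assume "0 \<le> y" "y \<le> t"
      then have "y * sin y \<ge> 0" using t by (intro mult_nonneg_nonneg sin_ge_zero) auto
      moreover have "((\<lambda>t. sin t - t * cos t) has_real_derivative y * sin y) (at y)"
        by (auto intro!: derivative_eq_intros)
      ultimately show "\<exists>z. ((\<lambda>t. sin t - t * cos t) has_real_derivative z) (at y) \<and> 0 \<le> z" by blast
    qed
    then have "pi * d * cos (pi * d) \<le> sin (pi * d)" by (simp add: t_def)
    moreover have "d * cos (pi * d) \<le> pi * d * cos (pi * d)" using assms c pi_gt3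
      by (intro mult_right_mono) auto
    ultimately have "d * cos (pi * d) \<le> sin (pi * d)" by simp
    then show ?thesis using s assms by (simp add: cot_def field_simps)
  qed
qed

lemma cot_antimono:
  assumes "0 < x" "x \<le> y" "y \<le> 1/2"
  shows "cot (pi * y) \<le> cot (pi * x)"
proof -
  have "sin (pi * x) \<le> sin (pi * y)" using assms by (intro sin_monotone_2pi_le) (use order_trans[of "- (pi / 2)" 0 "pi * x"] in auto)
  moreover have "cos (pi * y) \<le> cos (pi * x)" using assms by (intro cos_monotone_0_pi_le) auto
  moreover have "sin (pi * x) > 0" using assms by (intro sin_gt_zero) auto
  moreover have "cos (pi * y) \<ge> 0" using assms by (intro cos_ge_zero order_trans[of "- (pi / 2)" 0 "pi * y"]) auto
  ultimately show ?thesis unfolding cot_def by (intro frac_le) auto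
qed

text \<open>Abel summation. Dividing by \<open>e1 (D n) - 1\<close> writes each term as
  \<open>G n\<close> times a difference of consecutive terms, and summation by parts leaves two
  boundary terms and the variation of \<open>G\<close>. The latter telescopes because the cotangents
  of the decreasing differences increase, so everything is governed by the last, smallest
  difference. The constants are generous.\<close>

lemma Kusmin_Landau:
  fixes a :: "nat \<Rightarrow> real"
  assumes pos: "\<And>n. n \<ge> m \<Longrightarrow> 0 < a (Suc n) - a n" "\<And>n. n \<ge> m \<Longrightarrow> a (Suc n) - a n \<le> 1/2"
    and dec: "\<And>n. n \<ge> m \<Longrightarrow> a (Suc (Suc n)) - a (Suc n) \<le> a (Suc n) - a n"
  shows "norm (\<Sum>n=m..<m+k. e1 (a n)) \<le> 3 / (a (Suc (m + k)) - a (m + k)) + 3"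
proof -
  define D where "D n = a (Suc n) - a n" for n
  define G where "G n = inverse (e1 (D n) - 1)" for n
  have D: "0 < D n" "D n \<le> 1/2" if "n \<ge> m" for n using pos that by (auto simp: D_def)
  have G: "G n = - 1/2 - (\<i> / 2) * of_real (cot (pi * D n))" if "n \<ge> m" for n
    unfolding G_def using D[OF that] by (intro inverse_e1_minus_1) auto
  have GD: "norm (G n) \<le> 1/2 + 1 / (2 * D n)" if "n \<ge> m" for n
  proof -
    have "norm (G n) \<le> 1/2 + cot (pi * D n) / 2"
      unfolding G[OF that] using cot_bounds[OF D[OF that]]
      by (intro order_trans[OF norm_triangle_ineq4]) (simp add: norm_mult)
    then show ?thesis using cot_bounds(2)[OF D[OF that]] by simp
  qed
  have dG: "norm (G (Suc n) - G n) \<le> (cot (pi * D (Suc n)) - cot (pi * D n)) / 2" if "n \<ge> m" for n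
  proof -
    have "G (Suc n) - G n = - (\<i> / 2) * of_real (cot (pi * D (Suc n)) - cot (pi * D n))"
      using that by (simp add: G algebra_simps)
    also have "norm \<dots> = \<bar>cot (pi * D (Suc n)) - cot (pi * D n)\<bar> / 2"
      by (simp only: norm_mult norm_of_real) (simp add: norm_divide)
    also have "\<dots> = (cot (pi * D (Suc n)) - cot (pi * D n)) / 2"
      using cot_antimono[of "D (Suc n)" "D n"] that dec[of n] D[of n] D[of "Suc n"]
      by (auto simp: D_def)
    finally show ?thesis by simp
  qed
  have tele: "e1 (a n) = G n * (e1 (a (Suc n)) - e1 (a n))" if "n \<ge> m" for n
  proof -
    have "e1 (D n) \<noteq> 1" using D[OF that] by (intro e1_neq_1) auto
    moreover have "e1 (a (Suc n)) = e1 (a n) * e1 (D n)" by (simp add: D_def e1_add[symmetric])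
    ultimately show ?thesis by (simp add: G_def field_simps)
  qed
  have parts: "(\<Sum>n=m..<m+k. e1 (a n)) = G (m+k) * e1 (a (m+k)) - G m * e1 (a m)
      - (\<Sum>n=m..<m+k. (G (Suc n) - G n) * e1 (a (Suc n)))"
  proof (induction k)
    case (Suc k)
    then show ?case using tele[of "m + k"] by (simp add: algebra_simps)
  qed simp
  have "norm (\<Sum>n=m..<m+k. (G (Suc n) - G n) * e1 (a (Suc n)))
      \<le> (\<Sum>n=m..<m+k. (cot (pi * D (Suc n)) - cot (pi * D n)) / 2)"
    using dG by (intro sum_norm_le) (auto simp: norm_mult)
  also have "\<dots> = (cot (pi * D (m + k)) - cot (pi * D m)) / 2"
    by (induction k) (auto simp: field_simps)
  also have "\<dots> \<le> 1 / (2 * D (m + k))"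
    using cot_bounds[OF D, of "m+k"] cot_bounds[OF D, of m] by simp
  finally have 1: "norm (\<Sum>n=m..<m+k. (G (Suc n) - G n) * e1 (a (Suc n))) \<le> 1 / (2 * D (m + k))" .
  have "D (m + k) \<le> D m"
  proof (induction k)
    case (Suc k) then show ?case using dec[of "m+k"] by (simp add: D_def)
  qed simp
  then have 2: "1 / (2 * D m) \<le> 1 / (2 * D (m + k))" using D by (intro frac_le) auto
  have "norm (\<Sum>n=m..<m+k. e1 (a n)) \<le> norm (G (m+k)) + norm (G m) + 1 / (2 * D (m + k))"
    unfolding parts
    by (intro order_trans[OF norm_triangle_ineq4] add_mono 1) (auto simp: norm_mult)
  also have "\<dots> \<le> (1/2 + 1 / (2 * D (m + k))) + (1/2 + 1 / (2 * D (m + k))) + 1 / (2 * D (m + k))"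
    using GD[of m] GD[of "m+k"] 2 by (intro add_mono) auto
  also have "\<dots> \<le> 3 / D (m + k) + 3" using D[of "m+k"] by (simp add: field_simps)
  finally show ?thesis by (simp add: D_def)
qed

section \<open>Fejer's theorem and the reduction of higher differences to it\<close>

text \<open>The hypothesis of Fejer's theorem, to be imposed on a higher difference of the sequence.\<close>

definition slow :: "(nat \<Rightarrow> real) \<Rightarrow> bool" where
  "slow v \<longleftrightarrow> eventually (\<lambda>n. 0 < v n \<and> v (Suc n) \<le> v n) sequentially \<and> v \<longlonglongrightarrow> 0 \<and>
     filterlim (\<lambda>n. real n * v n) at_top sequentially"

definition fdiff :: "(nat \<Rightarrow> real) \<Rightarrow> nat \<Rightarrow> real" where
  "fdiff a n = a (Suc n) - a n"

lemma slow_shift: "slow v \<Longrightarrow> slow (\<lambda>n. v (n + d))"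
proof (induction d)
  case (Suc d)
  define w where "w n = v (n + d)" for n
  from Suc have w: "slow w" unfolding w_def by blast
  have 1: "eventually (\<lambda>n. 0 < w (Suc n) \<and> w (Suc (Suc n)) \<le> w (Suc n)) sequentially"
    using w unfolding slow_def by (subst eventually_sequentially_Suc) auto
  have 2: "(\<lambda>n. w (Suc n)) \<longlonglongrightarrow> 0" using w unfolding slow_def by (subst filterlim_sequentially_Suc) auto
  have "filterlim (\<lambda>n. real (Suc n) * w (Suc n)) at_top sequentially"
    using w unfolding slow_def by (subst filterlim_sequentially_Suc[of "\<lambda>n. real n * w n"]) auto
  \<comment> \<open>The factor has to become \<open>n\<close> instead of \<open>n + 1\<close>; the
    discrepancy \<open>w (Suc n)\<close> tends to zero.\<close>
  then have "filterlim (\<lambda>n. - w (Suc n) + real (Suc n) * w (Suc n)) at_top sequentially"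
    using tendsto_minus[OF 2] by (intro filterlim_tendsto_add_at_top) auto
  then have 3: "filterlim (\<lambda>n. real n * w (Suc n)) at_top sequentially"
    by (simp add: algebra_simps)
  show ?case using 1 2 3 by (simp add: slow_def w_def)
qed simp

lemma slow_add: "slow v \<Longrightarrow> slow w \<Longrightarrow> slow (\<lambda>n. v n + w n)"
  unfolding slow_def
proof (intro conjI)
  assume *: "(\<forall>\<^sub>F n in sequentially. 0 < v n \<and> v (Suc n) \<le> v n) \<and> v \<longlonglongrightarrow> 0 \<and>
      (LIM n sequentially. real n * v n :> at_top)"
    "(\<forall>\<^sub>F n in sequentially. 0 < w n \<and> w (Suc n) \<le> w n) \<and> w \<longlonglongrightarrow> 0 \<and>
      (LIM n sequentially. real n * w n :> at_top)"
  from *(1)[THEN conjunct1] *(2)[THEN conjunct1]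
  show "\<forall>\<^sub>F n in sequentially. 0 < v n + w n \<and> v (Suc n) + w (Suc n) \<le> v n + w n"
    by eventually_elim auto
  show "(\<lambda>n. v n + w n) \<longlonglongrightarrow> 0" using * by (auto intro: tendsto_add_zero)
  have "filterlim (\<lambda>n. real n * v n + real n * w n) at_top sequentially"
    using * by (intro filterlim_at_top_add_at_top) auto
  then show "filterlim (\<lambda>n. real n * (v n + w n)) at_top sequentially"
    by (simp add: distrib_left)
qed

lemma slow_sum: "(\<And>j. slow (\<lambda>n. v j n)) \<Longrightarrow> slow (\<lambda>n. \<Sum>j<Suc d. v j n)"
proof (induction d)
  case (Suc d)
  then show ?case using slow_add[of "\<lambda>n. \<Sum>j<Suc d. v j n" "v (Suc d)"] by simp
qed simp

text \<open>Once the differences lie below 1/2, the Kusmin-Landau bound is a multiple of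
  \<open>1 / fdiff a N\<close> up to a constant, and this is \<open>o(N)\<close> because
  \<open>N * fdiff a N\<close> tends to infinity.\<close>

lemma Fejer_mean:
  assumes "slow (fdiff a)"
  shows "has_mean (\<lambda>n. e1 (a n)) 0"
proof (rule has_mean_zeroI)
  fix e :: real assume e: "e > 0"
  have "eventually (\<lambda>n. fdiff a n < 1/2) sequentially"
    using assms by (intro order_tendstoD(2)[where y = 0]) (auto simp: slow_def)
  with assms have "eventually (\<lambda>n. 0 < fdiff a n \<and> fdiff a (Suc n) \<le> fdiff a n \<and> fdiff a n < 1/2) sequentially"
    unfolding slow_def by (auto elim: eventually_elim2)
  then have "eventually (\<lambda>n. 1 \<le> n \<and> 0 < fdiff a n \<and> fdiff a (Suc n) \<le> fdiff a n \<and> fdiff a n < 1/2) sequentially"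
    by (rule eventually_conj[OF eventually_ge_at_top])
  then obtain m where m: "\<And>n. n \<ge> m \<Longrightarrow> 1 \<le> n \<and> 0 < fdiff a n \<and> fdiff a (Suc n) \<le> fdiff a n \<and> fdiff a n < 1/2"
    by (auto simp: eventually_sequentially)
  have KL: "norm (\<Sum>n=m..<m+k. e1 (a n)) \<le> 3 / fdiff a (m + k) + 3" for k
    unfolding fdiff_def using m by (intro Kusmin_Landau) (auto simp: fdiff_def less_imp_le)
  \<comment> \<open>The two conditions allow \<open>e * N / 2\<close> each: one for
    \<open>3 / fdiff a N\<close>, the other for at most \<open>m\<close> initial terms, the last
    term and the additive 3.\<close>
  have "eventually (\<lambda>N. real N * fdiff a N \<ge> 6 / e) sequentially"
    using assms by (simp add: slow_def filterlim_at_top)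
  moreover have "eventually (\<lambda>N. real N \<ge> 2 * (m + 4) / e) sequentially"
    using filterlim_real_sequentially by (simp add: filterlim_at_top)
  ultimately show "eventually (\<lambda>N. norm ((\<Sum>n=1..N. e1 (a n)) / of_nat N) \<le> e) sequentially"
    using eventually_ge_at_top[of m]
  proof eventually_elim
    case (elim N)
    have dpos: "fdiff a N > 0" "N \<ge> 1" using m elim by auto
    have "{1..N} = insert N {1..<N}" using dpos by auto
    then have "(\<Sum>n=1..N. e1 (a n)) = (\<Sum>n=1..<N. e1 (a n)) + e1 (a N)" by simp
    also have "(\<Sum>n=1..<N. e1 (a n)) = (\<Sum>n=1..<m. e1 (a n)) + (\<Sum>n=m..<m+(N-m). e1 (a n))"
      using elim m[of m] by (simp add: sum.atLeastLessThan_concat)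
    finally have "norm (\<Sum>n=1..N. e1 (a n))
        \<le> norm (\<Sum>n=1..<m. e1 (a n)) + norm (\<Sum>n=m..<m+(N-m). e1 (a n)) + norm (e1 (a N))"
      by (metis (no_types, lifting) add_right_mono norm_triangle_ineq order_trans)
    also have "norm (\<Sum>n=1..<m. e1 (a n)) \<le> real m"
      by (rule order_trans[OF norm_sum]) simp
    finally have "norm (\<Sum>n=1..N. e1 (a n)) \<le> 3 / fdiff a N + (m + 4)"
      using KL[of "N - m"] elim by simp
    also have "3 / fdiff a N \<le> e * N / 2" using elim dpos e by (simp add: field_simps)
    also have "real (m + 4) \<le> e * N / 2" using elim e by (simp add: field_simps)
    finally show ?case using dpos by (simp add: norm_divide field_simps)
  qed
qed

text \<open>A van der Corput step lowers the order of the difference by one: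
  \<open>a (n + d) - a n\<close> is a sum of \<open>d\<close> shifts of \<open>fdiff a\<close>, so
  its differences of order \<open>i + 1\<close> are sums of shifts of those of order
  \<open>i + 2\<close> of \<open>a\<close>, and \<open>slow\<close> survives shifts and nonempty
  finite sums. In the end Fejer's theorem applies.\<close>

lemma slow_fdiff_mean:
  assumes "slow ((fdiff ^^ Suc i) a)"
  shows "has_mean (\<lambda>n. e1 (a n)) 0"
  using assms
proof (induction i arbitrary: a)
  case 0
  then show ?case by (intro Fejer_mean) simp
next
  case (Suc i)
  show ?case
  proof (rule van_der_Corput)
    fix d :: nat assume "d \<ge> 1"
    then obtain d' where d: "d = Suc d'" by (cases d) auto
    define b where "b n = a (n + d) - a n" for n
    have b: "b n = (\<Sum>j<Suc d'. fdiff a (n + j))" for n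
      unfolding b_def d using sum_lessThan_telescope[of "\<lambda>j. a (n + j)" "Suc d'"]
      by (simp add: fdiff_def)
    have "(fdiff ^^ m) (\<lambda>n. \<Sum>j\<in>J. w (n + j)) = (\<lambda>n. \<Sum>j\<in>J. (fdiff ^^ m) w (n + j))"
      for m w and J :: "nat set"
      by (induction m) (auto simp: fun_eq_iff fdiff_def sum_subtractf)
    from this[of "Suc i" "fdiff a" "{..<Suc d'}"]
    have "(fdiff ^^ Suc i) b = (\<lambda>n. \<Sum>j<Suc d'. (fdiff ^^ Suc (Suc i)) a (n + j))"
      unfolding b[abs_def] by (simp only: funpow_Suc_right o_def)
    moreover have "slow (\<lambda>n. \<Sum>j<Suc d'. (fdiff ^^ Suc (Suc i)) a (n + j))"
      by (intro slow_sum slow_shift Suc.prems)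
    ultimately have "has_mean (\<lambda>n. e1 (b n)) 0" by (intro Suc.IH) simp
    then show "has_mean (\<lambda>n. e1 (a (n + d)) * cnj (e1 (a n))) 0"
      by (simp add: b_def e1_diff)
  qed simp
qed

section \<open>Tempered functions\<close>

text \<open>The real-variable form of \<open>slow\<close>. Monotonicity is asked between arbitrary
  points beyond a threshold, not only at distance 1, since the mean value theorem produces unknown
  intermediate points.\<close>

definition rslow :: "(real \<Rightarrow> real) \<Rightarrow> bool" where
  "rslow u \<longleftrightarrow> (\<exists>x0. \<forall>x>x0. 0 < u x \<and> (\<forall>y\<ge>x. u y \<le> u x)) \<and> (u \<longlongrightarrow> 0) at_top \<and>
     filterlim (\<lambda>x. x * u x) at_top at_top"

definition rdiff :: "(real \<Rightarrow> real) \<Rightarrow> real \<Rightarrow> real" where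
  "rdiff F x = F (x + 1) - F x"

lemma filterlim_shift_real: "filterlim f F at_top \<Longrightarrow> filterlim (\<lambda>x::real. f (x + 1)) F at_top"
  by (rule filterlim_compose[of f F at_top], assumption)
    (use filterlim_tendsto_add_at_top[OF tendsto_const[of 1] filterlim_ident] in \<open>simp add: add.commute\<close>)

text \<open>By the mean value theorem \<open>rdiff F x\<close> is a value of the decreasing
  derivative \<open>u\<close> between \<open>x\<close> and \<open>x + 1\<close>, which squeezes it
  between \<open>u (x + 1)\<close> and \<open>u x\<close>. It decreases because its own derivative
  is \<open>u (z + 1) - u z\<close>.\<close>

lemma rslow_rdiff:
  assumes der: "\<And>x. x > x0 \<Longrightarrow> (F has_real_derivative u x) (at x)" and u: "rslow u"
  shows "rslow (rdiff F)"
proof -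
  obtain x1 where x1: "\<And>x. x > x1 \<Longrightarrow> 0 < u x" "\<And>x y. x > x1 \<Longrightarrow> x \<le> y \<Longrightarrow> u y \<le> u x"
    using u unfolding rslow_def by blast
  define x2 where "x2 = max (max x0 x1) 0"
  have bounds: "u (x + 1) \<le> rdiff F x" "rdiff F x \<le> u x" if "x > x2" for x
  proof -
    have "\<exists>z. x < z \<and> z < x + 1 \<and> F (x + 1) - F x = (x + 1 - x) * u z"
      using that by (intro MVT2 der) (auto simp: x2_def)
    then obtain z where "x < z" "z < x + 1" "rdiff F x = u z" by (auto simp: rdiff_def)
    then show "u (x + 1) \<le> rdiff F x" "rdiff F x \<le> u x"
      using that x1(2)[of x z] x1(2)[of z "x + 1"] by (auto simp: x2_def)
  qed
  have pos: "0 < rdiff F x" if "x > x2" for x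
    using bounds(1)[OF that] x1(1)[of "x + 1"] that by (simp add: x2_def)
  have dec: "rdiff F y \<le> rdiff F x" if "x > x2" "x \<le> y" for x y
  proof (rule DERIV_nonpos_imp_nonincreasing[OF that(2)])
    fix z assume z: "x \<le> z" "z \<le> y"
    have "(rdiff F has_real_derivative u (z + 1) - u z) (at z)"
      unfolding rdiff_def[abs_def] using z that
      by (auto intro!: derivative_eq_intros DERIV_chain'[of "\<lambda>x. x + 1", OF _ der] der simp: x2_def)
    moreover have "u (z + 1) - u z \<le> 0" using x1(2)[of z "z + 1"] z that by (simp add: x2_def)
    ultimately show "\<exists>d. (rdiff F has_real_derivative d) (at z) \<and> d \<le> 0" by blast
  qed
  have ev: "eventually (\<lambda>x. x > x2) at_top" by (rule eventually_gt_at_top)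
  have lim: "(rdiff F \<longlongrightarrow> 0) at_top"
  proof (rule tendsto_sandwich[of "\<lambda>_. 0" _ _ u])
    show "eventually (\<lambda>x. 0 \<le> rdiff F x) at_top" "eventually (\<lambda>x. rdiff F x \<le> u x) at_top"
      using ev by (eventually_elim, use pos bounds in \<open>auto simp: less_imp_le\<close>)+
  qed (use u in \<open>auto simp: rslow_def\<close>)
  have "filterlim (\<lambda>x. - u (x + 1) + (x + 1) * u (x + 1)) at_top at_top"
  proof (rule filterlim_tendsto_add_at_top)
    show "((\<lambda>x. - u (x + 1)) \<longlongrightarrow> - 0) at_top"
      using u by (intro tendsto_minus filterlim_shift_real) (simp add: rslow_def)
    show "filterlim (\<lambda>x. (x + 1) * u (x + 1)) at_top at_top"
      using u by (intro filterlim_shift_real[of "\<lambda>x. x * u x"]) (simp add: rslow_def)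
  qed
  then have "filterlim (\<lambda>x. x * u (x + 1)) at_top at_top" by (simp add: algebra_simps)
  then have "filterlim (\<lambda>x. x * rdiff F x) at_top at_top"
  proof (rule filterlim_at_top_mono)
    show "eventually (\<lambda>x. x * u (x + 1) \<le> x * rdiff F x) at_top"
      using ev by eventually_elim (use bounds in \<open>auto intro!: mult_left_mono simp: x2_def\<close>)
  qed
  with pos dec lim show ?thesis unfolding rslow_def by blast
qed

text \<open>Differencing commutes with differentiation: the derivative of the \<open>m\<close>-th
  difference of \<open>G 0\<close> is the \<open>m\<close>-th difference of \<open>G 1\<close>,
  which is slow by induction, and \<open>rslow_rdiff\<close> supplies one more difference. A chain
  \<open>G\<close> of successive derivatives is carried instead of iterates of \<open>deriv\<close>,
  so that it can be shifted and negated.\<close>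

lemma rslow_rdiff_iter:
  assumes "\<And>j x. x > x0 \<Longrightarrow> (G j has_real_derivative G (Suc j) x) (at x)" and "rslow (G m)"
  shows "rslow ((rdiff ^^ m) (G 0))"
  using assms
proof (induction m arbitrary: G)
  case (Suc m)
  have "((rdiff ^^ m) (G 0) has_real_derivative (rdiff ^^ m) (G (Suc 0)) x) (at x)" if "x > x0" for x
    using that
  proof (induction m arbitrary: x)
    case (Suc m)
    have "((\<lambda>x. (rdiff ^^ m) (G 0) (x + 1) - (rdiff ^^ m) (G 0) x) has_real_derivative
        (rdiff ^^ m) (G (Suc 0)) (x + 1) - (rdiff ^^ m) (G (Suc 0)) x) (at x)"
      using Suc.IH[of x] Suc.IH[of "x + 1"] Suc.prems by (intro DERIV_diff) (auto simp: DERIV_shift)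
    then show ?case by (simp add: rdiff_def[abs_def])
  qed (use Suc.prems in auto)
  then show ?case using Suc.IH[of "\<lambda>j. G (Suc j)"] Suc.prems
    by (auto intro!: rslow_rdiff)
qed simp

lemma slow_of_rslow:
  assumes "rslow u"
  shows "slow (\<lambda>n. u (real n))"
proof -
  obtain x1 where x1: "\<And>x. x > x1 \<Longrightarrow> 0 < u x \<and> (\<forall>y\<ge>x. u y \<le> u x)"
    using assms unfolding rslow_def by blast
  have "eventually (\<lambda>n. real n > x1) sequentially"
    using filterlim_real_sequentially by (simp add: filterlim_at_top_dense)
  then have "eventually (\<lambda>n. 0 < u (real n) \<and> u (real (Suc n)) \<le> u (real n)) sequentially"
    by eventually_elim (use x1 in auto)
  with assms show ?thesis
    unfolding slow_def rslow_def
    by (auto intro: filterlim_compose[OF _ filterlim_real_sequentially])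
qed

lemma rslow_chain_mean:
  assumes "\<And>j x. x > x0 \<Longrightarrow> (G j has_real_derivative G (Suc j) x) (at x)" and "rslow (G (Suc i))"
  shows "has_mean (\<lambda>n. e1 (G 0 (real n))) 0"
proof (rule slow_fdiff_mean)
  have "(fdiff ^^ m) (\<lambda>n. G 0 (real n)) = (\<lambda>n. (rdiff ^^ m) (G 0) (real n))" for m
    by (induction m) (auto simp: fdiff_def rdiff_def fun_eq_iff add.commute)
  then show "slow ((fdiff ^^ Suc i) (\<lambda>n. G 0 (real n)))"
    using slow_of_rslow[OF rslow_rdiff_iter[where G = G, OF assms]] by metis
qed

section \<open>Signs and growth exponents of derivatives\<close>

lemma eventually_constant_sign:
  fixes F :: "real \<Rightarrow> real"
  assumes "\<And>x. x > x0 \<Longrightarrow> isCont F x" "eventually (\<lambda>x. F x \<noteq> 0) at_top"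
  shows "eventually (\<lambda>x. F x > 0) at_top \<or> eventually (\<lambda>x. F x < 0) at_top"
proof -
  obtain x1 where x1: "\<And>x. x \<ge> x1 \<Longrightarrow> F x \<noteq> 0" using assms(2) by (auto simp: eventually_at_top_linorder)
  define x2 where "x2 = max x1 (x0 + 1)"
  have iv: "\<not> (F a * F b < 0)" if "x2 \<le> a" "x2 \<le> b" for a b
  proof
    assume neg: "F a * F b < 0"
    have "connected (F ` {x2..})"
      using assms(1) by (intro connected_continuous_image continuous_at_imp_continuous_on ballI)
        (auto simp: x2_def)
    then have "\<exists>c\<ge>x2. F c = 0"
      using neg that connectedD_interval[of "F ` {x2..}" "F a" "F b" 0] connectedD_interval[of "F ` {x2..}" "F b" "F a" 0]
      by (force simp: mult_less_0_iff)
    then show False using x1 by (auto simp: x2_def)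
  qed
  have nz: "F x \<noteq> 0" if "x2 \<le> x" for x using x1 that by (auto simp: x2_def)
  show ?thesis
  proof (cases "F x2 > 0")
    case True
    then have "F x > 0" if "x \<ge> x2" for x using iv[of x2 x] nz[of x] that by (auto simp: mult_less_0_iff not_less)
    then show ?thesis by (auto simp: eventually_at_top_linorder)
  next
    case False
    then have "F x2 < 0" using nz[of x2] by auto
    then have "F x < 0" if "x \<ge> x2" for x using iv[of x2 x] nz[of x] that by (auto simp: mult_less_0_iff not_less)
    then show ?thesis by (auto simp: eventually_at_top_linorder)
  qed
qed

text \<open>With half the exponent, \<open>c = a / 2\<close>, the function
  \<open>ln (F x) - c * ln x\<close> is eventually increasing, so \<open>F\<close> dominates a
  positive multiple of \<open>x powr c\<close>.\<close>

lemma positive_exponent_at_top: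
  assumes der: "\<And>x. x > x0 \<Longrightarrow> (F has_real_derivative F' x) (at x)"
    and pos: "eventually (\<lambda>x. F x > 0) at_top"
    and lim: "((\<lambda>x. x * F' x / F x) \<longlongrightarrow> a) at_top" and a: "a > 0"
  shows "filterlim F at_top at_top"
proof -
  define c where "c = a / 2"
  have c: "0 < c" "c < a" using a by (auto simp: c_def)
  have "eventually (\<lambda>x. x > max x0 0 \<and> F x > 0 \<and> c < x * F' x / F x) at_top"
    using order_tendstoD(1)[OF lim c(2)] pos eventually_gt_at_top[of "max x0 0"] by eventually_elim auto
  then obtain x1 where x1: "\<And>x. x \<ge> x1 \<Longrightarrow> x > max x0 0 \<and> F x > 0 \<and> c < x * F' x / F x"
    by (auto simp: eventually_at_top_linorder)
  have inc: "ln (F x1) - c * ln x1 \<le> ln (F x) - c * ln x" if "x \<ge> x1" for x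
  proof (rule DERIV_nonneg_imp_nondecreasing[OF that, of "\<lambda>x. ln (F x) - c * ln x"])
    fix z assume "x1 \<le> z" "z \<le> x"
    with x1[of z] have z: "z > x0" "z > 0" "F z > 0" "c < z * F' z / F z" by auto
    have "((\<lambda>x. ln (F x) - c * ln x) has_real_derivative F' z / F z - c / z) (at z)"
      using z by (auto intro!: derivative_eq_intros der)
    moreover have "F' z / F z - c / z \<ge> 0" using z by (simp add: field_simps)
    ultimately show "\<exists>y. ((\<lambda>x. ln (F x) - c * ln x) has_real_derivative y) (at z) \<and> 0 \<le> y" by blast
  qed
  have "filterlim (\<lambda>x. exp ((ln (F x1) - c * ln x1) + c * ln x)) at_top at_top"
    using c
    by (intro filterlim_compose[OF exp_at_top] filterlim_tendsto_add_at_top[OF tendsto_const]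
       filterlim_tendsto_pos_mult_at_top[OF tendsto_const] ln_at_top) auto
  then show ?thesis
  proof (rule filterlim_at_top_mono)
    show "eventually (\<lambda>x. exp ((ln (F x1) - c * ln x1) + c * ln x) \<le> F x) at_top"
      using eventually_ge_at_top[of x1]
    proof eventually_elim
      case (elim x)
      then have "exp ((ln (F x1) - c * ln x1) + c * ln x) \<le> exp (ln (F x))" using inc[OF elim] by simp
      then show ?case using x1[OF elim] by simp
    qed
  qed
qed

text \<open>L'Hospital's rule for \<open>x * G 1 x\<close> over \<open>G 0 x\<close>: the quotient
  of the derivatives is \<open>1 + x * G 2 x / G 1 x\<close>. The denominator tends to infinity
  because \<open>a\<close> is positive.\<close>

lemma log_derivative_exponent_pos:
  assumes der: "\<And>j x. x > x0 \<Longrightarrow> (G j has_real_derivative G (Suc j) x) (at x)"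
    and pos: "eventually (\<lambda>x. G 0 x > 0) at_top" and nz: "eventually (\<lambda>x. G 1 x \<noteq> 0) at_top"
    and a: "((\<lambda>x. x * G 1 x / G 0 x) \<longlongrightarrow> a) at_top" "a > 0"
    and b: "((\<lambda>x. x * G 2 x / G 1 x) \<longlongrightarrow> b) at_top"
  shows "b = a - 1"
proof -
  have "((\<lambda>x. x * G 1 x / G 0 x) \<longlongrightarrow> 1 + b) at_top"
  proof (rule lhospital_at_top_at_top[where f' = "\<lambda>x. G 1 x + x * G 2 x" and g' = "G 1"])
    show "filterlim (G 0) at_top at_top"
      using der[of _ 0] pos a by (intro positive_exponent_at_top[of x0 _ "G 1"]) auto
    show "eventually (\<lambda>x. ((\<lambda>x. x * G 1 x) has_real_derivative G 1 x + x * G 2 x) (at x)) at_top"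
      using eventually_gt_at_top[of x0]
      by eventually_elim (use der[of _ 1] in \<open>auto intro!: derivative_eq_intros simp: numeral_2_eq_2\<close>)
    show "eventually (\<lambda>x. (G 0 has_real_derivative G 1 x) (at x)) at_top"
      using eventually_gt_at_top[of x0] by eventually_elim (use der[of _ 0] in auto)
    have "((\<lambda>x. 1 + x * G 2 x / G 1 x) \<longlongrightarrow> 1 + b) at_top" by (intro tendsto_intros b)
    moreover have "eventually (\<lambda>x. 1 + x * G 2 x / G 1 x = (G 1 x + x * G 2 x) / G 1 x) at_top"
      using nz by eventually_elim (simp add: add_divide_distrib)
    ultimately show "((\<lambda>x. (G 1 x + x * G 2 x) / G 1 x) \<longlongrightarrow> 1 + b) at_top"
      by (rule Lim_transform_eventually)
  qed (rule nz)
  then show ?thesis using a(1) tendsto_unique[OF trivial_limit_at_top_linorder] by fastforce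
qed

lemma log_derivative_exponent:
  assumes der: "\<And>j x. x > x0 \<Longrightarrow> (G j has_real_derivative G (Suc j) x) (at x)"
    and nz: "eventually (\<lambda>x. G 0 x \<noteq> 0) at_top" "eventually (\<lambda>x. G 1 x \<noteq> 0) at_top"
    and a: "((\<lambda>x. x * G 1 x / G 0 x) \<longlongrightarrow> a) at_top" "a > 0"
    and b: "((\<lambda>x. x * G 2 x / G 1 x) \<longlongrightarrow> b) at_top"
  shows "b = a - 1" "filterlim (\<lambda>x. \<bar>G 0 x\<bar>) at_top at_top"
proof -
  have "eventually (\<lambda>x. G 0 x > 0) at_top \<or> eventually (\<lambda>x. G 0 x < 0) at_top"
    using der[of _ 0] nz by (intro eventually_constant_sign[of x0]) (auto intro: DERIV_isCont)
  then have "b = a - 1 \<and> filterlim (\<lambda>x. \<bar>G 0 x\<bar>) at_top at_top"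
  proof
    assume pos: "eventually (\<lambda>x. G 0 x > 0) at_top"
    have "filterlim (G 0) at_top at_top"
      using der[of _ 0] pos a by (intro positive_exponent_at_top[of x0 _ "G 1"]) auto
    then show ?thesis
      using log_derivative_exponent_pos[OF der pos nz(2) a b] by (auto elim!: filterlim_at_top_mono[OF _ always_eventually])
  next
    assume neg: "eventually (\<lambda>x. G 0 x < 0) at_top"
    define H where "H j x = - G j x" for j x
    have derH: "\<And>j x. x > x0 \<Longrightarrow> (H j has_real_derivative H (Suc j) x) (at x)"
      unfolding H_def by (auto intro!: derivative_intros der)
    have posH: "eventually (\<lambda>x. H 0 x > 0) at_top" using neg by (simp add: H_def)
    have aH: "((\<lambda>x. x * H 1 x / H 0 x) \<longlongrightarrow> a) at_top" using a by (simp add: H_def)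
    have "filterlim (H 0) at_top at_top"
      using derH[of _ 0] posH a aH by (intro positive_exponent_at_top[of x0 _ "H 1"]) auto
    moreover have "b = a - 1"
      by (rule log_derivative_exponent_pos[OF derH posH _ aH a(2)]) (use nz b in \<open>auto simp: H_def\<close>)
    ultimately show ?thesis by (auto elim!: filterlim_at_top_mono[OF _ always_eventually] simp: H_def)
  qed
  then show "b = a - 1" "filterlim (\<lambda>x. \<bar>G 0 x\<bar>) at_top at_top" by auto
qed

text \<open>Each differentiation lowers the growth exponent by one, so \<open>G i\<close> has
  exponent \<open>a - i\<close>, still positive, and its modulus tends to infinity. As
  \<open>x * G (Suc i) x\<close> is comparable to that modulus, it tends to infinity as
  well.\<close>

lemma rslow_top_derivative:
  assumes der: "\<And>j x. x > x0 \<Longrightarrow> (G j has_real_derivative G (Suc j) x) (at x)"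
    and nz: "\<And>j. eventually (\<lambda>x. G j x \<noteq> 0) at_top"
    and lims: "\<And>j. \<exists>c. ((\<lambda>x. x * G (Suc j) x / G j x) \<longlongrightarrow> c) at_top"
    and a: "((\<lambda>x. x * G 1 x / G 0 x) \<longlongrightarrow> a) at_top" "real i < a"
    and top: "(G (Suc i) \<longlongrightarrow> 0) at_top" and pos: "eventually (\<lambda>x. G (Suc i) x > 0) at_top"
  shows "rslow (G (Suc i))"
proof -
  have lim: "((\<lambda>x. x * G (Suc j) x / G j x) \<longlongrightarrow> a - j) at_top" if "j \<le> i" for j
    using that
  proof (induction j)
    case (Suc j)
    obtain b where b: "((\<lambda>x. x * G (Suc (Suc j)) x / G (Suc j) x) \<longlongrightarrow> b) at_top" using lims by blast
    have "b = (a - j) - 1"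
      by (rule log_derivative_exponent(1)[of x0 "\<lambda>k. G (k + j)"])
        (use Suc a der nz b in \<open>auto simp: numeral_2_eq_2\<close>)
    with b show ?case by (simp add: algebra_simps)
  qed (use a in auto)
  obtain b where b: "((\<lambda>x. x * G (Suc (Suc i)) x / G (Suc i) x) \<longlongrightarrow> b) at_top" using lims by blast
  have big: "filterlim (\<lambda>x. \<bar>G i x\<bar>) at_top at_top"
    by (rule log_derivative_exponent(2)[of x0 "\<lambda>k. G (k + i)" "a - i" b, simplified])
      (use lim[of i] a der nz b in \<open>auto simp: numeral_2_eq_2\<close>)
  have "filterlim (\<lambda>x. \<bar>x * G (Suc i) x / G i x\<bar> * \<bar>G i x\<bar>) at_top at_top"
    using a lim[of i] by (intro filterlim_tendsto_pos_mult_at_top[OF tendsto_rabs _ big]) auto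
  moreover have "eventually (\<lambda>x. \<bar>x * G (Suc i) x / G i x\<bar> * \<bar>G i x\<bar> \<le> x * G (Suc i) x) at_top"
    using nz[of i] pos eventually_gt_at_top[of 0] by eventually_elim (simp add: abs_mult)
  ultimately have xu: "filterlim (\<lambda>x. x * G (Suc i) x) at_top at_top"
    by (rule filterlim_at_top_mono)
  have "eventually (\<lambda>x. G (Suc (Suc i)) x > 0) at_top \<or> eventually (\<lambda>x. G (Suc (Suc i)) x < 0) at_top"
    using der[of _ "Suc (Suc i)"] nz by (intro eventually_constant_sign[of x0]) (auto intro: DERIV_isCont)
  \<comment> \<open>A positive function with eventually positive derivative stays above a positive
    constant and cannot tend to zero. In this way the limit condition in \<open>class_T_at\<close>
    yields monotonicity.\<close>
  then have neg: "eventually (\<lambda>x. G (Suc (Suc i)) x < 0) at_top"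
  proof
    assume "eventually (\<lambda>x. G (Suc (Suc i)) x > 0) at_top"
    with pos eventually_gt_at_top[of x0]
    have "eventually (\<lambda>x. x > x0 \<and> G (Suc i) x > 0 \<and> G (Suc (Suc i)) x > 0) at_top"
      by eventually_elim auto
    then obtain x1 where x1: "\<And>x. x \<ge> x1 \<Longrightarrow> x > x0 \<and> G (Suc i) x > 0 \<and> G (Suc (Suc i)) x > 0"
      by (auto simp: eventually_at_top_linorder)
    have "G (Suc i) x1 \<le> G (Suc i) x" if "x \<ge> x1" for x
      by (rule DERIV_nonneg_imp_nondecreasing[OF that]) (use der x1 in \<open>meson less_imp_le\<close>)
    then have "G (Suc i) x1 \<le> 0"
      by (intro tendsto_lowerbound[OF top]) (auto simp: eventually_at_top_linorder)
    with x1[of x1] show ?thesis by simp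
  qed
  from pos this eventually_gt_at_top[of x0]
  have "eventually (\<lambda>x. x > x0 \<and> G (Suc i) x > 0 \<and> G (Suc (Suc i)) x < 0) at_top"
    by eventually_elim auto
  then obtain x1 where x1: "\<And>x. x \<ge> x1 \<Longrightarrow> x > x0 \<and> G (Suc i) x > 0 \<and> G (Suc (Suc i)) x < 0"
    by (auto simp: eventually_at_top_linorder)
  have "G (Suc i) y \<le> G (Suc i) x" if "x \<ge> x1" "x \<le> y" for x y
    by (rule DERIV_nonpos_imp_nonincreasing[OF that(2)])
      (use der x1 that in \<open>meson less_imp_le order_trans\<close>)
  then show ?thesis unfolding rslow_def using x1 top xu by (auto intro!: exI[of _ x1])
qed

lemma class_T_mean:
  assumes "h \<in> class_T"
  shows "has_mean (\<lambda>n. e1 (h (real n))) 0"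
proof -
  obtain i where "h \<in> class_T_at i" using assms by (auto simp: class_T_def)
  then obtain a where R: "h \<in> class_R" and a: "real i < a" "((\<lambda>x. x * deriv h x / h x) \<longlongrightarrow> a) at_top"
    and top: "((deriv ^^ Suc i) h \<longlongrightarrow> 0) at_top"
    by (auto simp: class_T_at_def)
  obtain x0 where "\<And>j x. x > x0 \<Longrightarrow> (deriv ^^ j) h differentiable at x"
    using R by (auto simp: class_R_def smooth_on_half_line_def)
  then have der: "((deriv ^^ j) h has_real_derivative (deriv ^^ Suc j) h x) (at x)" if "x > x0" for j x
    using that by (simp add: DERIV_deriv_iff_real_differentiable)
  have nz: "eventually (\<lambda>x. (deriv ^^ j) h x \<noteq> 0) at_top"
    and lims: "\<exists>c. ((\<lambda>x. x * (deriv ^^ Suc j) h x / (deriv ^^ j) h x) \<longlongrightarrow> c) at_top" for j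
    using R unfolding class_R_def by blast+
  have "eventually (\<lambda>x. (deriv ^^ Suc i) h x > 0) at_top \<or> eventually (\<lambda>x. (deriv ^^ Suc i) h x < 0) at_top"
    using der[of _ "Suc i"] nz[of "Suc i"] by (intro eventually_constant_sign[of x0]) (auto intro: DERIV_isCont)
  then show ?thesis
  proof
    assume pos: "eventually (\<lambda>x. (deriv ^^ Suc i) h x > 0) at_top"
    have "rslow ((deriv ^^ Suc i) h)"
      by (rule rslow_top_derivative[where G = "\<lambda>j. (deriv ^^ j) h", OF der nz lims _ a(1) top pos])
        (use a in auto)
    from rslow_chain_mean[of x0 "\<lambda>j. (deriv ^^ j) h", OF der this] show ?thesis by simp
  next
    assume neg: "eventually (\<lambda>x. (deriv ^^ Suc i) h x < 0) at_top"
    \<comment> \<open>\<open>rslow\<close> demands a positive function. Negating the phase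
      conjugates the exponential, and a mean equal to zero is unaffected.\<close>
    define G where "G j x = - (deriv ^^ j) h x" for j x
    have derG: "(G j has_real_derivative G (Suc j) x) (at x)" if "x > x0" for j x
      unfolding G_def using der[OF that, of j] by (rule DERIV_minus)
    have "rslow (G (Suc i))"
    proof (rule rslow_top_derivative[where G = G, OF derG _ _ _ a(1)])
      show "(G (Suc i) \<longlongrightarrow> 0) at_top" unfolding G_def using tendsto_minus[OF top] by simp
      show "\<And>j. eventually (\<lambda>x. G j x \<noteq> 0) at_top" using nz by (simp only: G_def neg_equal_0_iff_equal)
      show "\<And>j. \<exists>c. ((\<lambda>x. x * G (Suc j) x / G j x) \<longlongrightarrow> c) at_top" using lims by (simp only: G_def) simp
    qed (use a neg in \<open>simp_all add: G_def\<close>)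
    from rslow_chain_mean[of x0 G, OF derG this] have "has_mean (\<lambda>n. e1 (- h (real n))) 0"
      by (simp add: G_def)
    from has_mean_cnj[OF this] show ?thesis by (simp add: e1_minus)
  qed
qed

section \<open>Integer parts\<close>

lemma e1_frac: "e1 (frac x) = e1 x"
  by (simp add: frac_def e1_diff e1_of_int)

inductive_set trig1 :: "(real \<Rightarrow> complex) set" where
  char: "(\<lambda>x. c * e1 (of_int m * x)) \<in> trig1"
| add: "p \<in> trig1 \<Longrightarrow> q \<in> trig1 \<Longrightarrow> (\<lambda>x. p x + q x) \<in> trig1"

lemma trig1_const: "(\<lambda>x. c) \<in> trig1"
  using trig1.char[of c 0] by simp

lemma trig1_mult: "p \<in> trig1 \<Longrightarrow> q \<in> trig1 \<Longrightarrow> (\<lambda>x. p x * q x) \<in> trig1"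
proof (induction p rule: trig1.induct)
  case (char c m)
  from char show ?case
  proof (induction q rule: trig1.induct)
    case (char d k)
    have "(\<lambda>x. c * e1 (of_int m * x) * (d * e1 (of_int k * x))) = (\<lambda>x. (c * d) * e1 (of_int (m + k) * x))"
      by (simp add: fun_eq_iff e1_add distrib_right)
    then show ?case by (simp only: trig1.char)
  next
    case (add p q)
    then show ?case using trig1.add by (simp add: distrib_left)
  qed
next
  case (add p q)
  then show ?case using trig1.add by (simp add: distrib_right)
qed

text \<open>Every real-linear form on the plane is a combination of \<open>z\<close> and
  \<open>cnj z\<close>, which on the circle are the characters of frequency 1 and -1; sums and
  products stay in \<open>trig1\<close>.\<close>

lemma trig1_of_real_polynomial:
  "real_polynomial_function p \<Longrightarrow> (\<lambda>x. of_real (p (e1 x))) \<in> trig1"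
proof (induction p rule: real_polynomial_function.induct)
  case (linear f)
  interpret bounded_linear f by (rule linear)
  have "f z = Re z * f 1 + Im z * f \<i>" for z
  proof -
    have "z = Re z *\<^sub>R 1 + Im z *\<^sub>R \<i>" by (simp add: complex_eq_iff)
    then have "f z = f (Re z *\<^sub>R 1 + Im z *\<^sub>R \<i>)" by simp
    then show ?thesis by (simp only: add scaleR real_scaleR_def)
  qed
  moreover have "complex_of_real (Re z * a + Im z * b) = (a - \<i> * b) / 2 * z + (a + \<i> * b) / 2 * cnj z" for z a b
    by (simp add: complex_eq_iff field_simps)
  ultimately have *: "complex_of_real (f z) = (f 1 - \<i> * f \<i>) / 2 * z + (f 1 + \<i> * f \<i>) / 2 * cnj z" for z
    by metis
  have "(\<lambda>x. (f 1 - \<i> * f \<i>) / 2 * e1 (of_int 1 * x) + (f 1 + \<i> * f \<i>) / 2 * e1 (of_int (- 1) * x)) \<in> trig1"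
    by (rule trig1.add[OF trig1.char trig1.char])
  then show ?case by (subst *) (simp add: e1_minus)
next
  case (const c)
  show ?case by (rule trig1_const)
next
  case (add f g)
  from trig1.add[OF add.IH] show ?case by simp
next
  case (mult f g)
  from trig1_mult[OF mult.IH] show ?case by simp
qed

lemma trig1_dense:
  fixes F :: "complex \<Rightarrow> complex"
  assumes "continuous_on (sphere 0 1) F" "e > 0"
  shows "\<exists>p\<in>trig1. \<forall>x. norm (F (e1 x) - p x) < e"
proof -
  obtain g where g: "polynomial_function g" "\<And>z. z \<in> sphere 0 1 \<Longrightarrow> norm (F z - g z) < e"
    using Stone_Weierstrass_polynomial_function[OF compact_sphere assms] by blast
  have "real_polynomial_function (Re \<circ> g)" "real_polynomial_function (Im \<circ> g)"
    using g(1) unfolding polynomial_function_def by (auto intro: bounded_linear_Re bounded_linear_Im)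
  from this[THEN trig1_of_real_polynomial]
  have "(\<lambda>x. of_real (Re (g (e1 x))) + \<i> * of_real (Im (g (e1 x)))) \<in> trig1"
    by (intro trig1.add trig1_mult trig1_const) auto
  then have "(\<lambda>x. g (e1 x)) \<in> trig1" by (simp add: complex_eq[symmetric])
  then show ?thesis using g(2) by (intro bexI[of _ "\<lambda>x. g (e1 x)"]) auto
qed

text \<open>The Fejer kernel, normalised to be 1 at the integers.\<close>

definition fejer :: "nat \<Rightarrow> real \<Rightarrow> real" where
  "fejer K x = (norm ((\<Sum>j<K. e1 (real j * x)) / of_nat K))\<^sup>2"

lemma fejer_bounds: "0 \<le> fejer K x" "fejer K x \<le> 1"
proof -
  show "0 \<le> fejer K x" by (simp add: fejer_def)
  have "norm (\<Sum>j<K. e1 (real j * x)) \<le> (\<Sum>j<K. 1)" by (rule sum_norm_le) simp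
  then have "norm ((\<Sum>j<K. e1 (real j * x)) / of_nat K) \<le> 1"
    by (cases "K = 0") (auto simp: norm_divide divide_le_eq_1)
  then show "fejer K x \<le> 1" unfolding fejer_def by (intro power_le_one) auto
qed

lemma of_real_fejer:
  "complex_of_real (fejer K x) = (\<Sum>j<K. \<Sum>k<K. e1 (of_int (int j - int k) * x)) / (of_nat K)\<^sup>2"
  unfolding fejer_def complex_norm_square
  by (simp add: sum_product e1_diff left_diff_distrib power2_eq_square)

text \<open>Among the \<open>K * K\<close> pairs of frequencies only the \<open>K\<close> diagonal
  ones have nonzero mean. So an error of the size of the kernel, though 1 at the integers, is cheap
  on average.\<close>

lemma fejer_mean:
  assumes K: "K > 0" and y: "\<And>m::int. m \<noteq> 0 \<Longrightarrow> has_mean (\<lambda>n. e1 (of_int m * y n)) 0"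
  shows "has_mean (\<lambda>n. of_real (fejer K (y n))) (1 / of_nat K)"
proof -
  have "has_mean (\<lambda>n. (1 / (of_nat K)\<^sup>2) * (\<Sum>j<K. \<Sum>k<K. e1 (of_int (int j - int k) * y n)))
     ((1 / (of_nat K)\<^sup>2) * (\<Sum>j<K. \<Sum>k<K. if j = k then 1 else 0))"
  proof (intro has_mean_cmult has_mean_sum)
    fix j k show "has_mean (\<lambda>n. e1 (of_int (int j - int k) * y n)) (if j = k then 1 else 0)"
      using y[of "int j - int k"] has_mean_const[of 1] by auto
  qed
  then show ?thesis using K by (simp add: of_real_fejer power2_eq_square)
qed

text \<open>Multiplication by one minus a Fejer kernel removes the jump of \<open>e1 (- t * frac x)\<close> at the integers.\<close>

lemma sawtooth_approx:
  assumes e: "e > 0" and K: "K > 0"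
  shows "\<exists>p\<in>trig1. \<forall>x. norm (e1 (- t * frac x) - p x) \<le> e + fejer K x"
proof -
  define R where "R z = (norm ((\<Sum>j<K. z ^ j) / of_nat K))\<^sup>2" for z :: complex
  \<comment> \<open>The function handed to Stone-Weierstrass. On the circle \<open>Arg2pi\<close>
    jumps only at 1; there \<open>1 - R\<close> vanishes while the exponential has modulus one, so
    \<open>F\<close> is continuous with value 0. \<open>R\<close> is the kernel as a function of
    \<open>z\<close>, continuous on the whole plane.\<close>
  define F where "F z = exp (- \<i> * of_real (t * Arg2pi z)) * of_real (1 - R z)" for z
  have R: "R (e1 x) = fejer K x" for x
    by (simp add: R_def fejer_def e1_def Complex.DeMoivre mult_ac)
  have F: "F (e1 x) = e1 (- t * frac x) * of_real (1 - fejer K x)" for x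
  proof -
    have "Arg2pi (e1 x) = 2 * pi * frac x"
    proof (rule Arg2pi_unique[of 1])
      show "of_real 1 * exp (\<i> * of_real (2 * pi * frac x)) = e1 x"
        using e1_frac[of x] by (simp add: e1_def cis_conv_exp)
    qed (use frac_lt_1[of x] in auto)
    then have "exp (- \<i> * of_real (t * Arg2pi (e1 x))) = e1 (- t * frac x)"
      by (simp add: e1_def cis_conv_exp mult_ac)
    then show ?thesis by (simp only: F_def R)
  qed
  have norm_F: "norm (F z) = norm (1 - R z)" for z
  proof -
    have "norm (exp (- \<i> * of_real (t * Arg2pi z))) = 1" by simp
    then show ?thesis unfolding F_def norm_mult norm_of_real by simp
  qed
  have contR: "continuous_on UNIV R" unfolding R_def by (intro continuous_intros) (use K in auto)
  have "continuous (at z within sphere 0 1) F" if "z \<in> sphere 0 1" for z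
  proof (cases "z = 1")
    case False
    have "z \<notin> \<real>\<^sub>\<ge>\<^sub>0" using that False by (auto elim!: nonneg_Reals_cases)
    then have "isCont Arg2pi z" by (rule continuous_at_Arg2pi)
    moreover have "isCont R z" using contR by (simp add: continuous_on_eq_continuous_at)
    ultimately have "isCont F z"
      unfolding F_def isCont_def by (intro tendsto_intros)
    then show ?thesis by (rule continuous_at_imp_continuous_within)
  next
    case True
    have "isCont R 1" using contR by (simp add: continuous_on_eq_continuous_at)
    then have "isCont (\<lambda>z. norm (1 - R z)) 1" by (rule isCont_norm[OF isCont_diff[OF continuous_const]])
    moreover have "norm (1 - R 1) = 0" using K by (simp add: R_def)
    ultimately have "((\<lambda>z. norm (F z)) \<longlongrightarrow> 0) (at 1)" by (simp only: isCont_def norm_F)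
    then have "(F \<longlongrightarrow> 0) (at 1)" by (rule tendsto_norm_zero_cancel)
    moreover have "F 1 = 0" using \<open>norm (1 - R 1) = 0\<close> norm_F[of 1] by (simp only: norm_eq_zero norm_zero)
    ultimately have "isCont F 1" by (simp only: isCont_def)
    then show ?thesis unfolding True by (rule continuous_at_imp_continuous_within)
  qed
  then have "continuous_on (sphere 0 1) F" unfolding continuous_on_eq_continuous_within by blast
  from trig1_dense[OF this e] obtain p where p: "p \<in> trig1" "\<And>x. norm (F (e1 x) - p x) < e" by blast
  have "norm (e1 (- t * frac x) - p x) \<le> e + fejer K x" for x
  proof -
    have "e1 (- t * frac x) - p x = (F (e1 x) - p x) + e1 (- t * frac x) * of_real (fejer K x)"
      unfolding F by (simp add: algebra_simps)
    also have "norm \<dots> \<le> norm (F (e1 x) - p x) + norm (e1 (- t * frac x) * of_real (fejer K x))"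
      by (rule norm_triangle_ineq)
    also have "\<dots> \<le> e + fejer K x"
      using p(2)[of x] fejer_bounds(1)[of K x] by (intro add_mono) (auto simp: norm_mult)
    finally show ?thesis .
  qed
  with p(1) show ?thesis by blast
qed

text \<open>Made for errors that are not uniformly small, such as a Fejer kernel: it is enough that
  the bound \<open>r\<close> have a small mean.\<close>

lemma has_mean_zero_approx:
  assumes "\<And>e. e > 0 \<Longrightarrow> \<exists>v r s. has_mean v 0 \<and> has_mean (\<lambda>n. of_real (r n)) (of_real s) \<and> s < e \<and>
     (\<forall>n. norm (u n - v n) \<le> r n)"
  shows "has_mean u 0"
proof (rule has_mean_zeroI)
  fix e :: real assume "e > 0"
  then obtain v r s where v: "has_mean v 0" and r: "has_mean (\<lambda>n. of_real (r n)) (of_real s)"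
    and s: "s < e / 2" and le: "\<And>n. norm (u n - v n) \<le> r n" using assms[of "e/2"] by auto
  have "(\<lambda>N. complex_of_real ((\<Sum>n=1..N. r n) / real N)) \<longlonglongrightarrow> of_real s"
    using r by (simp add: has_mean_def)
  then have "(\<lambda>N. (\<Sum>n=1..N. r n) / real N) \<longlonglongrightarrow> s" by (simp only: tendsto_of_real_iff)
  then have "eventually (\<lambda>N. (\<Sum>n=1..N. r n) / real N < e / 2) sequentially"
    using s by (rule order_tendstoD)
  moreover have "eventually (\<lambda>N. norm ((\<Sum>n=1..N. v n) / of_nat N) < e / 2) sequentially"
    using v \<open>e > 0\<close> unfolding has_mean_def tendsto_iff dist_norm by (auto dest: spec[of _ "e/2"])
  ultimately show "eventually (\<lambda>N. norm ((\<Sum>n=1..N. u n) / of_nat N) \<le> e) sequentially"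
  proof eventually_elim
    case (elim N)
    have "(\<Sum>n=1..N. u n) / of_nat N = (\<Sum>n=1..N. v n) / of_nat N + (\<Sum>n=1..N. u n - v n) / of_nat N"
      by (simp add: sum_subtractf diff_divide_distrib)
    also have "norm \<dots> \<le> norm ((\<Sum>n=1..N. v n) / of_nat N) + norm ((\<Sum>n=1..N. u n - v n) / of_nat N)"
      by (rule norm_triangle_ineq)
    also have "norm ((\<Sum>n=1..N. u n - v n) / of_nat N) \<le> (\<Sum>n=1..N. r n) / real N"
      unfolding norm_divide norm_of_nat by (intro divide_right_mono sum_norm_le le) auto
    finally show ?case using elim by linarith
  qed
qed

text \<open>As \<open>t * \<lfloor>y\<rfloor> = t * y - t * frac y\<close>, the integer part costs
  the factor \<open>e1 (- t * frac y)\<close>, for which a trigonometric polynomial in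
  \<open>y\<close> is substituted at the price of a Fejer kernel. Its integer frequencies
  \<open>m\<close> shift \<open>t\<close> to \<open>t + m\<close>; hence the hypothesis for all
  \<open>m\<close>.\<close>

lemma floor_mean_step:
  assumes y: "\<And>m::int. m \<noteq> 0 \<Longrightarrow> has_mean (\<lambda>n. e1 (of_int m * y n)) 0"
    and w: "\<And>n. norm (w n) \<le> 1" and wy: "\<And>m::int. has_mean (\<lambda>n. w n * e1 ((t + of_int m) * y n)) 0"
  shows "has_mean (\<lambda>n. w n * e1 (t * of_int \<lfloor>y n\<rfloor>)) 0"
proof (rule has_mean_zero_approx)
  fix e :: real assume e: "e > 0"
  \<comment> \<open>One half of \<open>e\<close> goes to the uniform error, the other to the mean
    \<open>1 / K\<close> of the kernel.\<close>
  obtain K :: nat where "max 1 (2 / e) < real K" using reals_Archimedean2 by blast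
  then have K: "K > 0" "1 / real K < e / 2" using e by (auto simp: field_simps)
  obtain p where p: "p \<in> trig1" "\<And>x. norm (e1 (- t * frac x) - p x) \<le> e / 2 + fejer K x"
    using sawtooth_approx[of "e/2" K t] e K by auto
  define v where "v n = w n * e1 (t * y n) * p (y n)" for n
  have "has_mean (\<lambda>n. w n * e1 (t * y n) * p (y n)) 0"
    using p(1)
  proof (induction p rule: trig1.induct)
    case (char c m)
    have "(\<lambda>n. c * (w n * e1 ((t + of_int m) * y n))) = (\<lambda>n. w n * e1 (t * y n) * (c * e1 (of_int m * y n)))"
      by (simp add: fun_eq_iff distrib_right e1_add)
    with has_mean_cmult[OF wy[of m], of c] show ?case by simp
  next
    case (add p q)
    from has_mean_add[OF add.IH] show ?case by (simp add: distrib_left)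
  qed
  moreover have "has_mean (\<lambda>n. of_real (e / 2 + fejer K (y n))) (of_real (e / 2 + 1 / real K))"
    using has_mean_add[OF has_mean_const[of "of_real (e/2)"] fejer_mean[OF K(1) y]] by simp
  moreover have "norm (w n * e1 (t * of_int \<lfloor>y n\<rfloor>) - w n * e1 (t * y n) * p (y n)) \<le> e / 2 + fejer K (y n)" for n
  proof -
    have "e1 (t * of_int \<lfloor>y n\<rfloor>) = e1 (t * y n) * e1 (- t * frac (y n))"
      by (simp add: e1_add[symmetric] frac_def algebra_simps)
    then have "w n * e1 (t * of_int \<lfloor>y n\<rfloor>) - w n * e1 (t * y n) * p (y n)
       = w n * e1 (t * y n) * (e1 (- t * frac (y n)) - p (y n))"
      by (simp add: right_diff_distrib mult.assoc)
    then have "norm (w n * e1 (t * of_int \<lfloor>y n\<rfloor>) - w n * e1 (t * y n) * p (y n))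
       = norm (w n) * norm (e1 (- t * frac (y n)) - p (y n))"
      by (simp add: norm_mult)
    also have "\<dots> \<le> 1 * (e / 2 + fejer K (y n))" by (intro mult_mono w p(2)) auto
    finally show ?thesis by simp
  qed
  ultimately show "\<exists>v r s. has_mean v 0 \<and> has_mean (\<lambda>n. of_real (r n)) (of_real s) \<and> s < e \<and>
     (\<forall>n. norm (w n * e1 (t * of_int \<lfloor>y n\<rfloor>) - v n) \<le> r n)"
    using K by (intro exI[of _ "\<lambda>n. w n * e1 (t * y n) * p (y n)"] exI[of _ "\<lambda>n. e / 2 + fejer K (y n)"]
        exI[of _ "e / 2 + 1 / real K"]) auto
qed

text \<open>The lattice point precedes the frequency, so that \<open>chr l k\<close> is a function
  on the dual torus.\<close>

definition chr :: "nat \<Rightarrow> (nat \<Rightarrow> int) \<Rightarrow> (nat \<Rightarrow> real) \<Rightarrow> complex" where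
  "chr l k \<theta> = e1 (\<Sum>i=1..l. \<theta> i * of_int (k i))"

text \<open>Integer parts are introduced one index at a time: at stage \<open>j\<close> the first
  \<open>j\<close> phases carry the floor and the others are linear with free coefficients
  \<open>c\<close>. Removing the floor at \<open>Suc j\<close> produces the coefficients
  \<open>\<theta> (Suc j) + m\<close>, nonzero if \<open>\<theta> (Suc j)\<close> is not an integer.
  So the disjunction carried by the induction is inherited, and at stage 0 it says that the linear
  combination is nontrivial.\<close>

lemma floor_mean:
  fixes y :: "nat \<Rightarrow> nat \<Rightarrow> real"
  assumes y: "\<And>c. \<exists>i\<in>{1..l}. c i \<noteq> 0 \<Longrightarrow> has_mean (\<lambda>n. e1 (\<Sum>i=1..l. c i * y i n)) 0"
    and \<theta>: "\<exists>i\<in>{1..l}. \<theta> i \<notin> \<int>"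
  shows "has_mean (\<lambda>n. chr l (\<lambda>i. \<lfloor>y i n\<rfloor>) \<theta>) 0"
proof -
  have single: "has_mean (\<lambda>n. e1 (of_int m * y i n)) 0" if "i \<in> {1..l}" "m \<noteq> 0" for i and m :: int
  proof -
    have "(\<Sum>j=1..l. (if j = i then of_int m else 0) * y j n) = of_int m * y i n" for n
      using that by (simp add: if_distrib[of "\<lambda>x. x * _"] cong: if_cong)
    with y[of "\<lambda>j. if j = i then of_int m else 0"] that show ?thesis by auto
  qed
  have "has_mean (\<lambda>n. e1 (\<Sum>i=1..j. \<theta> i * of_int \<lfloor>y i n\<rfloor>) * e1 (\<Sum>i=Suc j..l. c i * y i n)) 0"
    if "j \<le> l" "(\<exists>i\<in>{1..j}. \<theta> i \<notin> \<int>) \<or> (\<exists>i\<in>{Suc j..l}. c i \<noteq> 0)" for j c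
    using that
  proof (induction j arbitrary: c)
    case 0
    then show ?case using y[of c] by auto
  next
    case (Suc j)
    define w where "w n = e1 (\<Sum>i=1..j. \<theta> i * of_int \<lfloor>y i n\<rfloor>) * e1 (\<Sum>i=Suc (Suc j)..l. c i * y i n)" for n
    have "has_mean (\<lambda>n. w n * e1 (\<theta> (Suc j) * of_int \<lfloor>y (Suc j) n\<rfloor>)) 0"
    proof (rule floor_mean_step)
      fix m :: int
      define c' where "c' = c(Suc j := \<theta> (Suc j) + of_int m)"
      have *: "(\<Sum>i=Suc j..l. c' i * y i n)
          = (\<theta> (Suc j) + of_int m) * y (Suc j) n + (\<Sum>i=Suc (Suc j)..l. c i * y i n)" for n
        using Suc.prems(1) by (subst sum.atLeast_Suc_atMost) (auto simp: c'_def)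
      have "has_mean (\<lambda>n. e1 (\<Sum>i=1..j. \<theta> i * of_int \<lfloor>y i n\<rfloor>) * e1 (\<Sum>i=Suc j..l. c' i * y i n)) 0"
      proof (rule Suc.IH)
        show "j \<le> l" using Suc.prems by simp
        have *: "\<theta> (Suc j) + of_int m \<noteq> 0" if "\<theta> (Suc j) \<notin> \<int>"
          using that by (metis Ints_minus Ints_of_int eq_neg_iff_add_eq_0)
        then show "(\<exists>i\<in>{1..j}. \<theta> i \<notin> \<int>) \<or> (\<exists>i\<in>{Suc j..l}. c' i \<noteq> 0)"
          using Suc.prems(2)
        proof (elim disjE bexE)
          fix i assume "i \<in> {1..Suc j}" "\<theta> i \<notin> \<int>"
          with * Suc.prems(1) show ?thesis
            by (cases "i = Suc j") (auto simp: c'_def intro!: bexI[of _ i])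
        next
          fix i assume "i \<in> {Suc (Suc j)..l}" "c i \<noteq> 0"
          then show ?thesis by (intro disjI2 bexI[of _ i]) (auto simp: c'_def)
        qed
      qed
      then show "has_mean (\<lambda>n. w n * e1 ((\<theta> (Suc j) + of_int m) * y (Suc j) n)) 0"
        unfolding * by (simp add: w_def e1_add mult_ac)
    qed (use single[of "Suc j"] Suc.prems in \<open>auto simp: w_def norm_mult\<close>)
    then show ?case by (simp add: w_def e1_add mult_ac)
  qed
  from this[of l "\<lambda>_. 0"] \<theta> show ?thesis by (simp add: chr_def)
qed

section \<open>Bounded convergence for positive functionals\<close>

lemma ex_strict_mono_ge:
  fixes N :: "nat \<Rightarrow> nat"
  shows "\<exists>s. strict_mono s \<and> (\<forall>k. s k \<ge> N k)"
proof (intro exI conjI allI)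
  show "strict_mono (\<lambda>k. k + (\<Sum>j\<le>k. N j))" by (rule strict_monoI_Suc) simp
  show "k + (\<Sum>j\<le>k. N j) \<ge> N k" for k
    using member_le_sum[of k "{..k}" N] by simp
qed

text \<open>Only finite additivity is asked for. Positivity refers to \<open>K\<close>, while the
  members of \<open>A\<close> are functions on the whole type, as suits trigonometric polynomials
  tested on a cube of periods.\<close>

locale positive_functional =
  fixes K :: "'t::topological_space set" and A :: "('t \<Rightarrow> real) set" and L :: "('t \<Rightarrow> real) \<Rightarrow> real"
  assumes compact: "compact K"
    and cont: "f \<in> A \<Longrightarrow> continuous_on UNIV f"
    and const_mem: "(\<lambda>_. c) \<in> A"
    and add_mem: "f \<in> A \<Longrightarrow> g \<in> A \<Longrightarrow> (\<lambda>x. f x + g x) \<in> A"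
    and mult_mem: "f \<in> A \<Longrightarrow> g \<in> A \<Longrightarrow> (\<lambda>x. f x * g x) \<in> A"
    and L_add: "f \<in> A \<Longrightarrow> g \<in> A \<Longrightarrow> L (\<lambda>x. f x + g x) = L f + L g"
    and L_cmult: "f \<in> A \<Longrightarrow> L (\<lambda>x. c * f x) = c * L f"
    and L_pos: "f \<in> A \<Longrightarrow> (\<And>x. x \<in> K \<Longrightarrow> 0 \<le> f x) \<Longrightarrow> 0 \<le> L f"
begin

lemma cmult_mem: "f \<in> A \<Longrightarrow> (\<lambda>x. c * f x) \<in> A"
  by (rule mult_mem[OF const_mem])

lemma L_mono:
  assumes "f \<in> A" "g \<in> A" "\<And>x. x \<in> K \<Longrightarrow> f x \<le> g x"
  shows "L f \<le> L g"
proof -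
  have "(\<lambda>x. g x + (-1) * f x) \<in> A" by (intro add_mem cmult_mem assms)
  then have "0 \<le> L (\<lambda>x. g x + (-1) * f x)" by (rule L_pos) (use assms in auto)
  also have "\<dots> = L g + (-1) * L f" using assms by (simp only: L_add L_cmult cmult_mem)
  finally show ?thesis by simp
qed

lemma sum_mem: "(\<And>i. i \<in> I \<Longrightarrow> f i \<in> A) \<Longrightarrow> (\<lambda>x. \<Sum>i\<in>I. f i x) \<in> A"
  by (induction I rule: infinite_finite_induct) (auto intro: add_mem const_mem)

lemma L_const: "L (\<lambda>_. c) = c * L (\<lambda>_. 1)"
  using L_cmult[OF const_mem, of c 1] by simp

lemma L_sum: "(\<And>i. i \<in> I \<Longrightarrow> f i \<in> A) \<Longrightarrow> L (\<lambda>x. \<Sum>i\<in>I. f i x) = (\<Sum>i\<in>I. L (f i))"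
proof (induction I rule: infinite_finite_induct)
  case (insert i I)
  then have "L (\<lambda>x. f i x + (\<Sum>i\<in>I. f i x)) = L (f i) + L (\<lambda>x. \<Sum>i\<in>I. f i x)"
    by (intro L_add sum_mem) auto
  with insert show ?case by simp
qed (use L_const[of 0] in auto)

lemma diff_mem: "f \<in> A \<Longrightarrow> g \<in> A \<Longrightarrow> (\<lambda>x. f x - g x) \<in> A"
  using add_mem[OF _ cmult_mem, of f g "-1"] by simp

lemma parallelogram:
  assumes "f \<in> A" "g \<in> A"
  shows "L (\<lambda>x. (f x - g x) * (f x - g x)) = 2 * L (\<lambda>x. f x * f x) + 2 * L (\<lambda>x. g x * g x)
     - 4 * L (\<lambda>x. ((f x + g x) / 2) * ((f x + g x) / 2))"
proof -
  have mid: "(\<lambda>x. (f x + g x) / 2) \<in> A"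
    using cmult_mem[OF add_mem[OF assms], of "1/2"] by simp
  have "(\<lambda>x. (f x - g x) * (f x - g x))
      = (\<lambda>x. 2 * (f x * f x) + (2 * (g x * g x) + (-4) * (((f x + g x) / 2) * ((f x + g x) / 2))))"
    by (simp add: fun_eq_iff field_simps)
  then have "L (\<lambda>x. (f x - g x) * (f x - g x))
      = L (\<lambda>x. 2 * (f x * f x) + (2 * (g x * g x) + (-4) * (((f x + g x) / 2) * ((f x + g x) / 2))))"
    by (rule arg_cong)
  also have "\<dots> = 2 * L (\<lambda>x. f x * f x) + (2 * L (\<lambda>x. g x * g x)
     + (-4) * L (\<lambda>x. ((f x + g x) / 2) * ((f x + g x) / 2)))"
    by (simp only: L_add L_cmult add_mem cmult_mem mult_mem assms mid)
  finally show ?thesis by simp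
qed

text \<open>Eberlein's elementary proof of the bounded convergence theorem: near-minimisers of the quadratic
  form \<open>L (f\<^sup>2)\<close> over the convex tails of the sequence are Cauchy by the parallelogram law, and a
  fast Cauchy sequence tending to zero pointwise is dominated by the sum of its increments, to which
  Dini's argument applies.\<close>

lemma bounded_convergence_frequently:
  assumes \<phi>: "\<And>n. \<phi> n \<in> A" "\<And>n x. x \<in> K \<Longrightarrow> 0 \<le> \<phi> n x" "\<And>n x. x \<in> K \<Longrightarrow> \<phi> n x \<le> C"
    and lim: "\<And>x. x \<in> K \<Longrightarrow> (\<lambda>n. \<phi> n x) \<longlonglongrightarrow> 0"
    and ge: "\<And>n. \<delta> \<le> L (\<phi> n)"
  shows "\<delta> \<le> 0"
proof -
  \<comment> \<open>The convex tail is described from outside: at each point below every common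
    bound of the \<open>\<phi> k x\<close> with \<open>k \<ge> n\<close>. In this form closure under
    midpoints is immediate, and functions taken from later and later \<open>H n\<close> tend to zero
    pointwise.\<close>
  define H where "H n = {f \<in> A. \<delta> \<le> L f \<and> (\<forall>x\<in>K. 0 \<le> f x \<and> (\<forall>b. (\<forall>k\<ge>n. \<phi> k x \<le> b) \<longrightarrow> f x \<le> b))}" for n
  define Q where "Q f = L (\<lambda>x. f x * f x)" for f
  define d where "d n = (INF f\<in>H n. Q f)" for n
  have \<phi>H: "\<phi> n \<in> H n" for n using \<phi> ge by (auto simp: H_def)
  have Hmono: "H m \<subseteq> H n" if "n \<le> m" for n m
    using that unfolding H_def by (auto dest: order_trans)
  have mid: "(\<lambda>x. (f x + g x) / 2) \<in> H n" if "f \<in> H n" "g \<in> H n" for f g n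
  proof -
    have "(\<lambda>x. (f x + g x) / 2) = (\<lambda>x. (1/2) * (f x + g x))" by auto
    moreover have "f \<in> A" "g \<in> A" using that by (auto simp: H_def)
    ultimately have "(\<lambda>x. (f x + g x) / 2) \<in> A" "L (\<lambda>x. (f x + g x) / 2) = (1/2) * (L f + L g)"
      by (simp_all only: L_add L_cmult add_mem cmult_mem)
    moreover have "(f x + g x) / 2 \<le> b" if "x \<in> K" "\<forall>k\<ge>n. \<phi> k x \<le> b" for x b
    proof -
      have "f x \<le> b" "g x \<le> b" using \<open>f \<in> H n\<close> \<open>g \<in> H n\<close> that by (auto simp: H_def)
      then show ?thesis by simp
    qed
    ultimately show ?thesis using that by (auto simp: H_def)
  qed
  have Qpos: "0 \<le> Q f" if "f \<in> A" for f unfolding Q_def by (intro L_pos mult_mem that) auto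
  have bdd: "bdd_below (Q ` H n)" for n by (rule bdd_belowI2[of _ 0]) (auto simp: H_def Qpos)
  have d_le: "d n \<le> Q f" if "f \<in> H n" for f n unfolding d_def by (rule cINF_lower[OF bdd that])
  have Q\<phi>: "Q (\<phi> n) \<le> C * C * L (\<lambda>_. 1)" for n
  proof -
    have "Q (\<phi> n) \<le> L (\<lambda>_. C * C)" unfolding Q_def
      using \<phi> by (intro L_mono mult_mem const_mem mult_mono) (auto intro: order_trans[OF \<phi>(2) \<phi>(3)])
    then show ?thesis using L_const by metis
  qed
  have "incseq d" unfolding d_def
    by (rule incseq_SucI) (rule cINF_superset_mono[OF _ bdd Hmono], use \<phi>H in auto)
  moreover have "d n \<le> C * C * L (\<lambda>_. 1)" for n using d_le[OF \<phi>H[of n]] Q\<phi>[of n] by simp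
  ultimately obtain D where D: "d \<longlonglongrightarrow> D" "\<And>n. d n \<le> D"
    using incseq_convergent[of d "C * C * L (\<lambda>_. 1)"] by blast
  have "\<exists>f\<in>H n. Q f < d n + 1 / real (Suc n)" for n
  proof -
    have "d n < d n + 1 / real (Suc n)" by simp
    then show ?thesis unfolding d_def using \<phi>H by (subst (asm) cINF_less_iff[OF _ bdd]) auto
  qed
  then obtain \<psi> where \<psi>: "\<And>n. \<psi> n \<in> H n" "\<And>n. Q (\<psi> n) < d n + 1 / real (Suc n)" by metis
  have \<psi>A: "\<psi> n \<in> A" for n using \<psi>(1)[of n] by (simp add: H_def)
  \<comment> \<open>The midpoint of \<open>\<psi> n\<close> and \<open>\<psi> m\<close> lies in
    \<open>H n\<close>, where the form is at least \<open>d n\<close>; the parallelogram law turns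
    near-minimality into closeness.\<close>
  have close: "Q (\<lambda>x. \<psi> n x - \<psi> m x) \<le> 4 * (D - d n) + 4 / real (Suc n)" if "n \<le> m" for n m
  proof -
    have "\<psi> m \<in> H n" using \<psi>(1)[of m] Hmono[OF that] by blast
    then have "d n \<le> Q (\<lambda>x. (\<psi> n x + \<psi> m x) / 2)" using \<psi>(1) by (intro d_le mid)
    moreover have "1 / real (Suc m) \<le> 1 / real (Suc n)" using that by (simp add: frac_le)
    moreover have "Q (\<psi> m) \<le> D + 1 / real (Suc m)" using \<psi>(2)[of m] D(2)[of m] by simp
    moreover have "Q (\<psi> n) \<le> D + 1 / real (Suc n)" using \<psi>(2)[of n] D(2)[of n] by simp
    ultimately show ?thesis unfolding Q_def parallelogram[OF \<psi>A \<psi>A] by (simp add: Q_def) 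
  qed
  have "\<exists>N. \<forall>n\<ge>N. \<forall>m\<ge>n. Q (\<lambda>x. \<psi> n x - \<psi> m x) \<le> (1/4)^k" for k
  proof -
    have "(\<lambda>n. 4 * (D - d n) + 4 / real (Suc n)) \<longlonglongrightarrow> 4 * (D - D) + 0"
      by (intro tendsto_intros D LIMSEQ_Suc[OF lim_const_over_n])
    then have "eventually (\<lambda>n. 4 * (D - d n) + 4 / real (Suc n) < (1/4)^k) sequentially"
      by (rule order_tendstoD) simp
    then obtain N where "\<And>n. n \<ge> N \<Longrightarrow> 4 * (D - d n) + 4 / real (Suc n) < (1/4)^k"
      by (auto simp: eventually_sequentially)
    then show ?thesis using close by (meson less_imp_le order_trans)
  qed
  then obtain N where N: "\<And>k n m. n \<ge> N k \<Longrightarrow> m \<ge> n \<Longrightarrow> Q (\<lambda>x. \<psi> n x - \<psi> m x) \<le> (1/4)^k" by metis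
  obtain s where s: "strict_mono s" "\<And>k. s k \<ge> N k" using ex_strict_mono_ge[of N] by blast
  define f where "f k = \<psi> (s k)" for k
  \<comment> \<open>The modulus of an increment need not lie in \<open>A\<close>. The inequality
    \<open>t \<le> 2^k / 2 * t^2 + (1/2)^k / 2\<close> puts squares in its place, and the weight is
    balanced for increments with \<open>Q\<close> at most \<open>(1/4)^k\<close>: under
    \<open>L\<close> both terms are then of order \<open>(1/2)^k\<close>.\<close>
  define S where "S n m x = (\<Sum>k=n..m. 2^k / 2 * ((f k x - f (Suc k) x) * (f k x - f (Suc k) x)) + (1/2)^k / 2)" for n m x
  have fA: "f k \<in> A" for k by (simp add: f_def \<psi>A)
  have termA: "(\<lambda>x. 2^k / 2 * ((f k x - f (Suc k) x) * (f k x - f (Suc k) x)) + (1/2)^k / 2) \<in> A" for k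
    by (intro add_mem cmult_mem mult_mem diff_mem const_mem fA)
  then have SA: "S n m \<in> A" for n m unfolding S_def[abs_def] by (intro sum_mem)
  have LS: "L (S n m) \<le> (1/2)^n * (1 + L (\<lambda>_. 1))" for n m
  proof -
    have "L (\<lambda>x. 2^k / 2 * ((f k x - f (Suc k) x) * (f k x - f (Suc k) x)) + (1/2)^k / 2)
        \<le> (1/2)^k / 2 * (1 + L (\<lambda>_. 1))" for k
    proof -
      have "L (\<lambda>x. 2^k / 2 * ((f k x - f (Suc k) x) * (f k x - f (Suc k) x)) + (1/2)^k / 2)
        = 2^k / 2 * Q (\<lambda>x. f k x - f (Suc k) x) + (1/2)^k / 2 * L (\<lambda>_. 1)"
        unfolding Q_def L_const[of "(1/2)^k / 2", symmetric]
        by (simp only: L_add L_cmult const_mem cmult_mem mult_mem diff_mem fA)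
      moreover have "2^k / 2 * Q (\<lambda>x. f k x - f (Suc k) x) \<le> 2^k / 2 * (1/4)^k"
      proof (rule mult_left_mono)
        show "Q (\<lambda>x. f k x - f (Suc k) x) \<le> (1/4)^k" unfolding f_def
          using s by (intro N) (auto simp: strict_mono_less_eq)
      qed simp
      moreover have "2^k / 2 * (1/4)^k = ((1/2)^k / 2 :: real)"
        by (simp add: power_mult_distrib[symmetric] flip: power_divide)
      ultimately show ?thesis by (simp only: distrib_left mult_1_right)
    qed
    then have "L (S n m) \<le> (\<Sum>k=n..m. (1/2)^k / 2 * (1 + L (\<lambda>_. 1)))"
      unfolding S_def[abs_def] L_sum[OF termA] by (intro sum_mono)
    also have "\<dots> = (\<Sum>k=n..m. (1/2)^k / 2) * (1 + L (\<lambda>_. 1))" by (simp add: sum_distrib_right)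
    also have "(\<Sum>k=n..m. (1/2)^k / 2 :: real) \<le> (1/2)^n"
    proof (cases "n \<le> m")
      case True
      then have "(\<Sum>k=n..m. (1/2)^k / 2 :: real) = (1/2)^n - (1/2)^Suc m"
        by (induction m rule: dec_induct) simp_all
      then show ?thesis by simp
    qed auto
    finally show ?thesis using L_pos[OF const_mem, of 1] by (simp add: mult_right_mono)
  qed
  have "\<delta> \<le> \<epsilon> * L (\<lambda>_. 1) + (1/2)^n * (1 + L (\<lambda>_. 1))" if \<epsilon>: "\<epsilon> > 0" for \<epsilon> n
  proof -
    have pt: "f n x \<le> S n (n + m) x + f (Suc (n + m)) x" for x m
    proof (induction m)
      have step: "f k x \<le> (2^k / 2 * ((f k x - f (Suc k) x) * (f k x - f (Suc k) x)) + (1/2)^k / 2) + f (Suc k) x" for k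
      proof -
        have "0 \<le> (2^k * (f k x - f (Suc k) x) - 1)\<^sup>2 * ((1/2)^k / 2)" by simp
        also have "\<dots> = 2^k / 2 * ((f k x - f (Suc k) x) * (f k x - f (Suc k) x)) + (1/2)^k / 2 - (f k x - f (Suc k) x)"
          by (simp add: power2_eq_square field_simps)
        finally show ?thesis by simp
      qed
      { case 0 show ?case using step[of n] by (simp add: S_def)
      next
        case (Suc m) then show ?case using step[of "Suc (n + m)"] by (simp add: S_def) }
    qed
    \<comment> \<open>Dini's argument. Each point of \<open>K\<close> lies in some
      \<open>U m\<close>, because the remaining term \<open>f (Suc (n + m)) x\<close> falls to
      \<open>\<epsilon> / 2\<close>; compactness and monotonicity in \<open>m\<close> give one
      \<open>m\<close> for all of \<open>K\<close>.\<close>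
    define U where "U m = {x. f n x < \<epsilon> + S n (n + m) x}" for m
    have "open (U m)" for m unfolding U_def
      by (intro open_Collect_less continuous_intros cont fA SA)
    moreover have "K \<subseteq> (\<Union>m. U m)"
    proof
      fix x assume x: "x \<in> K"
      obtain n0 where n0: "\<And>k. k \<ge> n0 \<Longrightarrow> \<phi> k x \<le> \<epsilon> / 2"
        using order_tendstoD(2)[OF lim[OF x], of "\<epsilon> / 2"] \<epsilon>
        by (auto simp: eventually_sequentially intro: less_imp_le)
      have "f (Suc (n + n0)) x \<le> \<epsilon> / 2"
      proof -
        have "\<psi> (s (Suc (n + n0))) \<in> H (s (Suc (n + n0)))" by (rule \<psi>)
        moreover have "s (Suc (n + n0)) \<ge> n0" using strict_mono_imp_increasing[OF s(1), of "Suc (n + n0)"] by simp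
        then have "\<forall>k\<ge>s (Suc (n + n0)). \<phi> k x \<le> \<epsilon> / 2" using n0 by (meson order_trans)
        ultimately show ?thesis using x unfolding f_def H_def by blast
      qed
      then have "x \<in> U n0" using pt[of x n0] \<epsilon> by (simp add: U_def)
      then show "x \<in> (\<Union>m. U m)" by blast
    qed
    ultimately obtain M where M: "finite M" "K \<subseteq> (\<Union>m\<in>M. U m)"
      using compactE_image[OF compact, of UNIV U] by auto
    have Smono: "S n (n + m) x \<le> S n (n + m') x" if "m \<le> m'" for m m' x
      unfolding S_def using that by (intro sum_mono2) auto
    \<comment> \<open>The finite set \<open>M\<close> may be empty, and \<open>Max\<close> needs an
      element.\<close>
    define m where "m = Max (insert 0 M)"
    have "f n x \<le> \<epsilon> + S n (n + m) x" if x: "x \<in> K" for x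
    proof -
      obtain j where "j \<in> M" "x \<in> U j" using M x by blast
      then show ?thesis using Smono[of j m x] M(1) by (auto simp: U_def m_def)
    qed
    then have "L (f n) \<le> L (\<lambda>x. \<epsilon> + S n (n + m) x)"
      by (intro L_mono add_mem const_mem fA SA)
    also have "\<dots> = \<epsilon> * L (\<lambda>_. 1) + L (S n (n + m))"
      using L_add[OF const_mem SA] L_const by metis
    also have "\<dots> \<le> \<epsilon> * L (\<lambda>_. 1) + (1/2)^n * (1 + L (\<lambda>_. 1))" using LS by simp
    finally show ?thesis using \<psi>(1)[of "s n"] by (simp add: f_def H_def)
  qed
  note est = this
  have "(\<lambda>n. 1 / real (Suc n) * L (\<lambda>_. 1) + (1/2)^n * (1 + L (\<lambda>_. 1))) \<longlonglongrightarrow> 0 * L (\<lambda>_. 1) + 0 * (1 + L (\<lambda>_. 1))"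
    by (intro tendsto_intros LIMSEQ_Suc[OF lim_const_over_n] LIMSEQ_power_zero) auto
  then have "\<delta> \<le> 0 * L (\<lambda>_. 1) + 0 * (1 + L (\<lambda>_. 1))"
    by (rule tendsto_lowerbound) (intro always_eventually allI est, auto)
  then show ?thesis by simp
qed

lemma bounded_convergence:
  assumes \<phi>: "\<And>n. \<phi> n \<in> A" "\<And>n x. x \<in> K \<Longrightarrow> 0 \<le> \<phi> n x" "\<And>n x. x \<in> K \<Longrightarrow> \<phi> n x \<le> C"
    and lim: "\<And>x. x \<in> K \<Longrightarrow> (\<lambda>n. \<phi> n x) \<longlonglongrightarrow> 0"
  shows "(\<lambda>n. L (\<phi> n)) \<longlonglongrightarrow> 0"
proof (rule ccontr)
  assume "\<not> (\<lambda>n. L (\<phi> n)) \<longlonglongrightarrow> 0"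
  then obtain \<delta> where \<delta>: "\<delta> > 0" "\<not> eventually (\<lambda>n. dist (L (\<phi> n)) 0 < \<delta>) sequentially"
    by (auto simp: tendsto_iff)
  then have "\<exists>\<^sub>\<infinity>n. \<delta> \<le> L (\<phi> n)"
    using L_pos[OF \<phi>(1,2)] by (simp add: not_eventually not_less cofinite_eq_sequentially)
  then obtain r :: "nat \<Rightarrow> nat" where r: "strict_mono r" "\<forall>n. \<delta> \<le> L (\<phi> (r n))"
    using infinite_enumerate[of "{n. \<delta> \<le> L (\<phi> n)}"] by (auto simp: frequently_cofinite)
  have "\<delta> \<le> 0"
    by (rule bounded_convergence_frequently[of "\<lambda>n. \<phi> (r n)" C])
      (use \<phi> r LIMSEQ_subseq_LIMSEQ[OF lim r(1)] in \<open>auto simp: o_def\<close>)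
  with \<delta> show False by simp
qed

end

section \<open>The space $L^2$\<close>

text \<open>Squared norms are used throughout, as the parallelogram law and the isometry with the
  functional are quadratic. The root is taken at the very end.\<close>

definition nsq :: "'a measure \<Rightarrow> ('a \<Rightarrow> complex) \<Rightarrow> real" where
  "nsq M f = (\<integral>x. (norm (f x))\<^sup>2 \<partial>M)"

lemma norm_add_square_le: "(norm (a + b))\<^sup>2 \<le> 2 * (norm a)\<^sup>2 + 2 * (norm (b::complex))\<^sup>2"
proof -
  have "(norm (a + b))\<^sup>2 \<le> (norm a + norm b)\<^sup>2" by (intro power_mono norm_triangle_ineq) auto
  also have "\<dots> \<le> 2 * (norm a)\<^sup>2 + 2 * (norm b)\<^sup>2"
    using zero_le_power2[of "norm a - norm b"] by (simp add: power2_eq_square algebra_simps)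
  finally show ?thesis .
qed

lemma L2_measurable: "f \<in> L2_space M \<Longrightarrow> f \<in> borel_measurable M"
  by (simp add: L2_space_def)

lemma L2_integrable: "f \<in> L2_space M \<Longrightarrow> integrable M (\<lambda>x. (norm (f x))\<^sup>2)"
  by (simp add: L2_space_def)

lemma L2_add:
  assumes "f \<in> L2_space M" "g \<in> L2_space M"
  shows "(\<lambda>x. f x + g x) \<in> L2_space M"
proof -
  have "integrable M (\<lambda>x. 2 * (norm (f x))\<^sup>2 + 2 * (norm (g x))\<^sup>2)"
    using assms by (auto simp: L2_space_def)
  then have "integrable M (\<lambda>x. (norm (f x + g x))\<^sup>2)"
    by (rule Bochner_Integration.integrable_bound)
      (use assms norm_add_square_le in \<open>auto simp: L2_space_def\<close>)
  then show ?thesis using assms by (auto simp: L2_space_def)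
qed

lemma L2_cmult: "f \<in> L2_space M \<Longrightarrow> (\<lambda>x. c * f x) \<in> L2_space M"
  by (auto simp: L2_space_def norm_mult power_mult_distrib)

lemma L2_diff: "f \<in> L2_space M \<Longrightarrow> g \<in> L2_space M \<Longrightarrow> (\<lambda>x. f x - g x) \<in> L2_space M"
  using L2_add[OF _ L2_cmult, of f M g "-1"] by simp

lemma L2_zero: "(\<lambda>x. 0) \<in> L2_space M"
  by (simp add: L2_space_def)

lemma L2_sum: "(\<And>i. i \<in> I \<Longrightarrow> v i \<in> L2_space M) \<Longrightarrow> (\<lambda>x. \<Sum>i\<in>I. v i x) \<in> L2_space M"
  by (induction I rule: infinite_finite_induct) (auto intro: L2_add L2_zero)

lemma borel_measurable_cnj [measurable (raw)]:
  "f \<in> borel_measurable M \<Longrightarrow> (\<lambda>x. cnj (f x)) \<in> borel_measurable M"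
  by (rule measurable_compose[OF _ borel_measurable_continuous_onI[OF continuous_on_cnj[OF continuous_on_id]]])

lemma L2_inner_integrable:
  assumes "f \<in> L2_space M" "g \<in> L2_space M"
  shows "integrable M (\<lambda>x. f x * cnj (g x))"
proof -
  have "integrable M (\<lambda>x. (norm (f x))\<^sup>2 + (norm (g x))\<^sup>2)" using assms by (auto simp: L2_space_def)
  then show ?thesis
  proof (rule Bochner_Integration.integrable_bound)
    have "norm (a * cnj b) \<le> (norm a)\<^sup>2 + (norm b)\<^sup>2" for a b :: complex
    proof -
      have "2 * (norm a * norm b) \<le> (norm a)\<^sup>2 + (norm b)\<^sup>2"
        using sum_squares_bound[of "norm a" "norm b"] by (simp add: mult_ac)
      moreover have "0 \<le> norm a * norm b" by simp
      ultimately have "norm a * norm b \<le> (norm a)\<^sup>2 + (norm b)\<^sup>2" by linarith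
      then show ?thesis by (simp add: norm_mult)
    qed
    then show "AE x in M. norm (f x * cnj (g x)) \<le> norm ((norm (f x))\<^sup>2 + (norm (g x))\<^sup>2)" by simp
    show "(\<lambda>x. f x * cnj (g x)) \<in> borel_measurable M"
      using assms[THEN L2_measurable] by measurable
  qed
qed

lemma nsq_nonneg: "0 \<le> nsq M f" by (simp add: nsq_def)

lemma L2_inner_self: "L2_inner M f f = of_real (nsq M f)"
  unfolding L2_inner_def nsq_def by (simp add: complex_norm_square[symmetric] del: of_real_power)

lemma L2_inner_add_left:
  "f \<in> L2_space M \<Longrightarrow> g \<in> L2_space M \<Longrightarrow> h \<in> L2_space M \<Longrightarrow>
    L2_inner M (\<lambda>x. f x + g x) h = L2_inner M f h + L2_inner M g h"
  unfolding L2_inner_def by (simp add: distrib_right Bochner_Integration.integral_add L2_inner_integrable)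

lemma L2_inner_cmult_left:
  "L2_inner M (\<lambda>x. c * f x) h = c * L2_inner M f h"
  unfolding L2_inner_def by (simp add: mult.assoc)

lemma L2_inner_diff_left:
  "f \<in> L2_space M \<Longrightarrow> g \<in> L2_space M \<Longrightarrow> h \<in> L2_space M \<Longrightarrow>
    L2_inner M (\<lambda>x. f x - g x) h = L2_inner M f h - L2_inner M g h"
  unfolding L2_inner_def by (simp add: left_diff_distrib Bochner_Integration.integral_diff L2_inner_integrable)

lemma L2_inner_commute: "L2_inner M g f = cnj (L2_inner M f g)"
proof -
  have "cnj (L2_inner M f g) = (\<integral>x. cnj (f x * cnj (g x)) \<partial>M)"
    unfolding L2_inner_def by (rule Bochner_Integration.integral_cnj[symmetric])
  then show ?thesis by (simp add: L2_inner_def mult.commute)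
qed

lemma L2_inner_add_right:
  "f \<in> L2_space M \<Longrightarrow> g \<in> L2_space M \<Longrightarrow> h \<in> L2_space M \<Longrightarrow>
    L2_inner M h (\<lambda>x. f x + g x) = L2_inner M h f + L2_inner M h g"
  using L2_inner_add_left[of f M g h] by (simp add: L2_inner_commute[of M h])

lemma L2_inner_cmult_right:
  "L2_inner M h (\<lambda>x. c * f x) = cnj c * L2_inner M h f"
  using L2_inner_cmult_left[of M c f h] by (simp add: L2_inner_commute[of M h])

lemma nsq_add_le:
  assumes "f \<in> L2_space M" "g \<in> L2_space M"
  shows "nsq M (\<lambda>x. f x + g x) \<le> 2 * nsq M f + 2 * nsq M g"
proof -
  have "nsq M (\<lambda>x. f x + g x) \<le> (\<integral>x. 2 * (norm (f x))\<^sup>2 + 2 * (norm (g x))\<^sup>2 \<partial>M)"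
    unfolding nsq_def using assms
    by (intro integral_mono norm_add_square_le L2_integrable L2_add) (auto simp: L2_space_def)
  also have "\<dots> = 2 * nsq M f + 2 * nsq M g"
    unfolding nsq_def using assms by (subst Bochner_Integration.integral_add) (auto intro: L2_integrable)
  finally show ?thesis .
qed

lemma nsq_parallelogram:
  assumes "f \<in> L2_space M" "g \<in> L2_space M"
  shows "nsq M (\<lambda>x. f x - g x) = 2 * nsq M f + 2 * nsq M g - 4 * nsq M (\<lambda>x. 1/2 * (f x + g x))"
proof -
  have "(norm (a - b))\<^sup>2 = 2 * (norm a)\<^sup>2 + 2 * (norm b)\<^sup>2 - 4 * (norm (1/2 * (a + b)))\<^sup>2" for a b :: complex
    by (simp only: norm_mult power_mult_distrib cmod_power2) (simp add: power2_eq_square field_simps)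
  moreover have "integrable M (\<lambda>x. (norm (1/2 * (f x + g x)))\<^sup>2)"
    by (intro L2_integrable L2_cmult L2_add assms)
  ultimately show ?thesis
    unfolding nsq_def using assms
    by (simp add: L2_integrable Bochner_Integration.integral_diff Bochner_Integration.integral_add
        del: times_divide_eq_left mult_1)
qed

lemma L2_Cauchy_Schwarz:
  assumes "f \<in> L2_space M" "g \<in> L2_space M"
  shows "(norm (L2_inner M f g))\<^sup>2 \<le> nsq M f * nsq M g"
proof -
  define a b z where "a = nsq M f" and "b = nsq M g" and "z = L2_inner M f g"
  have ab: "a \<ge> 0" "b \<ge> 0" by (auto simp: a_def b_def nsq_nonneg)
  have *: "0 \<le> a * s\<^sup>2 - 2 * s * (norm z)\<^sup>2 + b * (norm z)\<^sup>2" for s :: real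
  proof -
    \<comment> \<open>The factor \<open>z = L2_inner M f g\<close> makes the mixed terms real, so
      that positivity of the squared norm is a real quadratic inequality in \<open>s\<close>. It is
      used at its minimum \<open>s = (norm z)^2 / a\<close> or, when \<open>a = 0\<close>, at
      \<open>s = b + 1\<close>, where it forces \<open>z = 0\<close>.\<close>
    define h where "h x = of_real s * f x + (- z) * g x" for x
    have "complex_of_real (nsq M h) = L2_inner M h h" by (simp add: L2_inner_self)
    also have "\<dots> = of_real s * (of_real s * L2_inner M f f + cnj (- z) * L2_inner M f g)
       + (- z) * (of_real s * L2_inner M g f + cnj (- z) * L2_inner M g g)"
      unfolding h_def using assms
      by (simp only: L2_inner_add_left L2_inner_add_right L2_inner_cmult_left L2_inner_cmult_right
          L2_add L2_cmult complex_cnj_complex_of_real)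
    also have "\<dots> = of_real s * (of_real s * of_real a + cnj (- z) * z)
       + (- z) * (of_real s * cnj z + cnj (- z) * of_real b)"
      by (simp only: L2_inner_self a_def b_def z_def L2_inner_commute[of M g f])
    also have "\<dots> = of_real (a * s\<^sup>2 - 2 * s * (norm z)\<^sup>2 + b * (norm z)\<^sup>2)"
    proof -
      have "complex_of_real (a * s\<^sup>2 - 2 * s * (norm z)\<^sup>2 + b * (norm z)\<^sup>2)
          = of_real a * (of_real s)\<^sup>2 - 2 * of_real s * (z * cnj z) + of_real b * (z * cnj z)"
        by (simp only: complex_norm_square[symmetric] of_real_add of_real_diff of_real_mult of_real_power of_real_numeral)
      then show ?thesis by (simp only:) (simp add: power2_eq_square algebra_simps)
    qed
    finally show ?thesis using nsq_nonneg[of M h] by (simp only: of_real_eq_iff)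
  qed
  show ?thesis
  proof (cases "a = 0")
    case True
    have "norm z = 0"
    proof (rule ccontr)
      assume "norm z \<noteq> 0"
      then have n: "(norm z)\<^sup>2 > 0" by simp
      have "0 \<le> (b - 2 * (b + 1)) * (norm z)\<^sup>2" using *[of "b + 1"] True by (simp add: algebra_simps)
      with n ab show False by (simp add: zero_le_mult_iff)
    qed
    then show ?thesis using ab by (simp add: a_def b_def z_def)
  next
    case False
    then have "a > 0" using ab by simp
    from *[of "(norm z)\<^sup>2 / a"] have "(norm z)\<^sup>2 * (norm z)\<^sup>2 \<le> a * b * (norm z)\<^sup>2"
      using \<open>a > 0\<close> by (simp add: power2_eq_square field_simps)
    then have "(norm z)\<^sup>2 \<le> a * b"
    proof (cases "z = 0")
      case False
      then have "0 < (norm z)\<^sup>2" by simp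
      with \<open>(norm z)\<^sup>2 * (norm z)\<^sup>2 \<le> a * b * (norm z)\<^sup>2\<close> show ?thesis
        by (rule mult_right_le_imp_le)
    qed (use ab in auto)
    then show ?thesis by (simp add: a_def b_def z_def)
  qed
qed

lemma fast_subsequence:
  fixes Q :: "nat \<Rightarrow> nat \<Rightarrow> real" and b :: "nat \<Rightarrow> real"
  assumes "\<And>e. e > 0 \<Longrightarrow> \<exists>N. \<forall>n\<ge>N. \<forall>m\<ge>n. Q n m \<le> e" "\<And>k. b k > 0"
  shows "\<exists>s. strict_mono s \<and> (\<forall>k. \<forall>n\<ge>s k. \<forall>m\<ge>n. Q n m \<le> b k)"
proof -
  from assms have "\<forall>k. \<exists>N. \<forall>n\<ge>N. \<forall>m\<ge>n. Q n m \<le> b k" by blast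
  then obtain N where N: "\<And>k n m. n \<ge> N k \<Longrightarrow> m \<ge> n \<Longrightarrow> Q n m \<le> b k" by metis
  obtain s where "strict_mono s" "\<And>k. s k \<ge> N k" using ex_strict_mono_ge[of N] by blast
  then show ?thesis using N by (meson order_trans)
qed

context prob_space
begin

text \<open>Riesz-Fischer. A subsequence with squared distances at most \<open>(1/4)^k\<close> has
  almost everywhere summable increments, hence a pointwise limit. Fatou's lemma, applied along the
  subsequence, then bounds the distance of every late term of the full sequence from this
  limit.\<close>

lemma L2_complete:
  fixes v :: "nat \<Rightarrow> 'a \<Rightarrow> complex"
  assumes v: "\<And>n. v n \<in> L2_space M"
    and cauchy: "\<And>e. e > 0 \<Longrightarrow> \<exists>N. \<forall>n\<ge>N. \<forall>m\<ge>n. nsq M (\<lambda>x. v n x - v m x) \<le> e"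
  shows "\<exists>u\<in>L2_space M. (\<lambda>n. nsq M (\<lambda>x. v n x - u x)) \<longlonglongrightarrow> 0"
proof -
  obtain s where s: "strict_mono s"
    and sQ: "\<And>k n m. n \<ge> s k \<Longrightarrow> m \<ge> n \<Longrightarrow> nsq M (\<lambda>x. v n x - v m x) \<le> (1/4)^k"
    using fast_subsequence[of "\<lambda>n m. nsq M (\<lambda>x. v n x - v m x)" "\<lambda>k. (1/4)^k", OF cauchy] by auto
  define w where "w k = v (s k)" for k
  have w: "w k \<in> L2_space M" for k by (simp add: w_def v)
  have [measurable]: "v k \<in> borel_measurable M" "w k \<in> borel_measurable M" for k
    using v w by (auto intro: L2_measurable)
  define D where "D k x = norm (w (Suc k) x - w k x)" for k x
  have step: "(\<integral>\<^sup>+x. ennreal (D k x) \<partial>M) \<le> ennreal ((1/2)^k)" for k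
  proof -
    have Q: "nsq M (\<lambda>x. w k x - w (Suc k) x) \<le> (1/4)^k"
      unfolding w_def using s by (intro sQ) (auto simp: strict_mono_less_eq)
    have int2: "integrable M (\<lambda>x. (D k x)\<^sup>2)"
      unfolding D_def by (intro L2_integrable L2_diff w)
    \<comment> \<open>The weighted square from the bounded convergence proof again; as
      \<open>M\<close> has total mass one, integrating it bounds the integral of
      \<open>D k\<close>.\<close>
    have pt: "D k x \<le> 2^k / 2 * (D k x)\<^sup>2 + (1/2)^k / 2" for x
    proof -
      have "0 \<le> (2^k * D k x - 1)\<^sup>2 * ((1/2)^k / 2)" by simp
      also have "\<dots> = 2^k / 2 * (D k x)\<^sup>2 + (1/2)^k / 2 - D k x"
        by (simp add: power2_eq_square field_simps)
      finally show ?thesis by simp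
    qed
    have "(\<integral>\<^sup>+x. ennreal (D k x) \<partial>M) \<le> (\<integral>\<^sup>+x. ennreal (2^k / 2 * (D k x)\<^sup>2 + (1/2)^k / 2) \<partial>M)"
      by (intro nn_integral_mono ennreal_leI pt)
    also have "\<dots> = ennreal (\<integral>x. 2^k / 2 * (D k x)\<^sup>2 + (1/2)^k / 2 \<partial>M)"
      using int2 by (intro nn_integral_eq_integral) auto
    also have "(\<integral>x. 2^k / 2 * (D k x)\<^sup>2 + (1/2)^k / 2 \<partial>M) = 2^k / 2 * nsq M (\<lambda>x. w k x - w (Suc k) x) + (1/2)^k / 2"
      using int2 by (subst Bochner_Integration.integral_add) (auto simp: nsq_def D_def norm_minus_commute prob_space)
    also have "\<dots> \<le> 2^k / 2 * (1/4)^k + (1/2)^k / 2" using Q by (intro add_right_mono mult_left_mono) auto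
    also have "\<dots> = (1/2)^k"
      by (simp add: power_mult_distrib[symmetric] flip: power_divide)
    finally show ?thesis by (auto intro: ennreal_leI)
  qed
  have [measurable]: "D k \<in> borel_measurable M" for k unfolding D_def by measurable
  have "(\<integral>\<^sup>+x. (\<Sum>k. ennreal (D k x)) \<partial>M) = (\<Sum>k. \<integral>\<^sup>+x. ennreal (D k x) \<partial>M)"
    by (intro nn_integral_suminf) measurable
  also have "\<dots> \<le> (\<Sum>k. ennreal ((1/2)^k))" by (intro suminf_le step summableI)
  also have "\<dots> = ennreal (\<Sum>k. (1/2)^k)" by (intro suminf_ennreal2) (auto intro: summable_geometric)
  finally have "(\<integral>\<^sup>+x. (\<Sum>k. ennreal (D k x)) \<partial>M) < \<infinity>"
    using le_less_trans[OF _ ennreal_less_top] by simp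
  then have "AE x in M. (\<Sum>k. ennreal (D k x)) \<noteq> \<infinity>"
    by (intro nn_integral_PInf_AE) auto
  then have conv: "AE x in M. convergent (\<lambda>k. w k x)"
  proof eventually_elim
    case (elim x)
    have "summable (\<lambda>k. D k x)"
      using elim by (intro summable_suminf_not_top) (auto simp: D_def)
    then have "summable (\<lambda>k. w (Suc k) x - w k x)"
      unfolding D_def by (rule summable_norm_cancel)
    then have "convergent (\<lambda>n. \<Sum>k<n. w (Suc k) x - w k x)" by (simp add: summable_iff_convergent)
    then have "convergent (\<lambda>n. w n x - w 0 x)" by (simp only: sum_lessThan_telescope[of "\<lambda>k. w k x"])
    from convergent_add[OF this convergent_const[of "w 0 x"]] show ?case by simp
  qed
  define u where "u x = lim (\<lambda>k. w k x)" for x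
  have um [measurable]: "u \<in> borel_measurable M"
    unfolding u_def by (rule borel_measurable_lim_metric) measurable
  have limu: "AE x in M. (\<lambda>k. w k x) \<longlonglongrightarrow> u x"
    using conv by eventually_elim (simp add: u_def convergent_LIMSEQ_iff)
  have fatou: "(\<integral>\<^sup>+x. ennreal ((norm (v n x - u x))\<^sup>2) \<partial>M) \<le> ennreal ((1/4)^k)" if "n \<ge> s k" for n k
  proof -
    have "(\<integral>\<^sup>+x. ennreal ((norm (v n x - u x))\<^sup>2) \<partial>M)
        = (\<integral>\<^sup>+x. liminf (\<lambda>j. ennreal ((norm (v n x - w j x))\<^sup>2)) \<partial>M)"
    proof (rule nn_integral_cong_AE, use limu in eventually_elim)
      case (elim x)
      have "(\<lambda>j. ennreal ((norm (v n x - w j x))\<^sup>2)) \<longlonglongrightarrow> ennreal ((norm (v n x - u x))\<^sup>2)"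
        by (intro tendsto_ennrealI tendsto_intros elim)
      from lim_imp_Liminf[OF sequentially_bot this] show ?case by simp
    qed
    also have "\<dots> \<le> liminf (\<lambda>j. \<integral>\<^sup>+x. ennreal ((norm (v n x - w j x))\<^sup>2) \<partial>M)"
      by (intro nn_integral_liminf) measurable
    also have "\<dots> \<le> liminf (\<lambda>j. ennreal ((1/4)^k))"
    proof (intro Liminf_mono)
      have "(\<integral>\<^sup>+x. ennreal ((norm (v n x - w j x))\<^sup>2) \<partial>M) \<le> ennreal ((1/4)^k)" if "j \<ge> n" for j
      proof -
        have "(\<integral>\<^sup>+x. ennreal ((norm (v n x - w j x))\<^sup>2) \<partial>M) = ennreal (nsq M (\<lambda>x. v n x - w j x))"
          unfolding nsq_def by (intro nn_integral_eq_integral L2_integrable L2_diff v w) auto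
        also have "nsq M (\<lambda>x. v n x - w j x) \<le> (1/4)^k"
          unfolding w_def using \<open>n \<ge> s k\<close> that strict_mono_imp_increasing[OF s, of j] by (intro sQ) auto
        finally show ?thesis by (simp add: ennreal_leI)
      qed
      then show "eventually (\<lambda>j. (\<integral>\<^sup>+x. ennreal ((norm (v n x - w j x))\<^sup>2) \<partial>M) \<le> ennreal ((1/4)^k)) sequentially"
        by (auto simp: eventually_sequentially)
    qed
    also have "\<dots> = ennreal ((1/4)^k)" by (simp add: Liminf_const)
    finally show ?thesis .
  qed
  have diffL2: "(\<lambda>x. v (s 0) x - u x) \<in> L2_space M"
    unfolding L2_space_def using fatou[of 0 "s 0"]
    by (auto intro!: integrableI_bounded intro: le_less_trans)
  have uL2: "u \<in> L2_space M" using L2_diff[OF v diffL2, of "s 0"] by simp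
  have le: "nsq M (\<lambda>x. v n x - u x) \<le> (1/4)^k" if "n \<ge> s k" for n k
  proof -
    have "ennreal (nsq M (\<lambda>x. v n x - u x)) \<le> ennreal ((1/4)^k)"
      using fatou[OF that] unfolding nsq_def
      by (subst nn_integral_eq_integral[symmetric]) (rule L2_integrable[OF L2_diff[OF v uL2]], auto)
    then show ?thesis by (subst (asm) ennreal_le_iff) auto
  qed
  have "(\<lambda>n. nsq M (\<lambda>x. v n x - u x)) \<longlonglongrightarrow> 0"
  proof (rule LIMSEQ_I)
    fix r :: real assume "r > 0"
    then obtain k where k: "(1/4)^k < r" using real_arch_pow_inv[of r "1/4"] by auto
    then have "norm (nsq M (\<lambda>x. v n x - u x) - 0) < r" if "n \<ge> s k" for n
      using le[OF that] nsq_nonneg[of M "\<lambda>x. v n x - u x"] by simp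
    then show "\<exists>n0. \<forall>n\<ge>n0. norm (nsq M (\<lambda>x. v n x - u x) - 0) < r" by blast
  qed
  with uL2 show ?thesis by blast
qed

end

section \<open>Commuting measure preserving transformations\<close>

definition mpres :: "'a measure \<Rightarrow> ('a \<Rightarrow> 'a) \<Rightarrow> bool" where
  "mpres M S \<longleftrightarrow> S \<in> measurable M M \<and> distr M M S = M"

lemma mpres_comp: "mpres M S \<Longrightarrow> mpres M R \<Longrightarrow> mpres M (\<lambda>x. S (R x))"
  unfolding mpres_def using distr_distr[of S M M R M] by (auto simp: o_def)

lemma mpres_id: "mpres M (\<lambda>x. x)"
  by (simp add: mpres_def distr_id2)

lemma mpres_space: "mpres M S \<Longrightarrow> x \<in> space M \<Longrightarrow> S x \<in> space M"
  by (auto simp: mpres_def dest: measurable_space)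

lemma mpres_funpow: "mpres M S \<Longrightarrow> mpres M (S ^^ n)"
  by (induction n) (use mpres_id mpres_comp in \<open>auto simp: o_def id_def\<close>)

lemma mpres_AE: "mpres M S \<Longrightarrow> AE x in M. P x \<Longrightarrow> AE x in M. P (S x)"
  unfolding mpres_def by (metis AE_distrD)

lemma mpres_integral:
  fixes F :: "'a \<Rightarrow> 'b::{banach, second_countable_topology}"
  assumes "mpres M S" "F \<in> borel_measurable M"
  shows "(\<integral>x. F (S x) \<partial>M) = (\<integral>x. F x \<partial>M)"
  using integral_distr[of S M M F] assms by (simp add: mpres_def)

lemma mpres_L2:
  assumes "mpres M S" "f \<in> L2_space M"
  shows "(\<lambda>x. f (S x)) \<in> L2_space M"
proof -
  have "integrable (distr M M S) (\<lambda>x. (norm (f x))\<^sup>2)" using assms by (auto simp: mpres_def L2_space_def)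
  then have "integrable M (\<lambda>x. (norm (f (S x)))\<^sup>2)"
    using assms by (subst (asm) integrable_distr_eq) (auto simp: mpres_def L2_space_def)
  then show ?thesis using assms by (auto simp: L2_space_def mpres_def)
qed

lemma mpres_nsq: "mpres M S \<Longrightarrow> f \<in> L2_space M \<Longrightarrow> nsq M (\<lambda>x. f (S x)) = nsq M f"
  unfolding nsq_def by (rule mpres_integral[of M S "\<lambda>x. (norm (f x))\<^sup>2"]) (auto simp: L2_space_def)

lemma mpres_inner:
  assumes "mpres M S" "f \<in> L2_space M" "h \<in> L2_space M"
  shows "L2_inner M (\<lambda>x. f (S x)) (\<lambda>x. h (S x)) = L2_inner M f h"
proof -
  have [measurable]: "f \<in> borel_measurable M" "h \<in> borel_measurable M"
    using assms by (auto intro: L2_measurable)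
  show ?thesis unfolding L2_inner_def
    by (rule mpres_integral[of M S "\<lambda>x. f x * cnj (h x)"]) (use assms(1) in measurable)
qed

lemma invertible_mpt_mpres: "invertible_mpt M S \<Longrightarrow> mpres M S"
  by (simp add: invertible_mpt_def mpres_def)

lemma invertible_mpt_bij: "invertible_mpt M S \<Longrightarrow> bij_betw S (space M) (space M)"
  by (simp add: invertible_mpt_def)

lemma invertible_mpt_inv:
  assumes "invertible_mpt M S"
  shows "mpres M (inv_into (space M) S)"
proof -
  let ?R = "inv_into (space M) S"
  have b: "bij_betw S (space M) (space M)" and S: "S \<in> measurable M M" "distr M M S = M"
    and R: "?R \<in> measurable M M"
    using assms by (auto simp: invertible_mpt_def)
  have "distr M M ?R = distr (distr M M S) M ?R" using S by simp
  also have "\<dots> = distr M M (?R \<circ> S)" by (rule distr_distr[OF R S(1)])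
  also have "\<dots> = distr M M (\<lambda>x. x)"
    by (intro distr_cong) (use b in \<open>auto simp: bij_betw_def\<close>)
  finally show ?thesis using R by (simp add: mpres_def distr_id2)
qed

lemma int_iter_mpres: "invertible_mpt M S \<Longrightarrow> mpres M (int_iter M S k)"
  unfolding int_iter_def by (auto intro: mpres_funpow[OF invertible_mpt_mpres] mpres_funpow[OF invertible_mpt_inv])

lemma int_iter_0 [simp]: "int_iter M S 0 x = x"
  by (simp add: int_iter_def)

lemma int_iter_Suc:
  assumes "invertible_mpt M S" "x \<in> space M"
  shows "int_iter M S (k + 1) x = S (int_iter M S k x)"
proof (cases "k \<ge> 0")
  case True
  then have "nat (k + 1) = Suc (nat k)" by simp
  then show ?thesis using True by (simp add: int_iter_def)
next
  case False
  let ?R = "inv_into (space M) S"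
  have *: "nat (- k) = Suc (nat (- (k + 1)))" using False by simp
  have "(?R ^^ nat (- (k + 1))) x \<in> space M"
    using assms by (intro mpres_space[OF mpres_funpow] invertible_mpt_inv)
  then have "S (?R ((?R ^^ nat (- (k + 1))) x)) = (?R ^^ nat (- (k + 1))) x"
    using invertible_mpt_bij[OF assms(1)] by (simp add: bij_betw_def f_inv_into_f)
  \<comment> \<open>For \<open>k = -1\<close> the exponent \<open>k + 1\<close> is zero and
    \<open>int_iter\<close> falls into its forward branch; both sides are then the identity.\<close>
  moreover have "(?R ^^ nat (- (k + 1))) x = int_iter M S (k + 1) x"
    using False by (cases "k = -1") (auto simp: int_iter_def)
  moreover have "?R ((?R ^^ nat (- (k + 1))) x) = int_iter M S k x"
    using False by (simp only: int_iter_def * if_False funpow.simps o_apply)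
  ultimately show ?thesis by simp
qed

text \<open>Both steps link \<open>k\<close> and \<open>k + 1\<close>, so the single law
  \<open>int_iter_Suc\<close> serves in both directions: upwards directly, downwards after
  cancelling the injective \<open>S\<close>.\<close>

lemma int_up_down_induct [consumes 0, case_names zero up down]:
  assumes "P (0::int)" "\<And>k. P k \<Longrightarrow> P (k + 1)" "\<And>k. P (k + 1) \<Longrightarrow> P k"
  shows "P k"
proof (induction k rule: int_induct[of _ 0])
  case base
  show ?case by (rule assms(1))
next
  case (step1 i)
  then show ?case by (intro assms(2))
next
  case (step2 i)
  then show ?case using assms(3)[of "i - 1"] by simp
qed

lemma int_iter_commute:
  assumes S: "invertible_mpt M S" and R: "\<And>x. x \<in> space M \<Longrightarrow> R x \<in> space M"
    and comm: "\<And>x. x \<in> space M \<Longrightarrow> R (S x) = S (R x)" and x: "x \<in> space M"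
  shows "R (int_iter M S k x) = int_iter M S k (R x)"
proof (induction k rule: int_up_down_induct)
  case (up k)
  have "int_iter M S k x \<in> space M" using int_iter_mpres[OF S] x by (rule mpres_space)
  with up show ?case using S x R comm by (simp add: int_iter_Suc)
next
  case (down k)
  have sp: "int_iter M S k y \<in> space M" if "y \<in> space M" for y using int_iter_mpres[OF S] that by (rule mpres_space)
  have "S (R (int_iter M S k x)) = S (int_iter M S k (R x))"
    using down S x R comm sp by (simp add: int_iter_Suc)
  moreover have "inj_on S (space M)" using invertible_mpt_bij[OF S] by (simp add: bij_betw_def)
  ultimately show ?case using R sp x by (auto dest: inj_onD)
qed simp

lemma int_iter_add:
  assumes S: "invertible_mpt M S" and x: "x \<in> space M"
  shows "int_iter M S (j + k) x = int_iter M S j (int_iter M S k x)"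
proof (induction j rule: int_up_down_induct)
  case (up j)
  have "int_iter M S k x \<in> space M" using int_iter_mpres[OF S] x by (rule mpres_space)
  with up show ?case using int_iter_Suc[OF S, of _ "j + k"] int_iter_Suc[OF S, of _ j] x
    by (simp add: ac_simps)
next
  case (down j)
  have sp: "int_iter M S k y \<in> space M" if "y \<in> space M" for y k using int_iter_mpres[OF S] that by (rule mpres_space)
  have "S (int_iter M S (j + k) x) = S (int_iter M S j (int_iter M S k x))"
    using down int_iter_Suc[OF S, of _ "j + k"] int_iter_Suc[OF S, of _ j] x sp by (simp add: ac_simps)
  moreover have "inj_on S (space M)" using invertible_mpt_bij[OF S] by (simp add: bij_betw_def)
  ultimately show ?case using sp x by (auto dest: inj_onD)
qed simp

section \<open>The lattice action of the commuting transformations\<close>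

locale commuting_system =
  fixes M :: "'a measure" and l :: nat and T :: "nat \<Rightarrow> 'a \<Rightarrow> 'a"
  assumes system: "mp_system M l T"
begin

sublocale prob_space M using system by (simp add: mp_system_def)

lemma inv_T: "i \<in> {1..l} \<Longrightarrow> invertible_mpt M (T i)"
  using system by (simp add: mp_system_def)

lemma comm_T: "i \<in> {1..l} \<Longrightarrow> j \<in> {1..l} \<Longrightarrow> x \<in> space M \<Longrightarrow> T i (T j x) = T j (T i x)"
  using system by (simp add: mp_system_def)

text \<open>Arbitrary lists of indices allow induction over the transformations one by one;
  \<open>translate\<close> below is the list of all of them.\<close>

definition act :: "nat list \<Rightarrow> (nat \<Rightarrow> int) \<Rightarrow> 'a \<Rightarrow> 'a" where
  "act xs k = foldr (\<lambda>i h. h \<circ> int_iter M (T i) (k i)) xs id"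

lemma act_Nil [simp]: "act [] k x = x" by (simp add: act_def)

lemma act_Cons [simp]: "act (i # xs) k x = act xs k (int_iter M (T i) (k i) x)" by (simp add: act_def)

lemma act_mpres: "set xs \<subseteq> {1..l} \<Longrightarrow> mpres M (act xs k)"
proof (induction xs)
  case Nil
  then show ?case using mpres_id by (simp add: act_def id_def)
next
  case (Cons i xs)
  then have "mpres M (\<lambda>x. act xs k (int_iter M (T i) (k i) x))"
    by (intro mpres_comp[OF Cons.IH int_iter_mpres[OF inv_T]]) auto
  then show ?case by (simp add: act_def comp_def)
qed

lemma int_iter_T_space: "i \<in> {1..l} \<Longrightarrow> x \<in> space M \<Longrightarrow> int_iter M (T i) a x \<in> space M"
  using mpres_space[OF int_iter_mpres[OF inv_T]] .

lemma int_iter_T_commute: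
  assumes "i \<in> {1..l}" "j \<in> {1..l}" "x \<in> space M"
  shows "int_iter M (T i) a (int_iter M (T j) b x) = int_iter M (T j) b (int_iter M (T i) a x)"
proof (rule int_iter_commute[OF inv_T[OF assms(2)] _ _ assms(3)])
  fix y assume y: "y \<in> space M"
  show "int_iter M (T i) a y \<in> space M" by (rule int_iter_T_space[OF assms(1) y])
  show "int_iter M (T i) a (T j y) = T j (int_iter M (T i) a y)"
    using mpres_space[OF invertible_mpt_mpres[OF inv_T[OF assms(2)]]] comm_T[OF assms(2,1)] y
    by (rule int_iter_commute[OF inv_T[OF assms(1)], where R = "T j", symmetric])
qed

lemma act_commute_int_iter:
  assumes "set xs \<subseteq> {1..l}" "i \<in> {1..l}" "x \<in> space M"
  shows "act xs k (int_iter M (T i) a x) = int_iter M (T i) a (act xs k x)"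
  using assms
proof (induction xs arbitrary: x)
  case (Cons j xs)
  then have j: "j \<in> {1..l}" "set xs \<subseteq> {1..l}" by auto
  have "act (j # xs) k (int_iter M (T i) a x) = act xs k (int_iter M (T i) a (int_iter M (T j) (k j) x))"
    using int_iter_T_commute[OF j(1) Cons.prems(2,3)] by (simp only: act_Cons)
  also have "\<dots> = int_iter M (T i) a (act xs k (int_iter M (T j) (k j) x))"
    by (rule Cons.IH[OF j(2) Cons.prems(2) int_iter_T_space[OF j(1) Cons.prems(3)]])
  finally show ?case by (simp only: act_Cons)
qed simp

text \<open>The iterate with exponent \<open>j i\<close> has to be moved past all of
  \<open>act xs k\<close>; this is where commutativity enters.\<close>

lemma act_add:
  assumes "set xs \<subseteq> {1..l}" "x \<in> space M"
  shows "act xs (\<lambda>i. j i + k i) x = act xs j (act xs k x)"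
  using assms
proof (induction xs arbitrary: x)
  case (Cons i xs)
  then have i: "i \<in> {1..l}" "set xs \<subseteq> {1..l}" by auto
  have sp: "int_iter M (T i) (k i) x \<in> space M" "act xs k (int_iter M (T i) (k i) x) \<in> space M"
    using i Cons.prems by (auto intro!: int_iter_T_space mpres_space[OF act_mpres])
  have "act (i # xs) (\<lambda>i. j i + k i) x
      = act xs (\<lambda>i. j i + k i) (int_iter M (T i) (j i) (int_iter M (T i) (k i) x))"
    using int_iter_add[OF inv_T[OF i(1)] Cons.prems(2)] by simp
  also have "\<dots> = act xs j (act xs k (int_iter M (T i) (j i) (int_iter M (T i) (k i) x)))"
    using i sp by (intro Cons.IH) (auto intro: int_iter_T_space)
  also have "act xs k (int_iter M (T i) (j i) (int_iter M (T i) (k i) x))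
     = int_iter M (T i) (j i) (act xs k (int_iter M (T i) (k i) x))"
    using i sp by (intro act_commute_int_iter) auto
  finally show ?case by simp
qed simp

lemma act_cong: "(\<And>i. i \<in> set xs \<Longrightarrow> j i = k i) \<Longrightarrow> act xs j x = act xs k x"
  by (induction xs arbitrary: x) auto

lemma act_trivial: "(\<And>i. i \<in> set xs \<Longrightarrow> k i = 0) \<Longrightarrow> act xs k x = x"
  by (induction xs) auto

lemma act_single:
  assumes "distinct xs" "i \<in> set xs" "i \<in> {1..l}" "x \<in> space M"
  shows "act xs (\<lambda>j. if j = i then 1 else 0) x = T i x"
  using assms
proof (induction xs arbitrary: x)
  case (Cons j xs)
  show ?case
  proof (cases "j = i")
    case True
    then have "act xs (\<lambda>j. if j = i then 1 else 0) (T i x) = T i x"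
      using Cons.prems by (intro act_trivial) auto
    then show ?thesis using True int_iter_Suc[OF inv_T[OF Cons.prems(3)] Cons.prems(4), of 0] by simp
  next
    case False
    then show ?thesis using Cons by simp
  qed
qed simp

definition translate :: "(nat \<Rightarrow> int) \<Rightarrow> 'a \<Rightarrow> 'a" where
  "translate = act [1..<Suc l]"

lemma koopman_prod_eq: "koopman_prod M l T k f = (\<lambda>x. f (translate k x))"
proof -
  have "foldr (\<lambda>i h. h \<circ> int_iter M (T i) (k i)) xs f = f \<circ> foldr (\<lambda>i h. h \<circ> int_iter M (T i) (k i)) xs id" for xs
    by (induction xs) (auto simp: o_assoc)
  then show ?thesis by (simp only: koopman_prod_def translate_def act_def comp_def)
qed

lemma translate_mpres: "mpres M (translate k)"
  unfolding translate_def by (rule act_mpres) auto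

lemma translate_space: "x \<in> space M \<Longrightarrow> translate k x \<in> space M"
  using mpres_space[OF translate_mpres] .

lemma translate_add: "x \<in> space M \<Longrightarrow> translate (\<lambda>i. j i + k i) x = translate j (translate k x)"
  unfolding translate_def by (rule act_add) auto

lemma translate_cong: "(\<And>i. i \<in> {1..l} \<Longrightarrow> j i = k i) \<Longrightarrow> translate j x = translate k x"
  unfolding translate_def by (rule act_cong) auto

lemma translate_single: "i \<in> {1..l} \<Longrightarrow> x \<in> space M \<Longrightarrow> translate (\<lambda>j. if j = i then 1 else 0) x = T i x"
  unfolding translate_def by (rule act_single) auto

text \<open>Invariance fails on a null set at most, and its preimage under an iterate is null again
  because iterates preserve the measure.\<close>

lemma invariant_int_iter:
  assumes i: "i \<in> {1..l}" and h: "AE x in M. h (T i x) = h x"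
  shows "AE x in M. h (int_iter M (T i) k x) = h x"
proof (induction k rule: int_up_down_induct)
  case (up k)
  have "AE x in M. h (T i (int_iter M (T i) k x)) = h (int_iter M (T i) k x)"
    by (rule mpres_AE[OF int_iter_mpres[OF inv_T[OF i]] h])
  with up AE_space show ?case by eventually_elim (simp add: int_iter_Suc[OF inv_T[OF i]])
next
  case (down k)
  have "AE x in M. h (T i (int_iter M (T i) k x)) = h (int_iter M (T i) k x)"
    by (rule mpres_AE[OF int_iter_mpres[OF inv_T[OF i]] h])
  with down AE_space show ?case by eventually_elim (simp add: int_iter_Suc[OF inv_T[OF i]])
qed simp

lemma invariant_act:
  assumes "set xs \<subseteq> {1..l}" "\<And>i. i \<in> {1..l} \<Longrightarrow> AE x in M. h (T i x) = h x"
  shows "AE x in M. h (act xs k x) = h x"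
  using assms(1)
proof (induction xs)
  case (Cons i xs)
  then have i: "i \<in> {1..l}" "AE x in M. h (act xs k x) = h x" by auto
  from mpres_AE[OF int_iter_mpres[OF inv_T[OF i(1)]] i(2), of "k i"]
    invariant_int_iter[OF i(1) assms(2)[OF i(1)], of "k i"]
  show ?case by eventually_elim simp
qed simp

section \<open>Invariant functions and correlations\<close>

abbreviation V :: "('a \<Rightarrow> complex) set" where "V \<equiv> invariant_L2 M l T"

lemma V_translate: "h \<in> V \<Longrightarrow> AE x in M. h (translate k x) = h x"
  unfolding translate_def by (rule invariant_act) (auto simp: invariant_L2_def)

lemma V_L2: "h \<in> V \<Longrightarrow> h \<in> L2_space M"
  by (simp add: invariant_L2_def)

lemma L2_inner_cong_AE:
  assumes "AE x in M. f x = f' x" "AE x in M. h x = h' x"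
    "f \<in> L2_space M" "f' \<in> L2_space M" "h \<in> L2_space M" "h' \<in> L2_space M"
  shows "L2_inner M f h = L2_inner M f' h'"
proof -
  have [measurable]: "f \<in> borel_measurable M" "f' \<in> borel_measurable M" "h \<in> borel_measurable M" "h' \<in> borel_measurable M"
    using assms by (auto intro: L2_measurable)
  show ?thesis unfolding L2_inner_def
    by (rule integral_cong_AE, measurable) (use assms(1,2) in eventually_elim, simp)
qed

lemma translate_L2: "f \<in> L2_space M \<Longrightarrow> (\<lambda>x. f (translate k x)) \<in> L2_space M"
  by (rule mpres_L2[OF translate_mpres])

lemma inner_translate_V:
  assumes "f \<in> L2_space M" "h \<in> V"
  shows "L2_inner M (\<lambda>x. f (translate k x)) h = L2_inner M f h"
proof -
  have "L2_inner M (\<lambda>x. f (translate k x)) h = L2_inner M (\<lambda>x. f (translate k x)) (\<lambda>x. h (translate k x))"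
    using V_translate[OF assms(2), of k] assms
    by (intro L2_inner_cong_AE) (auto intro: V_L2 translate_L2)
  also have "\<dots> = L2_inner M f h" by (intro mpres_inner translate_mpres assms V_L2)
  finally show ?thesis .
qed

text \<open>Classically, the Fourier coefficients of the spectral measure of
  \<open>f\<close>.\<close>

definition corr :: "('a \<Rightarrow> complex) \<Rightarrow> (nat \<Rightarrow> int) \<Rightarrow> complex" where
  "corr f k = L2_inner M (\<lambda>x. f (translate k x)) f"

lemma corr_cong: "(\<And>i. i \<in> {1..l} \<Longrightarrow> j i = k i) \<Longrightarrow> corr f j = corr f k"
  unfolding corr_def using translate_cong by metis

lemma inner_translate:
  assumes "f \<in> L2_space M"
  shows "L2_inner M (\<lambda>x. f (translate j x)) (\<lambda>x. f (translate k x)) = corr f (\<lambda>i. j i - k i)"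
proof -
  have "translate j x = translate (\<lambda>i. j i - k i) (translate k x)" if "x \<in> space M" for x
    using translate_add[OF that, of "\<lambda>i. j i - k i" k] by simp
  then have "L2_inner M (\<lambda>x. f (translate j x)) (\<lambda>x. f (translate k x))
      = L2_inner M (\<lambda>x. f (translate (\<lambda>i. j i - k i) (translate k x))) (\<lambda>x. f (translate k x))"
    unfolding L2_inner_def by (intro Bochner_Integration.integral_cong) simp_all
  also have "\<dots> = corr f (\<lambda>i. j i - k i)"
    unfolding corr_def
    by (rule mpres_inner[OF translate_mpres translate_L2[OF assms] assms])
  finally show ?thesis .
qed

end

section \<open>Positive definite functions on the integer lattice\<close>

lemma e1_sum: "e1 (\<Sum>i\<in>I. x i) = (\<Prod>i\<in>I. e1 (x i))"
  by (induction I rule: infinite_finite_induct) (auto simp: e1_add)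

lemma chr_mult: "chr l j \<theta> * chr l k \<theta> = chr l (\<lambda>i. j i + k i) \<theta>"
  by (simp add: chr_def e1_add[symmetric] sum.distrib distrib_left)

lemma cnj_chr: "cnj (chr l k \<theta>) = chr l (\<lambda>i. - k i) \<theta>"
  by (simp add: chr_def e1_minus[symmetric] sum_negf)

lemma norm_chr [simp]: "norm (chr l k \<theta>) = 1"
  by (simp add: chr_def)

inductive_set trig :: "nat \<Rightarrow> ((nat \<Rightarrow> real) \<Rightarrow> complex) set" for l where
  chr: "chr l k \<in> trig l"
| add: "p \<in> trig l \<Longrightarrow> q \<in> trig l \<Longrightarrow> (\<lambda>\<theta>. p \<theta> + q \<theta>) \<in> trig l"
| cmult: "p \<in> trig l \<Longrightarrow> (\<lambda>\<theta>. c * p \<theta>) \<in> trig l"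

lemma trig_const: "(\<lambda>_. c) \<in> trig l"
  using trig.cmult[OF trig.chr[of l "\<lambda>_. 0"], of c] by (simp add: chr_def)

lemma trig_mult: "p \<in> trig l \<Longrightarrow> q \<in> trig l \<Longrightarrow> (\<lambda>\<theta>. p \<theta> * q \<theta>) \<in> trig l"
proof (induction p rule: trig.induct)
  case (chr j)
  then show ?case
  proof (induction q rule: trig.induct)
    case (chr k)
    show ?case unfolding chr_mult by (rule trig.chr)
  next
    case (add p q)
    from trig.add[OF add.IH] show ?case by (simp only: distrib_left)
  next
    case (cmult p c)
    from trig.cmult[OF cmult.IH, of c] show ?case by (simp only: mult.left_commute)
  qed
next
  case (add p p')
  from trig.add[OF add.IH(1)[OF add.prems] add.IH(2)[OF add.prems]] show ?case by (simp only: distrib_right)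
next
  case (cmult p c)
  from trig.cmult[OF cmult.IH[OF cmult.prems], of c] show ?case by (simp only: mult.assoc)
qed

lemma trig_cnj: "p \<in> trig l \<Longrightarrow> (\<lambda>\<theta>. cnj (p \<theta>)) \<in> trig l"
proof (induction p rule: trig.induct)
  case (chr k)
  show ?case unfolding cnj_chr by (rule trig.chr)
next
  case (add p q)
  from trig.add[OF add.IH] show ?case by (simp only: complex_cnj_add)
next
  case (cmult p c)
  from trig.cmult[OF cmult.IH, of "cnj c"] show ?case by (simp only: complex_cnj_mult)
qed

lemma trig_continuous: "p \<in> trig l \<Longrightarrow> continuous_on UNIV p"
proof (induction p rule: trig.induct)
  case (chr k)
  have "continuous_on UNIV (\<lambda>\<theta> :: nat \<Rightarrow> real. \<Sum>i=1..l. \<theta> i * of_int (k i))"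
    by (rule continuous_on_sum, rule continuous_on_mult, rule continuous_on_product_coordinates, rule continuous_on_const)
  then have "continuous_on UNIV (\<lambda>\<theta>. exp (\<i> * of_real (2 * pi * (\<Sum>i=1..l. \<theta> i * of_int (k i)))))"
    by (intro continuous_on_exp continuous_on_mult continuous_on_const continuous_on_of_real)
  moreover have "chr l k = (\<lambda>\<theta>. exp (\<i> * of_real (2 * pi * (\<Sum>i=1..l. \<theta> i * of_int (k i)))))"
    by (simp add: fun_eq_iff chr_def e1_def cis_conv_exp)
  ultimately show ?case by (simp only:)
qed (auto intro: continuous_on_add continuous_on_mult continuous_on_const)

text \<open>The terms are the powers of a \<open>Q\<close>-th root of unity, which differs from 1
  for nonzero \<open>m\<close> by the size condition.\<close>

lemma e1_geometric_sum:
  assumes "\<bar>m\<bar> < int Q"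
  shows "(\<Sum>q<Q. e1 (of_nat q / of_nat Q * of_int m)) = (if m = 0 then of_nat Q else 0)"
proof (cases "m = 0")
  case False
  define z where "z = e1 (of_int m / of_nat Q)"
  have Q: "Q > 0" using assms by auto
  have pow: "e1 (of_nat q / of_nat Q * of_int m) = z ^ q" for q
    by (simp add: z_def e1_def Complex.DeMoivre mult_ac)
  have zQ: "z ^ Q = 1" using pow[of Q] Q e1_of_int[of m] by simp
  have "z \<noteq> 1"
  proof (cases "m > 0")
    case True
    then show ?thesis unfolding z_def using assms Q by (intro e1_neq_1) auto
  next
    case neg: False
    have "e1 (of_int (- m) / of_nat Q) \<noteq> 1" using assms Q neg False
      by (intro e1_neq_1) (auto simp: field_simps)
    moreover have "e1 (of_int (- m) / of_nat Q) = cnj z" by (simp add: z_def e1_minus[symmetric])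
    ultimately show ?thesis by auto
  qed
  then have "(\<Sum>q<Q. z ^ q) = 0" using zQ by (simp add: sum_gp_strict)
  then show ?thesis using False by (simp only: pow if_False)
qed simp

section \<open>Fejer means on finite grids\<close>

definition cube :: "nat \<Rightarrow> nat \<Rightarrow> (nat \<Rightarrow> int) set" where
  "cube l N = PiE {1..l} (\<lambda>_. {0..<int N})"

definition grid :: "nat \<Rightarrow> nat \<Rightarrow> (nat \<Rightarrow> nat) set" where
  "grid l Q = PiE {1..l} (\<lambda>_. {..<Q})"

text \<open>Members of \<open>grid l Q\<close> are \<open>undefined\<close> outside
  \<open>{1..l}\<close>; the value 0 there puts the point into \<open>torus\<close>, which
  constrains all coordinates.\<close>

definition gridpt :: "nat \<Rightarrow> nat \<Rightarrow> (nat \<Rightarrow> nat) \<Rightarrow> nat \<Rightarrow> real" where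
  "gridpt l Q q i = (if i \<in> {1..l} then of_nat (q i) / of_nat Q else 0)"

lemma finite_cube: "finite (cube l N)"
  unfolding cube_def by (intro finite_PiE) auto

lemma grid_orthogonality:
  assumes "\<And>i. i \<in> {1..l} \<Longrightarrow> \<bar>m i\<bar> < int Q"
  shows "(\<Sum>q\<in>grid l Q. chr l m (gridpt l Q q)) = of_nat Q ^ l * (\<Prod>i=1..l. if m i = 0 then 1 else 0)"
proof -
  have "(\<Sum>q\<in>grid l Q. chr l m (gridpt l Q q))
      = (\<Sum>q\<in>grid l Q. \<Prod>i=1..l. e1 (of_nat (q i) / of_nat Q * of_int (m i)))"
    by (intro sum.cong refl) (auto simp: chr_def e1_sum gridpt_def intro!: prod.cong)
  also have "\<dots> = (\<Prod>i=1..l. \<Sum>q<Q. e1 (of_nat q / of_nat Q * of_int (m i)))"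
    unfolding grid_def
    by (rule prod_sum_PiE[of "{1..l}" "\<lambda>_. {..<Q}" "\<lambda>i q. e1 (of_nat q / of_nat Q * of_int (m i))", symmetric]) auto
  also have "\<dots> = (\<Prod>i=1..l. of_nat Q * (if m i = 0 then 1 else 0))"
    using e1_geometric_sum[OF assms] by (intro prod.cong refl) auto
  finally show ?thesis by (simp add: prod.distrib)
qed

text \<open>For fixed \<open>a\<close> the only candidate is \<open>b = a - k\<close>, and both lie
  in the interval for \<open>N - \<bar>k\<bar>\<close> values of \<open>a\<close>: the triangular
  weight of the Fejer kernel.\<close>

lemma cube_overlap:
  assumes "\<bar>k\<bar> \<le> int N"
  shows "(\<Sum>a\<in>{0..<int N}. \<Sum>b\<in>{0..<int N}. if k - a + b = 0 then 1 else 0) = (of_int (int N - \<bar>k\<bar>) :: complex)"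
proof -
  have "(\<Sum>a\<in>{0..<int N}. \<Sum>b\<in>{0..<int N}. if k - a + b = 0 then 1 else (0::complex))
      = (\<Sum>a\<in>{0..<int N}. if a - k \<in> {0..<int N} then 1 else 0)"
  proof (rule sum.cong[OF refl])
    fix a
    have "k - a + b = 0 \<longleftrightarrow> b = a - k" for b by auto
    then show "(\<Sum>b\<in>{0..<int N}. if k - a + b = 0 then 1 else (0::complex)) = (if a - k \<in> {0..<int N} then 1 else 0)"
      by (simp add: sum.delta)
  qed
  also have "\<dots> = of_nat (card {a \<in> {0..<int N}. a - k \<in> {0..<int N}})"
    by (simp add: sum.If_cases Int_def)
  also have "{a \<in> {0..<int N}. a - k \<in> {0..<int N}} = {max 0 k..<min (int N) (int N + k)}" by auto
  also have "of_nat (card \<dots>) = (of_int (int N - \<bar>k\<bar>) :: complex)"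
    using assms by (simp add: of_nat_nat max_def min_def)
  finally show ?thesis .
qed

text \<open>The setting of the Herglotz-Bochner theorem; \<open>functional\<close> below acts as
  integration against the representing measure. Lattice points are total functions, so
  \<open>cong\<close> says that only the coordinates in \<open>{1..l}\<close> count.\<close>

locale positive_definite =
  fixes l :: nat and c :: "(nat \<Rightarrow> int) \<Rightarrow> complex"
  assumes cong: "(\<And>i. i \<in> {1..l} \<Longrightarrow> j i = k i) \<Longrightarrow> c j = c k"
    and pos: "finite J \<Longrightarrow> 0 \<le> Re (\<Sum>j\<in>J. \<Sum>k\<in>J. a j * cnj (a k) * c (\<lambda>i. j i - k i))"
begin

text \<open>Fejer means of the Fourier series with coefficients \<open>c\<close>: nonnegative weights on a finite grid which is
  fine enough for the characters in question to be orthogonal.\<close>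

definition weight :: "nat \<Rightarrow> (nat \<Rightarrow> real) \<Rightarrow> complex" where
  "weight N \<theta> = (\<Sum>j\<in>cube l N. \<Sum>k\<in>cube l N. cnj (chr l j \<theta>) * chr l k \<theta> * c (\<lambda>i. j i - k i))"

definition approx_functional :: "nat \<Rightarrow> ((nat \<Rightarrow> real) \<Rightarrow> complex) \<Rightarrow> complex" where
  "approx_functional N p = (\<Sum>q\<in>grid l (2 * N). p (gridpt l (2 * N) q) * weight N (gridpt l (2 * N) q))
     / (of_nat N ^ l * of_nat (2 * N) ^ l)"

text \<open>The limit is known to exist on \<open>trig l\<close>, by
  \<open>functional_tendsto\<close>.\<close>

definition functional :: "((nat \<Rightarrow> real) \<Rightarrow> complex) \<Rightarrow> complex" where
  "functional p = lim (\<lambda>N. approx_functional N p)"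

lemma weight_nonneg: "0 \<le> Re (weight N \<theta>)"
  unfolding weight_def using pos[OF finite_cube, of "\<lambda>j. cnj (chr l j \<theta>)" l N] by simp

text \<open>With \<open>2 * N\<close> grid points per coordinate no aliasing occurs:
  \<open>k - a + b\<close> is below \<open>2 * N\<close> in modulus, with at most \<open>N\<close>
  from \<open>k\<close> and \<open>N - 1\<close> from \<open>a\<close> and \<open>b\<close>.
  Orthogonality keeps exactly the pairs with \<open>a - b = k\<close> on \<open>{1..l}\<close>, and
  their number is the product of the triangular weights.\<close>

lemma approx_functional_chr:
  assumes N: "N > 0" "\<And>i. i \<in> {1..l} \<Longrightarrow> \<bar>k i\<bar> \<le> int N"
  shows "approx_functional N (chr l k) = c k * (\<Prod>i=1..l. of_int (int N - \<bar>k i\<bar>) / of_nat N)"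
proof -
  let ?Q = "2 * N"
  have "(\<Sum>q\<in>grid l ?Q. chr l k (gridpt l ?Q q) * weight N (gridpt l ?Q q))
      = (\<Sum>q\<in>grid l ?Q. \<Sum>a\<in>cube l N. \<Sum>b\<in>cube l N. c (\<lambda>i. a i - b i) * chr l (\<lambda>i. k i - a i + b i) (gridpt l ?Q q))"
  proof -
    have "chr l (\<lambda>i. k i - a i + b i) \<theta> = chr l k \<theta> * cnj (chr l a \<theta>) * chr l b \<theta>" for a b \<theta>
      by (simp only: cnj_chr chr_mult diff_conv_add_uminus)
    then show ?thesis unfolding weight_def sum_distrib_left
      by (intro sum.cong refl) (simp only: mult_ac)
  qed
  also have "\<dots> = (\<Sum>a\<in>cube l N. \<Sum>b\<in>cube l N. c (\<lambda>i. a i - b i) * (\<Sum>q\<in>grid l ?Q. chr l (\<lambda>i. k i - a i + b i) (gridpt l ?Q q)))"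
    unfolding sum_distrib_left
    by (rule trans[OF sum.swap], rule sum.cong[OF refl], rule sum.swap)
  also have "\<dots> = (\<Sum>a\<in>cube l N. \<Sum>b\<in>cube l N. c k * (of_nat ?Q ^ l * (\<Prod>i=1..l. if k i - a i + b i = 0 then 1 else 0)))"
  proof (intro sum.cong refl)
    fix a b assume ab: "a \<in> cube l N" "b \<in> cube l N"
    have bnd: "\<bar>k i - a i + b i\<bar> < int ?Q" if i: "i \<in> {1..l}" for i
    proof -
      have "a i \<in> {0..<int N}" "b i \<in> {0..<int N}" using ab i by (auto simp: cube_def)
      then show ?thesis using N(2)[OF i] by auto
    qed
    have orth: "(\<Sum>q\<in>grid l ?Q. chr l (\<lambda>i. k i - a i + b i) (gridpt l ?Q q))
        = of_nat ?Q ^ l * (\<Prod>i=1..l. if k i - a i + b i = 0 then 1 else 0)"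
      by (rule grid_orthogonality) (rule bnd)
    have "c (\<lambda>i. a i - b i) = c k" if "\<forall>i\<in>{1..l}. k i - a i + b i = 0"
      using that by (intro cong) (auto simp: algebra_simps)
    moreover have "(\<Prod>i=1..l. if k i - a i + b i = 0 then 1 else 0) = (0::complex)" if "\<not> (\<forall>i\<in>{1..l}. k i - a i + b i = 0)"
      using that by (auto simp: prod_zero_iff)
    ultimately show "c (\<lambda>i. a i - b i) * (\<Sum>q\<in>grid l ?Q. chr l (\<lambda>i. k i - a i + b i) (gridpt l ?Q q))
        = c k * (of_nat ?Q ^ l * (\<Prod>i=1..l. if k i - a i + b i = 0 then 1 else 0))"
      unfolding orth
      by (cases "\<forall>i\<in>{1..l}. k i - a i + b i = 0") (simp_all only: mult_zero_right not_False_eq_True)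
  qed
  also have "\<dots> = c k * (of_nat ?Q ^ l * (\<Sum>a\<in>cube l N. \<Sum>b\<in>cube l N. \<Prod>i=1..l. if k i - a i + b i = 0 then 1 else 0))"
    by (simp only: sum_distrib_left)
  also have "(\<Sum>a\<in>cube l N. \<Sum>b\<in>cube l N. \<Prod>i=1..l. if k i - a i + b i = 0 then 1 else (0::complex))
      = (\<Sum>a\<in>cube l N. \<Prod>i=1..l. \<Sum>b\<in>{0..<int N}. if k i - a i + b = 0 then 1 else 0)"
    unfolding cube_def by (intro sum.cong refl prod_sum_PiE[symmetric]) auto
  also have "\<dots> = (\<Prod>i=1..l. \<Sum>a\<in>{0..<int N}. \<Sum>b\<in>{0..<int N}. if k i - a + b = 0 then 1 else 0)"
    unfolding cube_def
    by (rule prod_sum_PiE[of "{1..l}" "\<lambda>_. {0..<int N}" "\<lambda>i a. \<Sum>b\<in>{0..<int N}. if k i - a + b = 0 then 1 else 0", symmetric]) auto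
  also have "\<dots> = (\<Prod>i=1..l. of_int (int N - \<bar>k i\<bar>))"
    using cube_overlap[OF N(2)] by (intro prod.cong refl) auto
  finally show ?thesis unfolding approx_functional_def
    using N(1) by (simp add: prod_dividef field_simps)
qed

lemma approx_functional_chr_tendsto: "(\<lambda>N. approx_functional N (chr l k)) \<longlonglongrightarrow> c k"
proof -
  have "(\<lambda>N. of_int (int N - \<bar>m\<bar>) / of_nat N :: complex) \<longlonglongrightarrow> 1" for m
  proof -
    have "(\<lambda>N. 1 - of_int \<bar>m\<bar> / of_nat N :: complex) \<longlonglongrightarrow> 1 - 0"
      by (intro tendsto_intros lim_const_over_n)
    then have "(\<lambda>N. 1 - of_int \<bar>m\<bar> / of_nat N :: complex) \<longlonglongrightarrow> 1" by simp
    then show ?thesis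
      by (rule Lim_transform_eventually)
        (use eventually_gt_at_top[of 0] in eventually_elim, simp add: diff_divide_distrib)
  qed
  then have "(\<lambda>N. c k * (\<Prod>i=1..l. of_int (int N - \<bar>k i\<bar>) / of_nat N)) \<longlonglongrightarrow> c k * (\<Prod>i=1..l. 1)"
    by (intro tendsto_mult tendsto_const tendsto_prod)
  then have lim: "(\<lambda>N. c k * (\<Prod>i=1..l. of_int (int N - \<bar>k i\<bar>) / of_nat N)) \<longlonglongrightarrow> c k" by simp
  \<comment> \<open>The sum dominates every \<open>\<bar>k i\<bar>\<close>; one more keeps
    \<open>N\<close> positive even when \<open>k\<close> vanishes.\<close>
  define B where "B = Suc (nat (\<Sum>i=1..l. \<bar>k i\<bar>))"
  have "eventually (\<lambda>N. c k * (\<Prod>i=1..l. of_int (int N - \<bar>k i\<bar>) / of_nat N) = approx_functional N (chr l k)) sequentially"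
    using eventually_ge_at_top[of B]
  proof eventually_elim
    case (elim N)
    have "\<bar>k i\<bar> \<le> int N" if "i \<in> {1..l}" for i
      using member_le_sum[of i "{1..l}" "\<lambda>i. \<bar>k i\<bar>"] that elim by (simp add: B_def)
    then show ?case using elim by (intro approx_functional_chr[symmetric]) (auto simp: B_def)
  qed
  with lim show ?thesis by (rule Lim_transform_eventually)
qed

lemma approx_functional_add:
  "approx_functional N (\<lambda>\<theta>. p \<theta> + q \<theta>) = approx_functional N p + approx_functional N q"
  by (simp add: approx_functional_def distrib_right sum.distrib add_divide_distrib)

lemma approx_functional_cmult: "approx_functional N (\<lambda>\<theta>. d * p \<theta>) = d * approx_functional N p"
  by (simp add: approx_functional_def sum_distrib_left mult.assoc)

lemma functional_tendsto: "p \<in> trig l \<Longrightarrow> (\<lambda>N. approx_functional N p) \<longlonglongrightarrow> functional p"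
proof -
  assume "p \<in> trig l"
  then have "convergent (\<lambda>N. approx_functional N p)"
  proof (induction p rule: trig.induct)
    case (chr k)
    show ?case using approx_functional_chr_tendsto by (rule convergentI)
  next
    case (add p q)
    from convergent_add[OF add.IH] show ?case by (simp only: approx_functional_add)
  next
    case (cmult p d)
    from convergent_mult[OF convergent_const cmult.IH, of d] show ?case by (simp only: approx_functional_cmult)
  qed
  then show ?thesis by (simp add: functional_def convergent_LIMSEQ_iff)
qed

lemma functional_chr: "functional (chr l k) = c k"
  using functional_tendsto[OF trig.chr] approx_functional_chr_tendsto by (rule LIMSEQ_unique)

lemma functional_add:
  assumes "p \<in> trig l" "q \<in> trig l"
  shows "functional (\<lambda>\<theta>. p \<theta> + q \<theta>) = functional p + functional q"
proof (rule LIMSEQ_unique[OF functional_tendsto[OF trig.add[OF assms]]])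
  show "(\<lambda>N. approx_functional N (\<lambda>\<theta>. p \<theta> + q \<theta>)) \<longlonglongrightarrow> functional p + functional q"
    unfolding approx_functional_add by (intro tendsto_add functional_tendsto assms)
qed

lemma functional_cmult:
  assumes "p \<in> trig l"
  shows "functional (\<lambda>\<theta>. d * p \<theta>) = d * functional p"
proof (rule LIMSEQ_unique[OF functional_tendsto[OF trig.cmult[OF assms]]])
  show "(\<lambda>N. approx_functional N (\<lambda>\<theta>. d * p \<theta>)) \<longlonglongrightarrow> d * functional p"
    unfolding approx_functional_cmult by (intro tendsto_mult tendsto_const functional_tendsto assms)
qed

text \<open>Frequencies are total functions, hence a cube in infinitely many coordinates, compact by
  Tychonoff's theorem. Opposite faces are not identified; positivity is tested at grid points, all
  of which lie in the cube.\<close>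

definition torus :: "(nat \<Rightarrow> real) set" where
  "torus = {\<theta>. \<forall>i. \<theta> i \<in> {0..1}}"

lemma compact_torus: "compact torus"
proof -
  have "compactin (product_topology (\<lambda>i::nat. euclidean) UNIV) (PiE UNIV (\<lambda>_. {0..1::real}))"
    by (auto simp: compactin_PiE)
  moreover have "PiE UNIV (\<lambda>_. {0..1::real}) = torus" by (auto simp: torus_def PiE_def Pi_def)
  ultimately show ?thesis by (simp add: euclidean_product_topology)
qed

lemma gridpt_torus: "q \<in> grid l Q \<Longrightarrow> gridpt l Q q \<in> torus"
  unfolding torus_def gridpt_def grid_def by (force simp: divide_le_eq_1 dest: PiE_mem)

lemma functional_nonneg:
  assumes "(\<lambda>\<theta>. complex_of_real (\<phi> \<theta>)) \<in> trig l" "\<And>\<theta>. \<theta> \<in> torus \<Longrightarrow> 0 \<le> \<phi> \<theta>"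
  shows "0 \<le> Re (functional (\<lambda>\<theta>. of_real (\<phi> \<theta>)))"
proof (rule tendsto_lowerbound[OF tendsto_Re[OF functional_tendsto[OF assms(1)]]])
  have "0 \<le> Re (approx_functional N (\<lambda>\<theta>. of_real (\<phi> \<theta>)))" for N
  proof -
    have "of_nat N ^ l * of_nat (2 * N) ^ l = complex_of_real (real N ^ l * real (2 * N) ^ l)" by simp
    then have "Re (approx_functional N (\<lambda>\<theta>. of_real (\<phi> \<theta>)))
      = (\<Sum>q\<in>grid l (2 * N). \<phi> (gridpt l (2 * N) q) * Re (weight N (gridpt l (2 * N) q))) / (real N ^ l * real (2 * N) ^ l)"
      unfolding approx_functional_def by (simp only: Re_divide_of_real Re_sum) simp
    also have "\<dots> \<ge> 0"
      by (intro divide_nonneg_nonneg sum_nonneg mult_nonneg_nonneg assms gridpt_torus weight_nonneg) auto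
    finally show ?thesis .
  qed
  then show "eventually (\<lambda>N. 0 \<le> Re (approx_functional N (\<lambda>\<theta>. of_real (\<phi> \<theta>)))) sequentially" by simp
qed simp

text \<open>Squared moduli of members of \<open>trig l\<close> are real trigonometric polynomials,
  and these form an algebra to which the abstract bounded convergence theorem applies.\<close>

lemma functional_square_tendsto_zero:
  assumes P: "\<And>n. P n \<in> trig l" "\<And>n \<theta>. \<theta> \<in> torus \<Longrightarrow> norm (P n \<theta>) \<le> C"
    and lim: "\<And>\<theta>. \<theta> \<in> torus \<Longrightarrow> (\<lambda>n. P n \<theta>) \<longlonglongrightarrow> 0"
  shows "(\<lambda>n. Re (functional (\<lambda>\<theta>. P n \<theta> * cnj (P n \<theta>)))) \<longlonglongrightarrow> 0"
proof -
  interpret F: positive_functional torus "{\<phi>. (\<lambda>\<theta>. complex_of_real (\<phi> \<theta>)) \<in> trig l}"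
    "\<lambda>\<phi>. Re (functional (\<lambda>\<theta>. of_real (\<phi> \<theta>)))"
  proof
    fix f assume "f \<in> {\<phi>. (\<lambda>\<theta>. complex_of_real (\<phi> \<theta>)) \<in> trig l}"
    then have "continuous_on UNIV (\<lambda>\<theta>. Re (complex_of_real (f \<theta>)))"
      by (intro continuous_on_Re trig_continuous) auto
    then show "continuous_on UNIV f" by simp
  next
    fix f d assume "f \<in> {\<phi>. (\<lambda>\<theta>. complex_of_real (\<phi> \<theta>)) \<in> trig l}"
    then show "Re (functional (\<lambda>\<theta>. of_real (d * f \<theta>))) = d * Re (functional (\<lambda>\<theta>. of_real (f \<theta>)))"
      using functional_cmult[of "\<lambda>\<theta>. of_real (f \<theta>)" "of_real d"] by simp
  qed (auto simp: compact_torus trig_const functional_add intro: trig.add trig_mult functional_nonneg)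
  have sq: "P n \<theta> * cnj (P n \<theta>) = complex_of_real ((norm (P n \<theta>))\<^sup>2)" for n \<theta>
    by (rule complex_norm_square[symmetric])
  have "(\<lambda>n. Re (functional (\<lambda>\<theta>. complex_of_real ((norm (P n \<theta>))\<^sup>2)))) \<longlonglongrightarrow> 0"
  proof (rule F.bounded_convergence)
    show "(\<lambda>\<theta>. (norm (P n \<theta>))\<^sup>2) \<in> {\<phi>. (\<lambda>\<theta>. complex_of_real (\<phi> \<theta>)) \<in> trig l}" for n
      using trig_mult[OF P(1) trig_cnj[OF P(1)], of n n] by (simp add: sq)
    show "(norm (P n \<theta>))\<^sup>2 \<le> C\<^sup>2" if "\<theta> \<in> torus" for n \<theta>
      using P(2)[OF that] by (intro power_mono) auto
    show "(\<lambda>n. (norm (P n \<theta>))\<^sup>2) \<longlonglongrightarrow> 0" if "\<theta> \<in> torus" for \<theta>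
      using tendsto_power[OF tendsto_norm_zero[OF lim[OF that]], of 2] by simp
  qed simp
  then show ?thesis by (simp only: sq)
qed

end

section \<open>Mean convergence\<close>

lemma L2_inner_sum_left:
  assumes "h \<in> L2_space M" "\<And>j. j \<in> J \<Longrightarrow> v j \<in> L2_space M"
  shows "L2_inner M (\<lambda>x. \<Sum>j\<in>J. v j x) h = (\<Sum>j\<in>J. L2_inner M (v j) h)"
  using assms(2)
proof (induction J rule: infinite_finite_induct)
  case (insert j J)
  then have "L2_inner M (\<lambda>x. v j x + (\<Sum>j\<in>J. v j x)) h = L2_inner M (v j) h + L2_inner M (\<lambda>x. \<Sum>j\<in>J. v j x) h"
    by (intro L2_inner_add_left L2_sum assms(1)) auto
  with insert show ?case by simp
qed (simp_all add: L2_inner_def)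

lemma nsq_minus_commute: "nsq M (\<lambda>x. f x - g x) = nsq M (\<lambda>x. g x - f x)"
  by (simp add: nsq_def norm_minus_commute)

lemma nsq_cong: "(\<And>x. x \<in> space M \<Longrightarrow> f x = g x) \<Longrightarrow> nsq M f = nsq M g"
  unfolding nsq_def by (rule Bochner_Integration.integral_cong) auto

lemma L2_space_cong: "(\<And>x. x \<in> space M \<Longrightarrow> f x = g x) \<Longrightarrow> f \<in> L2_space M \<longleftrightarrow> g \<in> L2_space M"
  unfolding L2_space_def
  by (auto cong: measurable_cong Bochner_Integration.integrable_cong)

lemma nsq_eq_0_AE:
  assumes "f \<in> L2_space M" "nsq M f = 0"
  shows "AE x in M. f x = 0"
  using assms integral_nonneg_eq_0_iff_AE[OF L2_integrable[OF assms(1)]] by (simp add: nsq_def)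

context commuting_system
begin

text \<open>The quadratic form is the squared norm of the combination of translates of
  \<open>f\<close> with coefficients \<open>a j\<close>.\<close>

lemma corr_positive_definite:
  assumes f: "f \<in> L2_space M"
  shows "positive_definite l (corr f)"
proof
  show "corr f j = corr f k" if "\<And>i. i \<in> {1..l} \<Longrightarrow> j i = k i" for j k
    using that by (rule corr_cong)
  fix J :: "(nat \<Rightarrow> int) set" and a assume J: "finite J"
  define v where "v j x = a j * f (translate j x)" for j x
  have v: "v j \<in> L2_space M" for j unfolding v_def by (intro L2_cmult translate_L2 f)
  have "complex_of_real (nsq M (\<lambda>x. \<Sum>j\<in>J. v j x)) = L2_inner M (\<lambda>x. \<Sum>j\<in>J. v j x) (\<lambda>x. \<Sum>j\<in>J. v j x)"
    by (simp add: L2_inner_self)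
  also have "\<dots> = (\<Sum>j\<in>J. L2_inner M (v j) (\<lambda>x. \<Sum>j\<in>J. v j x))"
    by (intro L2_inner_sum_left L2_sum v)
  also have "\<dots> = (\<Sum>j\<in>J. \<Sum>k\<in>J. L2_inner M (v j) (v k))"
  proof (rule sum.cong[OF refl])
    fix j
    have "L2_inner M (v j) (\<lambda>x. \<Sum>j\<in>J. v j x) = cnj (L2_inner M (\<lambda>x. \<Sum>j\<in>J. v j x) (v j))"
      by (rule L2_inner_commute)
    also have "\<dots> = (\<Sum>k\<in>J. cnj (L2_inner M (v k) (v j)))"
      using L2_inner_sum_left[of "v j" M J v, OF v v] by simp
    also have "\<dots> = (\<Sum>k\<in>J. L2_inner M (v j) (v k))"
      by (simp only: L2_inner_commute[symmetric])
    finally show "L2_inner M (v j) (\<lambda>x. \<Sum>j\<in>J. v j x) = (\<Sum>k\<in>J. L2_inner M (v j) (v k))" .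
  qed
  also have "\<dots> = (\<Sum>j\<in>J. \<Sum>k\<in>J. a j * cnj (a k) * corr f (\<lambda>i. j i - k i))"
    unfolding v_def L2_inner_cmult_left L2_inner_cmult_right inner_translate[OF f] by (simp only: mult_ac)
  finally have "Re (\<Sum>j\<in>J. \<Sum>k\<in>J. a j * cnj (a k) * corr f (\<lambda>i. j i - k i)) = nsq M (\<lambda>x. \<Sum>j\<in>J. v j x)"
    by (metis Re_complex_of_real)
  then show "0 \<le> Re (\<Sum>j\<in>J. \<Sum>k\<in>J. a j * cnj (a k) * corr f (\<lambda>i. j i - k i))"
    by (simp add: nsq_nonneg)
qed

text \<open>Pairs of a trigonometric polynomial and the vector it yields when the characters are replaced by the
  translates of \<open>f\<close>.\<close>

inductive_set rep :: "('a \<Rightarrow> complex) \<Rightarrow> (((nat \<Rightarrow> real) \<Rightarrow> complex) \<times> ('a \<Rightarrow> complex)) set" for f where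
  base: "(chr l k, \<lambda>x. f (translate k x)) \<in> rep f"
| add: "(p, v) \<in> rep f \<Longrightarrow> (q, w) \<in> rep f \<Longrightarrow> (\<lambda>\<theta>. p \<theta> + q \<theta>, \<lambda>x. v x + w x) \<in> rep f"
| cmult: "(p, v) \<in> rep f \<Longrightarrow> (\<lambda>\<theta>. c * p \<theta>, \<lambda>x. c * v x) \<in> rep f"
| space_cong: "(p, v) \<in> rep f \<Longrightarrow> (\<And>x. x \<in> space M \<Longrightarrow> v x = w x) \<Longrightarrow> (p, w) \<in> rep f"

lemma rep_trig: "(p, v) \<in> rep f \<Longrightarrow> p \<in> trig l"
  by (induction rule: rep.induct) (auto intro: trig.intros)

lemma rep_L2:
  assumes "f \<in> L2_space M"
  shows "(p, v) \<in> rep f \<Longrightarrow> v \<in> L2_space M"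
proof (induction rule: rep.induct)
  case (space_cong p v w)
  then show ?case using L2_space_cong[of M v w] by blast
qed (auto intro: L2_add L2_cmult translate_L2 assms)

lemma rep_zero: "(\<lambda>_. 0, \<lambda>_. 0) \<in> rep f"
  using rep.cmult[OF rep.base, of 0] by simp

lemma rep_sum:
  "(\<And>i. i \<in> I \<Longrightarrow> (p i, v i) \<in> rep f) \<Longrightarrow> (\<lambda>\<theta>. \<Sum>i\<in>I. p i \<theta>, \<lambda>x. \<Sum>i\<in>I. v i x) \<in> rep f"
proof (induction I rule: infinite_finite_induct)
  case (insert i I)
  then have "(\<lambda>\<theta>. p i \<theta> + (\<Sum>i\<in>I. p i \<theta>), \<lambda>x. v i x + (\<Sum>i\<in>I. v i x)) \<in> rep f"
    by (intro rep.add) auto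
  with insert show ?case by simp
qed (simp_all add: rep_zero)

text \<open>As \<open>translate\<close> is shown to be additive on \<open>space M\<close> only, the
  vectors agree merely there; the rule \<open>space_cong\<close> of \<open>rep\<close> absorbs
  this.\<close>

lemma rep_translate:
  "(p, v) \<in> rep f \<Longrightarrow> (\<lambda>\<theta>. chr l k \<theta> * p \<theta>, \<lambda>x. v (translate k x)) \<in> rep f"
proof (induction rule: rep.induct)
  case (base j)
  show ?case unfolding chr_mult
  proof (rule rep.space_cong[OF rep.base])
    fix x assume "x \<in> space M"
    then have "translate (\<lambda>i. k i + j i) x = translate j (translate k x)"
      using translate_add[of x j k] by (simp add: add.commute)
    then show "f (translate (\<lambda>i. k i + j i) x) = f (translate j (translate k x))" by simp
  qed
next
  case (add p v q w)
  from rep.add[OF add.IH] show ?case by (simp only: distrib_left)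
next
  case (cmult p v c)
  from rep.cmult[OF cmult.IH, of c] show ?case by (simp only: mult.left_commute)
next
  case (space_cong p v w)
  show ?case by (rule rep.space_cong[OF space_cong.IH]) (simp add: space_cong.hyps translate_space)
qed

text \<open>The spectral isometry. Both sides are sesquilinear, so it suffices to compare characters
  with translates, where \<open>functional\<close> returns a correlation. First \<open>p\<close> is
  a character and \<open>q\<close> varies, then \<open>p\<close> varies.\<close>

lemma rep_inner:
  assumes f: "f \<in> L2_space M" and pv: "(p, v) \<in> rep f" and qw: "(q, w) \<in> rep f"
  shows "positive_definite.functional l (corr f) (\<lambda>\<theta>. p \<theta> * cnj (q \<theta>)) = L2_inner M v w"
proof -
  interpret P: positive_definite l "corr f" by (rule corr_positive_definite[OF f])
  have inner_cong: "L2_inner M v w = L2_inner M v' w'"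
    if "\<And>x. x \<in> space M \<Longrightarrow> v x = v' x" "\<And>x. x \<in> space M \<Longrightarrow> w x = w' x" for v v' w w'
    unfolding L2_inner_def using that by (intro Bochner_Integration.integral_cong) auto
  have *: "P.functional (\<lambda>\<theta>. chr l j \<theta> * cnj (q \<theta>)) = L2_inner M (\<lambda>x. f (translate j x)) w" for j
    using qw
  proof (induction rule: rep.induct)
    case (base k)
    show ?case unfolding inner_translate[OF f] by (simp add: cnj_chr chr_mult P.functional_chr)
  next
    case (add q w q' w')
    have "P.functional (\<lambda>\<theta>. chr l j \<theta> * cnj (q \<theta>) + chr l j \<theta> * cnj (q' \<theta>))
       = P.functional (\<lambda>\<theta>. chr l j \<theta> * cnj (q \<theta>)) + P.functional (\<lambda>\<theta>. chr l j \<theta> * cnj (q' \<theta>))"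
      by (intro P.functional_add trig_mult trig.chr trig_cnj rep_trig[OF add.hyps(1)] rep_trig[OF add.hyps(2)])
    also have "\<dots> = L2_inner M (\<lambda>x. f (translate j x)) (\<lambda>x. w x + w' x)"
      unfolding add.IH
      by (rule L2_inner_add_right[symmetric, OF rep_L2[OF f add.hyps(1)] rep_L2[OF f add.hyps(2)] translate_L2[OF f]])
    finally show ?case by (simp only: complex_cnj_add distrib_left)
  next
    case (cmult q w c)
    have "P.functional (\<lambda>\<theta>. cnj c * (chr l j \<theta> * cnj (q \<theta>))) = cnj c * P.functional (\<lambda>\<theta>. chr l j \<theta> * cnj (q \<theta>))"
      by (intro P.functional_cmult trig_mult trig.chr trig_cnj rep_trig[OF cmult.hyps])
    then show ?case unfolding L2_inner_cmult_right cmult.IH by (simp only: complex_cnj_mult mult.left_commute)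
  next
    case (space_cong q w w')
    then show ?case using inner_cong[of "\<lambda>x. f (translate j x)" _ w w'] by simp
  qed
  have qt: "(\<lambda>\<theta>. cnj (q \<theta>)) \<in> trig l" by (rule trig_cnj[OF rep_trig[OF qw]])
  have wL2: "w \<in> L2_space M" by (rule rep_L2[OF f qw])
  show ?thesis using pv
  proof (induction rule: rep.induct)
    case (base k)
    show ?case by (rule *)
  next
    case (add p v p' v')
    have "P.functional (\<lambda>\<theta>. p \<theta> * cnj (q \<theta>) + p' \<theta> * cnj (q \<theta>))
       = P.functional (\<lambda>\<theta>. p \<theta> * cnj (q \<theta>)) + P.functional (\<lambda>\<theta>. p' \<theta> * cnj (q \<theta>))"
      by (intro P.functional_add trig_mult qt rep_trig[OF add.hyps(1)] rep_trig[OF add.hyps(2)])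
    also have "\<dots> = L2_inner M (\<lambda>x. v x + v' x) w"
      unfolding add.IH
      by (rule L2_inner_add_left[symmetric, OF rep_L2[OF f add.hyps(1)] rep_L2[OF f add.hyps(2)] wL2])
    finally show ?case by (simp only: distrib_right)
  next
    case (cmult p v c)
    have "P.functional (\<lambda>\<theta>. c * (p \<theta> * cnj (q \<theta>))) = c * P.functional (\<lambda>\<theta>. p \<theta> * cnj (q \<theta>))"
      by (intro P.functional_cmult trig_mult qt rep_trig[OF cmult.hyps])
    then show ?case unfolding L2_inner_cmult_left cmult.IH by (simp only: mult.assoc)
  next
    case (space_cong p v v')
    then show ?case using inner_cong[of v v' w w] by simp
  qed
qed

text \<open>Midpoints stand in for general convex combinations: they are all that the parallelogram
  law asks for, and every property then passes through a single rule.\<close>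

inductive_set midpoint_hull :: "('a \<Rightarrow> complex) \<Rightarrow> (((nat \<Rightarrow> real) \<Rightarrow> complex) \<times> ('a \<Rightarrow> complex)) set" for f where
  base: "(chr l k, \<lambda>x. f (translate k x)) \<in> midpoint_hull f"
| mid: "(p, v) \<in> midpoint_hull f \<Longrightarrow> (q, w) \<in> midpoint_hull f \<Longrightarrow> (\<lambda>\<theta>. 1/2 * (p \<theta> + q \<theta>), \<lambda>x. 1/2 * (v x + w x)) \<in> midpoint_hull f"

lemma hull_rep: "(p, v) \<in> midpoint_hull f \<Longrightarrow> (p, v) \<in> rep f"
  by (induction rule: midpoint_hull.induct) (rule rep.base, rule rep.cmult[OF rep.add])

lemma hull_L2: "f \<in> L2_space M \<Longrightarrow> (p, v) \<in> midpoint_hull f \<Longrightarrow> v \<in> L2_space M"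
  by (rule rep_L2[OF _ hull_rep])

lemma hull_norm: "(p, v) \<in> midpoint_hull f \<Longrightarrow> norm (p \<theta>) \<le> 1"
proof (induction rule: midpoint_hull.induct)
  case (mid p v q w)
  have "norm (p \<theta> + q \<theta>) \<le> 1 + 1" by (intro norm_triangle_mono mid.IH)
  then show ?case by (simp add: norm_mult)
qed simp

lemma hull_integer:
  assumes "(p, v) \<in> midpoint_hull f" "\<forall>i\<in>{1..l}. \<theta> i \<in> \<int>"
  shows "p \<theta> = 1"
  using assms(1)
proof (induction rule: midpoint_hull.induct)
  case (base k)
  have "(\<Sum>i=1..l. \<theta> i * of_int (k i)) \<in> \<int>" using assms(2) by (intro Ints_sum Ints_mult) auto
  then obtain m where "(\<Sum>i=1..l. \<theta> i * of_int (k i)) = of_int m" by (auto elim: Ints_cases)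
  then show ?case by (simp add: chr_def e1_of_int)
qed simp

lemma hull_translate:
  assumes i: "i \<in> {1..l}"
  shows "(p, v) \<in> midpoint_hull f \<Longrightarrow> \<exists>q w. (q, w) \<in> midpoint_hull f \<and> (\<forall>x\<in>space M. w x = v (T i x))"
proof (induction rule: midpoint_hull.induct)
  case (base k)
  have "translate (\<lambda>j. k j + (if j = i then 1 else 0)) x = translate k (T i x)" if "x \<in> space M" for x
    using translate_add[OF that, of k "\<lambda>j. if j = i then 1 else 0"] translate_single[OF i that] by simp
  then show ?case using midpoint_hull.base[of "\<lambda>j. k j + (if j = i then 1 else 0)" f] by fastforce
next
  case (mid p v q w)
  then obtain p' v' q' w' where "(p', v') \<in> midpoint_hull f" "\<forall>x\<in>space M. v' x = v (T i x)"
    "(q', w') \<in> midpoint_hull f" "\<forall>x\<in>space M. w' x = w (T i x)" by blast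
  with midpoint_hull.mid[of p' v' f q' w'] show ?case by fastforce
qed

lemma hull_inner_V:
  assumes f: "f \<in> L2_space M" and h: "h \<in> V"
  shows "(p, v) \<in> midpoint_hull f \<Longrightarrow> L2_inner M v h = L2_inner M f h"
proof (induction rule: midpoint_hull.induct)
  case (base k)
  show ?case by (rule inner_translate_V[OF f h])
next
  case (mid p v q w)
  then show ?case unfolding L2_inner_cmult_left
    by (subst L2_inner_add_left[OF hull_L2[OF f mid.hyps(1)] hull_L2[OF f mid.hyps(2)] V_L2[OF h]]) simp
qed

text \<open>The element of minimal norm in the closed convex hull of the orbit of \<open>f\<close> is invariant, by uniqueness, and it is
  the projection of \<open>f\<close>.\<close>

lemma mean_ergodic:
  assumes f: "f \<in> L2_space M"
  shows "\<exists>u\<in>V. (\<forall>h\<in>V. L2_inner M (\<lambda>x. f x - u x) h = 0) \<and>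
    (\<forall>e>0. \<exists>p v. (p, v) \<in> midpoint_hull f \<and> nsq M (\<lambda>x. v x - u x) < e)"
proof -
  define H where "H = snd ` midpoint_hull f"
  define d where "d = (INF v\<in>H. nsq M v)"
  have H: "v \<in> L2_space M" if "v \<in> H" for v using that hull_L2[OF f] by (auto simp: H_def)
  have ne: "H \<noteq> {}" using midpoint_hull.base by (force simp: H_def)
  have bdd: "bdd_below (nsq M ` H)" by (rule bdd_belowI2[of _ 0]) (rule nsq_nonneg)
  have mid: "(\<lambda>x. 1/2 * (v x + w x)) \<in> H" if "v \<in> H" "w \<in> H" for v w
    using that midpoint_hull.mid by (force simp: H_def)
  have d_le: "d \<le> nsq M v" if "v \<in> H" for v unfolding d_def by (rule cINF_lower[OF bdd that])
  have close: "nsq M (\<lambda>x. v x - w x) \<le> 2 * nsq M v + 2 * nsq M w - 4 * d" if "v \<in> H" "w \<in> H" for v w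
    using d_le[OF mid[OF that]] nsq_parallelogram[OF H H, OF that] by simp
  have "\<exists>v\<in>H. nsq M v < d + 1 / real (Suc n)" for n
  proof -
    have "d < d + 1 / real (Suc n)" by simp
    then show ?thesis unfolding d_def by (subst (asm) cINF_less_iff[OF ne bdd])
  qed
  then obtain v where v: "\<And>n. v n \<in> H" "\<And>n. nsq M (v n) < d + 1 / real (Suc n)" by metis
  have "\<exists>N. \<forall>n\<ge>N. \<forall>m\<ge>n. nsq M (\<lambda>x. v n x - v m x) \<le> e" if "e > 0" for e
  proof -
    obtain N where N: "4 / e < real N" using reals_Archimedean2 by blast
    have "nsq M (\<lambda>x. v n x - v m x) \<le> e" if "n \<ge> N" "m \<ge> n" for n m
    proof -
      have "1 / real (Suc m) \<le> 1 / real (Suc n)" using that by (simp add: frac_le)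
      moreover have "4 * (1 / real (Suc n)) \<le> e"
      proof -
        have "4 / e \<le> real (Suc n)" using N that by simp
        then show ?thesis using \<open>e > 0\<close> by (simp add: field_simps)
      qed
      ultimately show ?thesis using close[OF v(1) v(1), of n m] v(2)[of n] v(2)[of m] by linarith
    qed
    then show ?thesis by blast
  qed
  with L2_complete[of v] H v(1) obtain u where u: "u \<in> L2_space M" and
    lim: "(\<lambda>n. nsq M (\<lambda>x. v n x - u x)) \<longlonglongrightarrow> 0" by blast
  have "AE x in M. u (T i x) = u x" if i: "i \<in> {1..l}" for i
  proof -
    have mp: "mpres M (T i)" by (rule invertible_mpt_mpres[OF inv_T[OF i]])
    have uT: "(\<lambda>x. u (T i x)) \<in> L2_space M" by (rule mpres_L2[OF mp u])
    \<comment> \<open>The composition of \<open>v n\<close> with \<open>T i\<close> is again a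
      near-minimiser and so close to \<open>v n\<close>, while its distance from \<open>u\<close>
      composed with \<open>T i\<close> is that of \<open>v n\<close> from \<open>u\<close>. Applying
      \<open>nsq_add_le\<close> twice to the three differences gives the constants 2, 4 and
      16.\<close>
    have est: "nsq M (\<lambda>x. u (T i x) - u x) \<le> 2 * nsq M (\<lambda>x. v n x - u x)
        + (4 * nsq M (\<lambda>x. v n x - u x) + 16 * (1 / real (Suc n)))" for n
    proof -
      have vT: "(\<lambda>x. v n (T i x)) \<in> L2_space M" by (rule mpres_L2[OF mp H[OF v(1)]])
      obtain p where "(p, v n) \<in> midpoint_hull f" using v(1)[of n] by (auto simp: H_def)
      from hull_translate[OF i this] obtain w where w: "w \<in> H" "\<And>x. x \<in> space M \<Longrightarrow> w x = v n (T i x)"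
        by (force simp: H_def)
      have "nsq M w = nsq M (v n)" using nsq_cong[of M w "\<lambda>x. v n (T i x)", OF w(2)] mpres_nsq[OF mp H[OF v(1)], of n] by simp
      then have "nsq M (\<lambda>x. w x - v n x) \<le> 4 * (1 / real (Suc n))"
        using close[OF w(1) v(1), of n] v(2)[of n] by linarith
      moreover have "nsq M (\<lambda>x. w x - v n x) = nsq M (\<lambda>x. v n (T i x) - v n x)"
        by (rule nsq_cong) (simp add: w)
      ultimately have 1: "nsq M (\<lambda>x. v n (T i x) - v n x) \<le> 4 * (1 / real (Suc n))" by simp
      have 2: "nsq M (\<lambda>x. u (T i x) - v n (T i x)) = nsq M (\<lambda>x. v n x - u x)"
        using mpres_nsq[OF mp L2_diff[OF u H[OF v(1)]], of n] by (simp add: nsq_minus_commute)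
      have "nsq M (\<lambda>x. u (T i x) - u x) = nsq M (\<lambda>x. (v n x - u x) + ((u (T i x) - v n (T i x)) + (v n (T i x) - v n x)))"
        by (simp add: algebra_simps)
      also have "\<dots> \<le> 2 * nsq M (\<lambda>x. v n x - u x) + 2 * nsq M (\<lambda>x. (u (T i x) - v n (T i x)) + (v n (T i x) - v n x))"
        by (intro nsq_add_le L2_add L2_diff u uT vT H[OF v(1)])
      also have "nsq M (\<lambda>x. (u (T i x) - v n (T i x)) + (v n (T i x) - v n x))
          \<le> 2 * nsq M (\<lambda>x. u (T i x) - v n (T i x)) + 2 * nsq M (\<lambda>x. v n (T i x) - v n x)"
        by (intro nsq_add_le L2_add L2_diff u uT vT H[OF v(1)])
      finally show ?thesis using 1 2 by simp
    qed
    have "(\<lambda>n. 2 * nsq M (\<lambda>x. v n x - u x) + (4 * nsq M (\<lambda>x. v n x - u x) + 16 * (1 / real (Suc n)))) \<longlonglongrightarrow> 2 * 0 + (4 * 0 + 16 * 0)"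
      by (intro tendsto_intros lim LIMSEQ_Suc[OF lim_const_over_n])
    then have "nsq M (\<lambda>x. u (T i x) - u x) \<le> 2 * 0 + (4 * 0 + 16 * 0)"
      by (rule tendsto_lowerbound) (intro always_eventually allI est, simp)
    then have "nsq M (\<lambda>x. u (T i x) - u x) = 0" using nsq_nonneg[of M "\<lambda>x. u (T i x) - u x"] by simp
    from nsq_eq_0_AE[OF L2_diff[OF uT u] this] show ?thesis by simp
  qed
  then have uV: "u \<in> V" using u by (simp add: invariant_L2_def)
  moreover have "L2_inner M (\<lambda>x. f x - u x) h = 0" if h: "h \<in> V" for h
  proof -
    have est: "(norm (L2_inner M (\<lambda>x. f x - u x) h))\<^sup>2 \<le> nsq M (\<lambda>x. v n x - u x) * nsq M h" for n
    proof -
      obtain p where p: "(p, v n) \<in> midpoint_hull f" using v(1)[of n] by (auto simp: H_def)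
      have "L2_inner M (\<lambda>x. f x - u x) h = L2_inner M (\<lambda>x. v n x - u x) h"
        using hull_inner_V[OF f h p] L2_inner_diff_left[OF f u V_L2[OF h]]
          L2_inner_diff_left[OF H[OF v(1)] u V_L2[OF h]] by simp
      then show ?thesis using L2_Cauchy_Schwarz[OF L2_diff[OF H[OF v(1)] u] V_L2[OF h]] by simp
    qed
    have "(\<lambda>n. nsq M (\<lambda>x. v n x - u x) * nsq M h) \<longlonglongrightarrow> 0 * nsq M h"
      by (intro tendsto_intros lim)
    then have "(norm (L2_inner M (\<lambda>x. f x - u x) h))\<^sup>2 \<le> 0 * nsq M h"
      by (rule tendsto_lowerbound) (intro always_eventually allI est, simp)
    then show ?thesis by simp
  qed
  moreover have "\<exists>p w. (p, w) \<in> midpoint_hull f \<and> nsq M (\<lambda>x. w x - u x) < e" if "e > 0" for e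
  proof -
    have "eventually (\<lambda>n. nsq M (\<lambda>x. v n x - u x) < e) sequentially" using lim that by (rule order_tendstoD)
    then obtain n where "nsq M (\<lambda>x. v n x - u x) < e" by (auto simp: eventually_sequentially)
    moreover obtain p where "(p, v n) \<in> midpoint_hull f" using v(1)[of n] by (auto simp: H_def)
    ultimately show ?thesis by blast
  qed
  ultimately show ?thesis by blast
qed

text \<open>The invariant \<open>u\<close> of \<open>mean_ergodic\<close> is orthogonal to
  \<open>f\<close> and to \<open>f - u\<close>, hence to itself, so it vanishes almost everywhere.
  The resulting \<open>p\<close> is the polynomial that neutralises the integer frequencies.\<close>

lemma hull_small:
  assumes f: "f \<in> L2_space M" and orth: "\<And>h. h \<in> V \<Longrightarrow> L2_inner M f h = 0" and e: "e > 0"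
  shows "\<exists>p v. (p, v) \<in> midpoint_hull f \<and> nsq M v < e"
proof -
  obtain u where u: "u \<in> V" "\<And>h. h \<in> V \<Longrightarrow> L2_inner M (\<lambda>x. f x - u x) h = 0"
    and small: "\<And>e. e > 0 \<Longrightarrow> \<exists>p v. (p, v) \<in> midpoint_hull f \<and> nsq M (\<lambda>x. v x - u x) < e"
    using mean_ergodic[OF f] by blast
  have "L2_inner M u u = 0"
    using u(2)[OF u(1)] L2_inner_diff_left[OF f V_L2[OF u(1)] V_L2[OF u(1)]] orth[OF u(1)] by simp
  then have u0: "nsq M u = 0" by (simp add: L2_inner_self)
  obtain p v where pv: "(p, v) \<in> midpoint_hull f" "nsq M (\<lambda>x. v x - u x) < e / 2" using small[of "e/2"] e by auto
  have "nsq M (\<lambda>x. (v x - u x) + u x) \<le> 2 * nsq M (\<lambda>x. v x - u x) + 2 * nsq M u"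
    by (intro nsq_add_le L2_diff V_L2[OF u(1)] hull_L2[OF f pv(1)])
  then have "nsq M v < e" using pv(2) u0 by simp
  with pv(1) show ?thesis by blast
qed

section \<open>Convergence of the averages\<close>

lemma L2_proj_properties:
  assumes "f \<in> L2_space M"
  shows "L2_proj M V f \<in> V" "\<And>h. h \<in> V \<Longrightarrow> L2_inner M (\<lambda>x. f x - L2_proj M V f x) h = 0"
proof -
  have "\<exists>p. p \<in> V \<and> (\<forall>h\<in>V. L2_inner M (\<lambda>x. f x - p x) h = 0)" using mean_ergodic[OF assms] by blast
  from someI_ex[OF this]
  show "L2_proj M V f \<in> V" "\<And>h. h \<in> V \<Longrightarrow> L2_inner M (\<lambda>x. f x - L2_proj M V f x) h = 0"
    unfolding L2_proj_def by blast+
qed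

text \<open>Convexity of the squared modulus at each point, then measure preservation for each
  translate.\<close>

lemma nsq_average_le:
  assumes v: "v \<in> L2_space M"
  shows "nsq M (\<lambda>x. 1 / of_nat N * (\<Sum>n=1..N. v (translate (k n) x))) \<le> nsq M v"
proof (cases "N = 0")
  case True
  then show ?thesis using nsq_nonneg[of M v] by (simp add: nsq_def)
next
  case False
  have int: "integrable M (\<lambda>x. (norm (v (translate j x)))\<^sup>2)" for j
    using L2_integrable[OF translate_L2[OF v, of j]] .
  have "nsq M (\<lambda>x. 1 / of_nat N * (\<Sum>n=1..N. v (translate (k n) x)))
      \<le> (\<integral>x. 1 / real N * (\<Sum>n=1..N. (norm (v (translate (k n) x)))\<^sup>2) \<partial>M)"
    unfolding nsq_def
  proof (rule integral_mono)
    show "integrable M (\<lambda>x. (norm (1 / of_nat N * (\<Sum>n=1..N. v (translate (k n) x))))\<^sup>2)"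
      by (intro L2_integrable L2_cmult L2_sum translate_L2 v)
    show "integrable M (\<lambda>x. 1 / real N * (\<Sum>n=1..N. (norm (v (translate (k n) x)))\<^sup>2))"
      by (intro integrable_mult_right Bochner_Integration.integrable_sum int)
    fix x
    have "(norm (1 / of_nat N * (\<Sum>n=1..N. v (translate (k n) x))))\<^sup>2
        = (1 / real N)\<^sup>2 * (norm (\<Sum>n=1..N. v (translate (k n) x)))\<^sup>2"
      by (simp add: norm_mult norm_divide power_mult_distrib power_divide)
    also have "\<dots> \<le> (1 / real N)\<^sup>2 * (real (card {1..N}) * (\<Sum>n=1..N. (norm (v (translate (k n) x)))\<^sup>2))"
      by (intro mult_left_mono norm_sum_square_le) auto
    also have "\<dots> = 1 / real N * (\<Sum>n=1..N. (norm (v (translate (k n) x)))\<^sup>2)"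
      using False by (simp add: power2_eq_square)
    finally show "(norm (1 / of_nat N * (\<Sum>n=1..N. v (translate (k n) x))))\<^sup>2
        \<le> 1 / real N * (\<Sum>n=1..N. (norm (v (translate (k n) x)))\<^sup>2)" .
  qed
  also have "\<dots> = 1 / real N * (\<Sum>n=1..N. nsq M (\<lambda>x. v (translate (k n) x)))"
    unfolding nsq_def using int
    by (simp add: Bochner_Integration.integral_sum del: times_divide_eq_left)
  also have "\<dots> = nsq M v" using False mpres_nsq[OF translate_mpres v] by simp
  finally show ?thesis .
qed

lemma averages_tendsto_zero:
  fixes k :: "nat \<Rightarrow> nat \<Rightarrow> int"
  assumes f: "f \<in> L2_space M" and orth: "\<And>h. h \<in> V \<Longrightarrow> L2_inner M f h = 0"
    and k: "\<And>\<theta>. \<exists>i\<in>{1..l}. \<theta> i \<notin> \<int> \<Longrightarrow> has_mean (\<lambda>n. chr l (k n) \<theta>) 0"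
  shows "(\<lambda>N. nsq M (\<lambda>x. 1 / of_nat N * (\<Sum>n=1..N. f (translate (k n) x)))) \<longlonglongrightarrow> 0"
proof (rule LIMSEQ_I)
  fix e :: real assume e: "e > 0"
  interpret P: positive_definite l "corr f" by (rule corr_positive_definite[OF f])
  \<comment> \<open>In \<open>af = w + av\<close> each part counts twice in the squared norm, so
    each gets a quarter of \<open>e\<close>.\<close>
  obtain q v where qv: "(q, v) \<in> midpoint_hull f" "nsq M v < e / 4" using hull_small[OF f orth, of "e/4"] e by auto
  have vL2: "v \<in> L2_space M" by (rule hull_L2[OF f qv(1)])
  define A where "A N \<theta> = 1 / of_nat N * (\<Sum>n=1..N. chr l (k n) \<theta>)" for N \<theta>
  define af where "af N x = 1 / of_nat N * (\<Sum>n=1..N. f (translate (k n) x))" for N x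
  define av where "av N x = 1 / of_nat N * (\<Sum>n=1..N. v (translate (k n) x))" for N x
  have repf: "(A N, af N) \<in> rep f" for N
    unfolding A_def[abs_def] af_def[abs_def] by (intro rep.cmult rep_sum rep.base)
  have "(\<lambda>\<theta>. 1 / of_nat N * (\<Sum>n=1..N. chr l (k n) \<theta> * q \<theta>), av N) \<in> rep f" for N
    unfolding av_def[abs_def] by (intro rep.cmult rep_sum rep_translate hull_rep qv(1))
  then have repv: "(\<lambda>\<theta>. A N \<theta> * q \<theta>, av N) \<in> rep f" for N
    by (simp add: A_def sum_distrib_right mult.assoc)
  \<comment> \<open>The product of \<open>A N\<close> and \<open>1 - q\<close>, spelled out in the
    shape of the rules of \<open>rep\<close>.\<close>
  define B where "B N \<theta> = A N \<theta> + (-1) * (A N \<theta> * q \<theta>)" for N \<theta>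
  define w where "w N x = af N x + (-1) * av N x" for N x
  have repB: "(B N, w N) \<in> rep f" for N
    unfolding B_def[abs_def] w_def[abs_def] by (intro rep.add rep.cmult repf repv)
  have normA: "norm (A N \<theta>) \<le> 1" for N \<theta>
  proof -
    have "norm (\<Sum>n=1..N. chr l (k n) \<theta>) \<le> (\<Sum>n=1..N. 1)" by (rule sum_norm_le) simp
    then show ?thesis by (cases "N = 0") (auto simp: A_def norm_mult norm_divide divide_le_eq_1)
  qed
  have "(\<lambda>N. Re (P.functional (\<lambda>\<theta>. B N \<theta> * cnj (B N \<theta>)))) \<longlonglongrightarrow> 0"
  proof (rule P.functional_square_tendsto_zero)
    show "B N \<in> trig l" for N by (rule rep_trig[OF repB])
    show "norm (B N \<theta>) \<le> 2" for N \<theta>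
    proof -
      have "norm (A N \<theta> * q \<theta>) \<le> 1"
        using normA[of N \<theta>] hull_norm[OF qv(1), of \<theta>] by (simp add: norm_mult mult_le_one)
      then show ?thesis using normA[of N \<theta>] norm_triangle_ineq4[of "A N \<theta>" "A N \<theta> * q \<theta>"] by (simp add: B_def)
    qed
    show "(\<lambda>N. B N \<theta>) \<longlonglongrightarrow> 0" for \<theta>
    proof (cases "\<exists>i\<in>{1..l}. \<theta> i \<notin> \<int>")
      case True
      from k[OF True] have "(\<lambda>N. A N \<theta>) \<longlonglongrightarrow> 0" by (simp add: has_mean_def A_def)
      then have "(\<lambda>N. A N \<theta> + (-1) * (A N \<theta> * q \<theta>)) \<longlonglongrightarrow> 0 + (-1) * (0 * q \<theta>)"
        by (intro tendsto_add tendsto_mult tendsto_const)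
      then show ?thesis by (simp add: B_def)
    next
      case False
      then have "q \<theta> = 1" by (intro hull_integer[OF qv(1)]) auto
      then show ?thesis by (simp add: B_def)
    qed
  qed
  then have "(\<lambda>N. nsq M (w N)) \<longlonglongrightarrow> 0"
    unfolding rep_inner[OF f repB repB] L2_inner_self by simp
  then have "eventually (\<lambda>N. nsq M (w N) < e / 4) sequentially"
    using e by (intro order_tendstoD) auto
  then obtain N0 where N0: "\<And>N. N \<ge> N0 \<Longrightarrow> nsq M (w N) < e / 4" by (auto simp: eventually_sequentially)
  have "norm (nsq M (af N) - 0) < e" if "N \<ge> N0" for N
  proof -
    have "nsq M (\<lambda>x. w N x + av N x) \<le> 2 * nsq M (w N) + 2 * nsq M (av N)"
      by (intro nsq_add_le rep_L2[OF f repB] rep_L2[OF f repv])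
    moreover have "nsq M (av N) \<le> nsq M v" unfolding av_def[abs_def] by (rule nsq_average_le[OF vL2])
    moreover have "(\<lambda>x. w N x + av N x) = af N" by (simp add: w_def fun_eq_iff)
    ultimately show ?thesis using N0[OF that] qv(2) nsq_nonneg[of M "af N"] by simp
  qed
  then show "\<exists>N0. \<forall>N\<ge>N0. norm (nsq M (\<lambda>x. 1 / of_nat N * (\<Sum>n=1..N. f (translate (k n) x))) - 0) < e"
    unfolding af_def[abs_def] by blast
qed

end

theorem theorem2p1:
  fixes l :: nat
    and M :: "'a measure"
    and T :: "nat \<Rightarrow> 'a \<Rightarrow> 'a"
    and f :: "'a \<Rightarrow> complex"
    and g :: "nat \<Rightarrow> real \<Rightarrow> real"
  assumes "l \<ge> 1"
    and "mp_system M l T"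
    and "f \<in> L2_space M"
    and "\<And>i. i \<in> {1..l} \<Longrightarrow> g i \<in> class_T"
    and "\<And>i. i \<in> {1..<l} \<Longrightarrow> grows_slower (g (Suc i)) (g i)"
    and "\<And>c :: nat \<Rightarrow> real. \<exists>i\<in>{1..l}. c i \<noteq> 0 \<Longrightarrow> (\<lambda>x. \<Sum>i=1..l. c i * g i x) \<in> class_T"
  shows "(\<lambda>N. L2_norm M (\<lambda>x.
            (\<Sum>n=1..N. koopman_prod M l T (\<lambda>i. \<lfloor>g i (real n)\<rfloor>) f x) / of_nat N
            - L2_proj M (invariant_L2 M l T) f x))
         \<longlonglongrightarrow> 0"
proof -
  interpret commuting_system M l T by standard (rule assms(2))
  note f = assms(3)
  define p where "p = L2_proj M V f"
  define f' where "f' x = f x - p x" for x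
  define k where "k n i = \<lfloor>g i (real n)\<rfloor>" for n i
  define a where "a N x = (\<Sum>n=1..N. f (translate (k n) x)) / of_nat N - p x" for N x
  have p: "p \<in> V" unfolding p_def by (rule L2_proj_properties[OF f])
  have f': "f' \<in> L2_space M" unfolding f'_def by (intro L2_diff f V_L2 p)
  have "(\<lambda>N. nsq M (\<lambda>x. 1 / of_nat N * (\<Sum>n=1..N. f' (translate (k n) x)))) \<longlonglongrightarrow> 0"
  proof (rule averages_tendsto_zero[OF f'])
    show "L2_inner M f' h = 0" if "h \<in> V" for h
      using L2_proj_properties(2)[OF f that] by (simp add: f'_def[abs_def] p_def)
    show "has_mean (\<lambda>n. chr l (k n) \<theta>) 0" if "\<exists>i\<in>{1..l}. \<theta> i \<notin> \<int>" for \<theta>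
      unfolding k_def[abs_def]
      by (rule floor_mean[where y = "\<lambda>i n. g i (real n)", OF class_T_mean[OF assms(6)] that])
  qed
  moreover have "nsq M (\<lambda>x. 1 / of_nat N * (\<Sum>n=1..N. f' (translate (k n) x))) = nsq M (a N)" if "N > 0" for N
  proof -
    \<comment> \<open>An average of the invariant \<open>p\<close> is \<open>p\<close>, off a null
      set common to the finitely many translates. For \<open>N = 0\<close> division by zero would
      make the average 0 and leave \<open>- p\<close>.\<close>
    have "AE x in M. \<forall>n\<in>{1..N}. p (translate (k n) x) = p x"
      using V_translate[OF p] by (intro AE_ball_countable[THEN iffD2]) auto
    then have "AE x in M. 1 / of_nat N * (\<Sum>n=1..N. f' (translate (k n) x)) = a N x"
    proof eventually_elim
      case (elim x)
      then have "(\<Sum>n=1..N. f' (translate (k n) x)) = (\<Sum>n=1..N. f (translate (k n) x)) - of_nat N * p x"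
        by (simp add: f'_def sum_subtractf)
      then show ?case using that by (simp add: a_def diff_divide_distrib)
    qed
    moreover have "(\<lambda>x. 1 / of_nat N * (\<Sum>n=1..N. f' (translate (k n) x))) \<in> L2_space M"
      by (intro L2_cmult L2_sum translate_L2 f')
    moreover have "(\<lambda>x. 1 / of_nat N * (\<Sum>n=1..N. f (translate (k n) x)) - p x) \<in> L2_space M"
      by (intro L2_diff L2_cmult L2_sum translate_L2 f V_L2 p)
    then have "a N \<in> L2_space M" by (simp add: a_def[abs_def])
    ultimately show ?thesis unfolding nsq_def
      by (intro integral_cong_AE) (auto dest!: L2_measurable L2_integrable borel_measurable_integrable elim!: eventually_mono)
  qed
  ultimately have "(\<lambda>N. nsq M (a N)) \<longlonglongrightarrow> 0"
    by (rule Lim_transform_eventually[OF _ eventually_mono[OF eventually_gt_at_top[of 0]]])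
  from tendsto_real_sqrt[OF this] show ?thesis
    by (simp add: L2_norm_def nsq_def koopman_prod_eq a_def[abs_def] k_def[abs_def] p_def)
qed

end
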